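(* Let $\mathbb{F}$ be a field, $G$ a finite simple graph and $R\subseteq V(G)$. Then: (i) The algebra $\mathcal{H}(G,R)$ is semisimple if and only if $R=\emptyset$. (ii) For any $I\in\mathcal{I}(G-R)$ one has $\mathbf{P}_I(G,R)\cong\mathcal{H}(G,R)\otimes_{\mathcal{H}(G-R,\emptyset)}\mathbf{C}_I(G-R,\emptyset)$ as $\mathcal{H}(G,R)$-modules. (iii) For any $I\in\mathcal{I}(G-R)$, the socle of $\mathbf{P}_I(G,R)$ is the direct sum of the subspaces $\mathbb{F}X_{I+J}X^-_{G-R-I}\cong\mathbf{C}_I(G,R)$ over all (inclusion-)maximal $J$ in $\mathcal{I}(R-N(I))$. (iv) The Cartan matrix of $\mathcal{H}(G,R)$ is the diagonal matrix $\operatorname{diag}\{|\mathcal{I}(R-N(I))|: I\in\mathcal{I}(G-R)\}$. (v) A complete set of primitive orthogonal idempotents of $\mathcal{H}(G,R)$ is given by $\{X_IX^-_{G-R-I}: I\in\mathcal{I}(G-R)\}$.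
   Context: For a finite simple graph $G$ with vertex set $V(G)$ and edge set $E(G)$, and $R\subseteq V(G)$, $\mathcal{H}(G,R)$ is the quotient of the polynomial algebra $\mathbb{F}[x_v:v\in V(G)]$ by the ideal generated by $\{x_r^2:r\in R\}\cup\{x_v^2-x_v:v\in V(G)\setminus R\}\cup\{x_ux_v:uv\in E(G)\}$. The image of $x_v$ is still denoted $x_v$, and $x_v^-:=1-x_v$. For $U\subseteq V(G)$, $X_U:=\prod_{u\in U}x_u$ and $X_U^-:=\prod_{u\in U}x_u^-$; $N(U)$ is the set of all vertices adjacent in $G$ to some $u\in U$. The symbols $+$ and $-$ denote union and difference of sets, and a subset $U\subseteq V(G)$ is identified with the subgraph of $G$ it induces; thus $G-R$ is the subgraph induced by $V(G)\setminus R$. $\mathcal{I}(\cdot)$ denotes the set of all independent sets (including $\emptyset$) of a graph. The algebra $\mathcal{H}(G-R,\emptyset)$ is identified with the subalgebra of $\mathcal{H}(G,R)$ generated by $\{x_v:v\in V(G)\setminus R\}$. For $I\in\mathcal{I}(G-R)$, $\mathbf{P}_I(G,R):=\mathcal{H}(G,R)X_IX^-_{G-R-I}$, and $\mathbf{C}_I(G,R)$ is the one-dimensional $\mathcal{H}(G,R)$-module on which $x_v$ acts by $1$ if $v\in I$ and by $0$ if $v\notin I$. The modules $\mathbf{P}_I(G,R)$ (respectively $\mathbf{C}_I(G,R)$), $I\in\mathcal{I}(G-R)$, form a complete list of pairwise non-isomorphic projective indecomposable (respectively simple) $\mathcal{H}(G,R)$-modules, with $\mathbf{C}_I(G,R)$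 the top of $\mathbf{P}_I(G,R)$. The Cartan matrix has entries $a_{IJ}$ = the multiplicity of $\mathbf{C}_J(G,R)$ among the composition factors of $\mathbf{P}_I(G,R)$. The socle of a module is the sum of its minimal (simple) submodules. *)

theory Defs
  imports
    "HOL-Algebra.QuotRing"
    "HOL-Algebra.Module"
    "HOL-Algebra.Free_Abelian_Groups"
    "HOL-Library.Poly_Mapping"
    "Graph_Theory.Digraph_Component"
begin

text \<open>
  The library's module record extends the ring record; a module only uses the fields
  carrier, zero, add and smult, and mult and one are left undefined below when there is no
  natural choice for them.
\<close>

definition regular_module :: "('a, 'm) ring_scheme \<Rightarrow> ('a, 'a) module" where
  "regular_module A = \<lparr>carrier = carrier A, monoid.mult = monoid.mult A, monoid.one = monoid.one A,
     ring.zero = ring.zero A, ring.add = ring.add A, module.smult = monoid.mult A\<rparr>"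

definition module_iso ::
  "('a, 'm) ring_scheme \<Rightarrow> ('a, 'b, 'n) module_scheme \<Rightarrow> ('a, 'c, 'k) module_scheme \<Rightarrow> bool" where
  "module_iso A M N \<longleftrightarrow> (\<exists>f \<in> iso (add_monoid M) (add_monoid N).
     \<forall>a\<in>carrier A. \<forall>x\<in>carrier M. f (a \<odot>\<^bsub>M\<^esub> x) = a \<odot>\<^bsub>N\<^esub> f x)"

definition simple_module :: "('a, 'm) ring_scheme \<Rightarrow> ('a, 'b, 'n) module_scheme \<Rightarrow> bool" where
  "simple_module A M \<longleftrightarrow> Module.module A M \<and> carrier M \<noteq> {\<zero>\<^bsub>M\<^esub>} \<and>
     (\<forall>N. submodule N A M \<longrightarrow> N = {\<zero>\<^bsub>M\<^esub>} \<or> N = carrier M)"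

text \<open>The family may be infinite (finite sums of members) or empty (the zero submodule).\<close>

definition submodule_sum :: "('a, 'b, 'n) module_scheme \<Rightarrow> 'i set \<Rightarrow> ('i \<Rightarrow> 'b set) \<Rightarrow> 'b set" where
  "submodule_sum M T N = generate (add_monoid M) (\<Union>i\<in>T. N i)"

definition internal_direct_sum ::
  "('a, 'm) ring_scheme \<Rightarrow> ('a, 'b, 'n) module_scheme \<Rightarrow> 'i set \<Rightarrow> ('i \<Rightarrow> 'b set) \<Rightarrow> 'b set \<Rightarrow> bool" where
  "internal_direct_sum A M T N S \<longleftrightarrow>
     (\<forall>i\<in>T. submodule (N i) A M) \<and> S = submodule_sum M T N \<and>
     (\<forall>i\<in>T. N i \<inter> submodule_sum M (T - {i}) N = {\<zero>\<^bsub>M\<^esub>})"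

definition simple_submodules :: "('a, 'm) ring_scheme \<Rightarrow> ('a, 'b, 'n) module_scheme \<Rightarrow> 'b set set" where
  "simple_submodules A M = {N. submodule N A M \<and> simple_module A (M\<lparr>carrier := N\<rparr>)}"

definition semisimple_module :: "('a, 'm) ring_scheme \<Rightarrow> ('a, 'b, 'n) module_scheme \<Rightarrow> bool" where
  "semisimple_module A M \<longleftrightarrow> Module.module A M \<and>
     (\<exists>\<N> \<subseteq> simple_submodules A M. internal_direct_sum A M \<N> (\<lambda>N. N) (carrier M))"

definition semisimple_algebra :: "('a, 'm) ring_scheme \<Rightarrow> bool" where
  "semisimple_algebra A \<longleftrightarrow> semisimple_module A (regular_module A)"

definition socle :: "('a, 'm) ring_scheme \<Rightarrow> ('a, 'b, 'n) module_scheme \<Rightarrow> 'b set" where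
  "socle A M = submodule_sum M (simple_submodules A M) (\<lambda>N. N)"

definition quotient_module :: "('a, 'b, 'n) module_scheme \<Rightarrow> 'b set \<Rightarrow> ('a, 'b set) module" where
  "quotient_module M N = \<lparr>carrier = a_rcosets\<^bsub>M\<^esub> N, monoid.mult = undefined, monoid.one = undefined,
     ring.zero = N, ring.add = set_add M,
     module.smult = (\<lambda>a X. the_elem ((\<lambda>x. N +>\<^bsub>M\<^esub> (a \<odot>\<^bsub>M\<^esub> x)) ` X))\<rparr>"

definition composition_factor :: "('a, 'b, 'n) module_scheme \<Rightarrow> 'b set list \<Rightarrow> nat \<Rightarrow> ('a, 'b set) module" where
  "composition_factor M Ns i = quotient_module (M\<lparr>carrier := Ns ! Suc i\<rparr>) (Ns ! i)"

definition composition_series ::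
  "('a, 'm) ring_scheme \<Rightarrow> ('a, 'b, 'n) module_scheme \<Rightarrow> 'b set list \<Rightarrow> bool" where
  "composition_series A M Ns \<longleftrightarrow>
     Ns \<noteq> [] \<and> hd Ns = {\<zero>\<^bsub>M\<^esub>} \<and> last Ns = carrier M \<and>
     (\<forall>N\<in>set Ns. submodule N A M) \<and>
     (\<forall>i. Suc i < length Ns \<longrightarrow>
        Ns ! i \<subset> Ns ! Suc i \<and> simple_module A (composition_factor M Ns i))"

text \<open>
  By the Jordan-Hoelder theorem the count is the same for all composition series, so that the
  description is unique whenever M has a composition series.
\<close>

definition composition_multiplicity ::
  "('a, 'm) ring_scheme \<Rightarrow> ('a, 'b, 'n) module_scheme \<Rightarrow> ('a, 'c, 'k) module_scheme \<Rightarrow> nat" where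
  "composition_multiplicity A M C = (THE n. \<exists>Ns. composition_series A M Ns \<and>
     n = card {i. Suc i < length Ns \<and> module_iso A (composition_factor M Ns i) C})"

text \<open>
  For a ring homomorphism \<open>\<phi>\<close> from B to A and a B-module N, the A-module obtained by tensoring A
  with N over B: the free abelian group on the pairs (a, n), modulo the bilinearity relations and
  the relation identifying \<open>(a \<phi>(b), n)\<close> with \<open>(a, b n)\<close>; A acts on the left factor.
\<close>

definition tensor_relations ::
  "('b, 'm) ring_scheme \<Rightarrow> ('b \<Rightarrow> 'a) \<Rightarrow> ('a, 'k) ring_scheme \<Rightarrow> ('b, 'c, 'n) module_scheme
    \<Rightarrow> ('a \<times> 'c \<Rightarrow>\<^sub>0 int) set" where
  "tensor_relations B \<phi> A N =
     {frag_of (a \<oplus>\<^bsub>A\<^esub> a', n) - frag_of (a, n) - frag_of (a', n) | a a' n.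
        a \<in> carrier A \<and> a' \<in> carrier A \<and> n \<in> carrier N} \<union>
     {frag_of (a, n \<oplus>\<^bsub>N\<^esub> n') - frag_of (a, n) - frag_of (a, n') | a n n'.
        a \<in> carrier A \<and> n \<in> carrier N \<and> n' \<in> carrier N} \<union>
     {frag_of (a \<otimes>\<^bsub>A\<^esub> \<phi> b, n) - frag_of (a, b \<odot>\<^bsub>N\<^esub> n) | a b n.
        a \<in> carrier A \<and> b \<in> carrier B \<and> n \<in> carrier N}"

definition extension_of_scalars ::
  "('b, 'm) ring_scheme \<Rightarrow> ('b \<Rightarrow> 'a) \<Rightarrow> ('a, 'k) ring_scheme \<Rightarrow> ('b, 'c, 'n) module_scheme
    \<Rightarrow> ('a, ('a \<times> 'c \<Rightarrow>\<^sub>0 int) set) module" where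
  "extension_of_scalars B \<phi> A N =
     (let F = free_Abelian_group (carrier A \<times> carrier N);
          K = generate F (tensor_relations B \<phi> A N)
      in \<lparr>carrier = carrier (F Mod K), monoid.mult = undefined, monoid.one = undefined,
          ring.zero = monoid.one (F Mod K), ring.add = monoid.mult (F Mod K),
          module.smult = (\<lambda>a X. the_elem
            ((\<lambda>c. K #>\<^bsub>F\<^esub> frag_extend (\<lambda>(a', n). frag_of (a \<otimes>\<^bsub>A\<^esub> a', n)) c) ` X))\<rparr>)"

definition idempotent :: "('a, 'm) ring_scheme \<Rightarrow> 'a \<Rightarrow> bool" where
  "idempotent A e \<longleftrightarrow> e \<in> carrier A \<and> e \<otimes>\<^bsub>A\<^esub> e = e"

definition orthogonal :: "('a, 'm) ring_scheme \<Rightarrow> 'a \<Rightarrow> 'a \<Rightarrow> bool" where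
  "orthogonal A e f \<longleftrightarrow> e \<otimes>\<^bsub>A\<^esub> f = \<zero>\<^bsub>A\<^esub> \<and> f \<otimes>\<^bsub>A\<^esub> e = \<zero>\<^bsub>A\<^esub>"

definition primitive_idempotent :: "('a, 'm) ring_scheme \<Rightarrow> 'a \<Rightarrow> bool" where
  "primitive_idempotent A e \<longleftrightarrow> idempotent A e \<and> e \<noteq> \<zero>\<^bsub>A\<^esub> \<and>
     \<not> (\<exists>f g. idempotent A f \<and> idempotent A g \<and> orthogonal A f g \<and>
          f \<noteq> \<zero>\<^bsub>A\<^esub> \<and> g \<noteq> \<zero>\<^bsub>A\<^esub> \<and> e = f \<oplus>\<^bsub>A\<^esub> g)"

definition complete_primitive_orthogonal_idempotents ::
  "('a, 'm) ring_scheme \<Rightarrow> 'i set \<Rightarrow> ('i \<Rightarrow> 'a) \<Rightarrow> bool" where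
  "complete_primitive_orthogonal_idempotents A T e \<longleftrightarrow> finite T \<and>
     (\<forall>i\<in>T. primitive_idempotent A (e i)) \<and>
     (\<forall>i\<in>T. \<forall>j\<in>T. i \<noteq> j \<longrightarrow> orthogonal A (e i) (e j)) \<and>
     (\<Oplus>\<^bsub>A\<^esub>i\<in>T. e i) = \<one>\<^bsub>A\<^esub>"

text \<open>
  A finite simple graph is a loop-free symmetric digraph without parallel arcs (locale graph of
  Graph_Theory); the edge uv is the pair of arcs from u to v and from v to u.
\<close>

definition neighbours :: "('v, 'e) pre_digraph \<Rightarrow> 'v set \<Rightarrow> 'v set" where
  "neighbours G U = {v. \<exists>u\<in>U. u \<rightarrow>\<^bsub>G\<^esub> v}"

definition independent_sets :: "('v, 'e) pre_digraph \<Rightarrow> 'v set set" where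
  "independent_sets G = {I. I \<subseteq> verts G \<and> (\<forall>u\<in>I. \<forall>v\<in>I. \<not> u \<rightarrow>\<^bsub>G\<^esub> v)}"

definition maximal_independent_sets :: "('v, 'e) pre_digraph \<Rightarrow> 'v set set" where
  "maximal_independent_sets G =
     {J \<in> independent_sets G. \<forall>J' \<in> independent_sets G. J \<subseteq> J' \<longrightarrow> J' = J}"

text \<open>
  Polynomials in variables from 'v are finitely supported functions from monomials to
  coefficients, monomials being finitely supported exponent functions.
\<close>

type_synonym ('v, 'f) mpoly = "('v \<Rightarrow>\<^sub>0 nat) \<Rightarrow>\<^sub>0 'f"

definition poly_ring :: "'v set \<Rightarrow> ('v, 'f::field) mpoly ring" where
  "poly_ring V = \<lparr>carrier = {p. \<forall>m \<in> Poly_Mapping.keys p. Poly_Mapping.keys m \<subseteq> V},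
     monoid.mult = (*), monoid.one = 1, ring.zero = 0, ring.add = (+)\<rparr>"

definition pconst :: "'f::field \<Rightarrow> ('v, 'f) mpoly" where
  "pconst c = Poly_Mapping.single 0 c"

definition pvar :: "'v \<Rightarrow> ('v, 'f::field) mpoly" where
  "pvar v = Poly_Mapping.single (Poly_Mapping.single v 1) 1"

definition poly_eval :: "('v \<Rightarrow> 'f) \<Rightarrow> ('v, 'f::field) mpoly \<Rightarrow> 'f" where
  "poly_eval a p = (\<Sum>m \<in> Poly_Mapping.keys p. Poly_Mapping.lookup p m *
     (\<Prod>v \<in> Poly_Mapping.keys m. a v ^ Poly_Mapping.lookup m v))"

definition hecke_ideal :: "('v, 'e) pre_digraph \<Rightarrow> 'v set \<Rightarrow> ('v, 'f::field) mpoly set" where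
  "hecke_ideal G R = Idl\<^bsub>poly_ring (verts G)\<^esub>
     ({(pvar r)\<^sup>2 | r. r \<in> R} \<union>
      {(pvar v)\<^sup>2 - pvar v | v. v \<in> verts G - R} \<union>
      {pvar u * pvar v | u v. u \<rightarrow>\<^bsub>G\<^esub> v})"

definition hecke_algebra :: "('v, 'e) pre_digraph \<Rightarrow> 'v set \<Rightarrow> ('v, 'f::field) mpoly set ring" where
  "hecke_algebra G R = poly_ring (verts G) Quot hecke_ideal G R"

definition hecke_class :: "('v, 'e) pre_digraph \<Rightarrow> 'v set \<Rightarrow> ('v, 'f::field) mpoly \<Rightarrow> ('v, 'f) mpoly set" where
  "hecke_class G R p = hecke_ideal G R +>\<^bsub>poly_ring (verts G)\<^esub> p"

definition hecke_gen :: "('v, 'e) pre_digraph \<Rightarrow> 'v set \<Rightarrow> 'v \<Rightarrow> ('v, 'f::field) mpoly set" where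
  "hecke_gen G R v = hecke_class G R (pvar v)"

definition X_plus :: "('v, 'e) pre_digraph \<Rightarrow> 'v set \<Rightarrow> 'v set \<Rightarrow> ('v, 'f::field) mpoly set" where
  "X_plus G R U = (\<Otimes>\<^bsub>hecke_algebra G R\<^esub>u\<in>U. hecke_gen G R u)"

definition X_minus :: "('v, 'e) pre_digraph \<Rightarrow> 'v set \<Rightarrow> 'v set \<Rightarrow> ('v, 'f::field) mpoly set" where
  "X_minus G R U = (\<Otimes>\<^bsub>hecke_algebra G R\<^esub>u\<in>U.
     \<one>\<^bsub>hecke_algebra G R\<^esub> \<ominus>\<^bsub>hecke_algebra G R\<^esub> hecke_gen G R u)"

definition scalar_line ::
  "('v, 'e) pre_digraph \<Rightarrow> 'v set \<Rightarrow> ('v, 'f::field) mpoly set \<Rightarrow> ('v, 'f) mpoly set set" where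
  "scalar_line G R h = {hecke_class G R (pconst c) \<otimes>\<^bsub>hecke_algebra G R\<^esub> h | c. True}"

definition P_module ::
  "('v, 'e) pre_digraph \<Rightarrow> 'v set \<Rightarrow> 'v set
    \<Rightarrow> (('v, 'f::field) mpoly set, ('v, 'f) mpoly set) module" where
  "P_module G R I = (regular_module (hecke_algebra G R))
     \<lparr>carrier := PIdl\<^bsub>hecke_algebra G R\<^esub>
        (X_plus G R I \<otimes>\<^bsub>hecke_algebra G R\<^esub> X_minus G R (verts G - R - I))\<rparr>"

text \<open>
  The underlying space is the field, and the class of a polynomial acts through its value at the
  indicator function of I. This formula mentions neither G nor R, so the same record serves for
  every algebra in which the indicator function of I is a zero of the defining ideal.
\<close>

definition C_module :: "'v set \<Rightarrow> (('v, 'f::field) mpoly set, 'f) module" where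
  "C_module I = \<lparr>carrier = UNIV, monoid.mult = (*), monoid.one = 1, ring.zero = 0, ring.add = (+),
     module.smult = (\<lambda>h c. the_elem (poly_eval (\<lambda>v. if v \<in> I then 1 else 0) ` h) * c)\<rparr>"

definition cartan_entry :: "'f::field itself \<Rightarrow> ('v, 'e) pre_digraph \<Rightarrow> 'v set \<Rightarrow> 'v set \<Rightarrow> 'v set \<Rightarrow> nat" where
  "cartan_entry _ G R I J = composition_multiplicity
     (hecke_algebra G R :: ('v, 'f) mpoly set ring) (P_module G R I) (C_module J)"

text \<open>
  The homomorphism sending \<open>x\<^sub>v\<close> to \<open>x\<^sub>v\<close>, by which the algebra of \<open>G - R\<close> is identified with a
  subalgebra of the algebra of G.
\<close>

definition hecke_incl ::
  "('v, 'e) pre_digraph \<Rightarrow> 'v set \<Rightarrow> ('v, 'f::field) mpoly set \<Rightarrow> ('v, 'f) mpoly set" where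
  "hecke_incl G R h = the_elem (hecke_class G R ` h)"

lemma poly_ring_cring: "cring (poly_ring V)"
proof (rule cringI)
  have add: "Poly_Mapping.keys m \<subseteq> V"
    if "m \<in> Poly_Mapping.keys (p + q)" "\<forall>m \<in> Poly_Mapping.keys p. Poly_Mapping.keys m \<subseteq> V"
       "\<forall>m \<in> Poly_Mapping.keys q. Poly_Mapping.keys m \<subseteq> V" for m and p q :: "('a, 'b) mpoly"
    using that Poly_Mapping.keys_add[of p q] by blast
  have mult: "Poly_Mapping.keys m \<subseteq> V"
    if mk: "m \<in> Poly_Mapping.keys (p * q)" "\<forall>m \<in> Poly_Mapping.keys p. Poly_Mapping.keys m \<subseteq> V"
       "\<forall>m \<in> Poly_Mapping.keys q. Poly_Mapping.keys m \<subseteq> V" for m and p q :: "('a, 'b) mpoly"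
  proof -
    obtain a b where "m = a + b" "a \<in> Poly_Mapping.keys p" "b \<in> Poly_Mapping.keys q"
      using mk Poly_Mapping.keys_mult[of p q] by blast
    then show ?thesis using that(2,3) Poly_Mapping.keys_add[of a b] by blast
  qed
  show "abelian_group (poly_ring V :: ('a, 'b) mpoly ring)"
  proof (rule abelian_groupI)
    fix p :: "('a, 'b) mpoly" assume "p \<in> carrier (poly_ring V)"
    then show "\<exists>q\<in>carrier (poly_ring V). q \<oplus>\<^bsub>poly_ring V\<^esub> p = \<zero>\<^bsub>poly_ring V\<^esub>"
      by (intro bexI[of _ "- p"]) (auto simp: poly_ring_def Poly_Mapping.in_keys_iff)
  qed (use add in \<open>auto simp: poly_ring_def ac_simps\<close>)
  show "Group.comm_monoid (poly_ring V :: ('a, 'b) mpoly ring)"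
    using mult by (auto intro!: comm_monoidI simp: poly_ring_def ac_simps)
qed (auto simp: poly_ring_def distrib_right)

lemma poly_eval_eq_Sum:
  assumes "finite S" "Poly_Mapping.keys p \<subseteq> S"
  shows "poly_eval a p = (\<Sum>m\<in>S. Poly_Mapping.lookup p m *
     (\<Prod>v \<in> Poly_Mapping.keys m. a v ^ Poly_Mapping.lookup m v))"
  unfolding poly_eval_def using assms
  by (intro sum.mono_neutral_left) (auto simp: Poly_Mapping.in_keys_iff)

lemma poly_eval_add: "poly_eval a (p + q) = poly_eval a p + poly_eval a q"
proof -
  let ?S = "Poly_Mapping.keys p \<union> Poly_Mapping.keys q"
  have "Poly_Mapping.keys (p + q) \<subseteq> ?S" by (rule Poly_Mapping.keys_add)
  then show ?thesis
    by (simp add: poly_eval_eq_Sum[of ?S] lookup_add distrib_right sum.distrib)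
qed

lemma poly_eval_single:
  "poly_eval a (Poly_Mapping.single m c) = c * (\<Prod>v \<in> Poly_Mapping.keys m. a v ^ Poly_Mapping.lookup m v)"
  by (cases "c = 0") (simp_all add: poly_eval_def)

lemma monomial_add:
  fixes a :: "'v \<Rightarrow> 'f::field"
  shows "(\<Prod>v \<in> Poly_Mapping.keys (m + n). a v ^ Poly_Mapping.lookup (m + n) v) =
    (\<Prod>v \<in> Poly_Mapping.keys m. a v ^ Poly_Mapping.lookup m v) *
    (\<Prod>v \<in> Poly_Mapping.keys n. a v ^ Poly_Mapping.lookup n v)"
proof -
  let ?S = "Poly_Mapping.keys m \<union> Poly_Mapping.keys n"
  have *: "(\<Prod>v \<in> Poly_Mapping.keys k. a v ^ Poly_Mapping.lookup k v) = (\<Prod>v \<in> ?S. a v ^ Poly_Mapping.lookup k v)"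
    if "Poly_Mapping.keys k \<subseteq> ?S" for k
    using that by (intro prod.mono_neutral_left) (auto simp: Poly_Mapping.in_keys_iff)
  show ?thesis
    unfolding *[OF Poly_Mapping.keys_add[of m n]] *[of m, OF Un_upper1] *[of n, OF Un_upper2]
    by (simp add: lookup_add power_add prod.distrib)
qed

lemma poly_eval_0: "poly_eval a 0 = 0" by (simp add: poly_eval_def)

lemma mpoly_induct:
  fixes p :: "'a \<Rightarrow>\<^sub>0 'b::comm_monoid_add"
  assumes "P 0" and step: "\<And>k v p. P p \<Longrightarrow> P (Poly_Mapping.single k v + p)"
  shows "P p"
proof (induction p rule: Poly_Mapping.update_induct)
  case const
  show ?case by (rule assms(1))
next
  case (update f a b)
  have "Poly_Mapping.update a b f = Poly_Mapping.single a b + f"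
    using update(1) by (intro poly_mapping_eqI) (auto simp: lookup_add lookup_single lookup_update when_def Poly_Mapping.in_keys_iff)
  then show ?case using step update by simp
qed

lemma poly_eval_mult: "poly_eval a (p * q) = poly_eval a p * poly_eval a q"
proof (induction p rule: mpoly_induct)
  case 1
  show ?case by (simp add: poly_eval_0)
next
  case (2 k v p)
  have "poly_eval a (Poly_Mapping.single k v * q) = poly_eval a (Poly_Mapping.single k v) * poly_eval a q"
  proof (induction q rule: mpoly_induct)
    case 1
    show ?case by (simp add: poly_eval_0)
  next
    case (2 k' v' q)
    then show ?case
      by (simp add: distrib_left poly_eval_add mult_single poly_eval_single monomial_add ac_simps)
  qed
  with 2 show ?case by (simp add: distrib_right poly_eval_add)
qed

lemma poly_eval_var: "poly_eval a (pvar v) = a v"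
  by (simp add: pvar_def poly_eval_single)

lemma poly_eval_const: "poly_eval a (pconst c) = c"
  by (simp add: pconst_def poly_eval_single)

lemma poly_eval_1: "poly_eval a 1 = 1"
  using poly_eval_const[of a 1] by (simp add: pconst_def)

lemma poly_eval_uminus: "poly_eval a (- p) = - poly_eval a p"
  using poly_eval_add[of a p "- p"] by (simp add: poly_eval_0 eq_neg_iff_add_eq_0 add.commute)

lemma poly_eval_diff: "poly_eval a (p - q) = poly_eval a p - poly_eval a q"
  using poly_eval_add[of a p "- q"] by (simp add: poly_eval_uminus)

text \<open>The points at which all generators of the defining ideal vanish.\<close>

definition hecke_zero :: "('v, 'e) pre_digraph \<Rightarrow> 'v set \<Rightarrow> ('v \<Rightarrow> 'f::field) \<Rightarrow> bool" where
  "hecke_zero G R a \<longleftrightarrow> (\<forall>r\<in>R. a r = 0) \<and> (\<forall>v\<in>verts G - R. a v = 0 \<or> a v = 1)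
    \<and> (\<forall>u v. u \<rightarrow>\<^bsub>G\<^esub> v \<longrightarrow> a u = 0 \<or> a v = 0)"

lemma pvar_closed: "v \<in> V \<Longrightarrow> pvar v \<in> carrier (poly_ring V)"
  by (auto simp: poly_ring_def pvar_def)

lemma hecke_relations_closed:
  assumes "wf_digraph G" "R \<subseteq> verts G"
  shows "({(pvar r)\<^sup>2 | r. r \<in> R} \<union>
      {(pvar v)\<^sup>2 - pvar v | v. v \<in> verts G - R} \<union>
      {pvar u * pvar v | u v. u \<rightarrow>\<^bsub>G\<^esub> v}) \<subseteq> carrier (poly_ring (verts G))" (is "?S \<subseteq> carrier ?P")
proof -
  interpret cring "?P :: ('a,'c) mpoly ring" by (rule poly_ring_cring)
  have m: "p * q \<in> carrier ?P" if "p \<in> carrier ?P" "q \<in> carrier ?P" for p q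
    using m_closed[OF that] by (simp add: poly_ring_def)
  have d: "p - q \<in> carrier ?P" if "p \<in> carrier ?P" "q \<in> carrier ?P" for p q
    using that Poly_Mapping.keys_diff[of p q] by (auto simp: poly_ring_def)
  show ?thesis using assms by (auto simp: power2_eq_square intro!: m d pvar_closed dest: wf_digraph.adj_in_verts)
qed

lemma hecke_ideal_ideal:
  fixes G :: "('v,'e) pre_digraph"
  assumes "wf_digraph G" "R \<subseteq> verts G"
  shows "ideal (hecke_ideal G R :: ('v,'f::field) mpoly set) (poly_ring (verts G))"
proof -
  interpret cring "poly_ring (verts G) :: ('v,'f::field) mpoly ring" by (rule poly_ring_cring)
  show ?thesis unfolding hecke_ideal_def by (rule genideal_ideal[OF hecke_relations_closed[OF assms]])
qed

lemma hecke_cring: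
  fixes G :: "('v,'e) pre_digraph"
  assumes "wf_digraph G" "R \<subseteq> verts G"
  shows "cring (hecke_algebra G R :: ('v,'f::field) mpoly set ring)"
  unfolding hecke_algebra_def by (rule ideal.quotient_is_cring[OF hecke_ideal_ideal[OF assms] poly_ring_cring])

lemma poly_eval_hecke_ideal:
  fixes G :: "('v,'e) pre_digraph"
  assumes "wf_digraph G" "R \<subseteq> verts G" "hecke_zero G R a" "p \<in> hecke_ideal G R"
  shows "poly_eval a p = (0::'f::field)"
proof -
  interpret cring "poly_ring (verts G) :: ('v,'f) mpoly ring" by (rule poly_ring_cring)
  let ?P = "poly_ring (verts G) :: ('v,'f) mpoly ring"
  let ?K = "{p \<in> carrier ?P. poly_eval a p = 0}"
  have inv: "\<ominus>\<^bsub>?P\<^esub> p = - p" if "p \<in> carrier ?P" for p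
    using that by (intro minus_equality) (auto simp: poly_ring_def)
  have "ideal ?K ?P"
  proof (rule idealI)
    show "subgroup ?K (add_monoid ?P)"
    proof (rule add.subgroupI)
      show "?K \<noteq> {}" using zero_closed by (auto simp: poly_ring_def poly_eval_0 intro: exI[of _ 0])
    next
      fix p assume "p \<in> ?K" then show "\<ominus>\<^bsub>?P\<^esub> p \<in> ?K" using a_inv_closed[of p] by (simp add: inv poly_eval_uminus)
    next
      fix p q assume "p \<in> ?K" "q \<in> ?K" then show "p \<oplus>\<^bsub>?P\<^esub> q \<in> ?K"
        using a_closed[of p q] by (simp add: poly_eval_add) (simp add: poly_ring_def poly_eval_add)
    qed auto
  next
    show "ring ?P" by (rule ring_axioms)
  next
    fix p q assume "p \<in> ?K" "q \<in> carrier ?P"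
    then show "q \<otimes>\<^bsub>?P\<^esub> p \<in> ?K" "p \<otimes>\<^bsub>?P\<^esub> q \<in> ?K"
      using m_closed[of p q] m_closed[of q p] by simp_all (simp_all add: poly_ring_def poly_eval_mult)
  qed
  moreover have "({(pvar r)\<^sup>2 | r. r \<in> R} \<union>
      {(pvar v)\<^sup>2 - pvar v | v. v \<in> verts G - R} \<union>
      {pvar u * pvar v | u v. u \<rightarrow>\<^bsub>G\<^esub> v}) \<subseteq> ?K" (is "?S \<subseteq> _")
  proof (intro subsetI CollectI conjI)
    fix p assume p: "p \<in> ?S"
    show "p \<in> carrier ?P" using hecke_relations_closed[OF assms(1,2)] p by (rule subsetD)
    show "poly_eval a p = 0" using p assms(3)
      by (auto simp: power2_eq_square poly_eval_mult poly_eval_diff poly_eval_var hecke_zero_def)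
  qed
  ultimately show ?thesis using assms(4) unfolding hecke_ideal_def genideal_def by blast
qed

lemma the_elem_poly_eval:
  fixes G :: "('v,'e) pre_digraph"
  assumes "wf_digraph G" "R \<subseteq> verts G" "hecke_zero G R a"
  shows "the_elem (poly_eval a ` hecke_class G R p) = (poly_eval a p :: 'f::field)"
proof -
  interpret ideal "hecke_ideal G R :: ('v,'f) mpoly set" "poly_ring (verts G)" by (rule hecke_ideal_ideal[OF assms(1,2)])
  have "poly_eval a ` hecke_class G R p = {poly_eval a p}"
    using additive_subgroup.zero_closed[OF is_additive_subgroup] poly_eval_hecke_ideal[OF assms]
    by (force simp: hecke_class_def a_r_coset_def' poly_ring_def poly_eval_add)
  then show ?thesis by simp
qed

lemma indicator_hecke_zero:
  assumes "graph G" "I \<in> independent_sets (G \<restriction> (verts G - R))"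
  shows "hecke_zero G R (\<lambda>v. if v \<in> I then 1 else (0::'f::field))"
proof -
  interpret graph G by fact
  show ?thesis using assms(2)
    by (auto simp: hecke_zero_def independent_sets_def arcs_ends_conv arc_to_ends_def) fast
qed

lemma C_module_smult:
  assumes "graph G" "R \<subseteq> verts G" "I \<in> independent_sets (G \<restriction> (verts G - R))"
  shows "hecke_class G R p \<odot>\<^bsub>C_module I\<^esub> c = poly_eval (\<lambda>v. if v \<in> I then 1 else 0) p * (c::'f::field)"
proof -
  interpret graph G by fact
  show ?thesis by (simp add: C_module_def the_elem_poly_eval[OF wf_digraph assms(2) indicator_hecke_zero[OF assms(1,3)]])
qed

lemma C_module_smult_gen:
  assumes "graph G" "R \<subseteq> verts G" "I \<in> independent_sets (G \<restriction> (verts G - R))"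
  shows "hecke_gen G R v \<odot>\<^bsub>C_module I\<^esub> c = (if v \<in> I then c else (0::'f::field))"
  by (simp add: hecke_gen_def C_module_smult[OF assms] poly_eval_var)

lemma C_module_module:
  assumes "graph G" "R \<subseteq> verts G" "I \<in> independent_sets (G \<restriction> (verts G - R))"
  shows "Module.module (hecke_algebra G R :: ('v,'f::field) mpoly set ring) (C_module I)"
proof -
  interpret graph G by fact
  let ?J = "hecke_ideal G R :: ('v,'f) mpoly set" and ?P = "poly_ring (verts G) :: ('v,'f) mpoly ring"
  interpret J: ideal ?J ?P by (rule hecke_ideal_ideal[OF wf_digraph assms(2)])
  have h: "hecke_class G R \<in> ring_hom ?P (hecke_algebra G R)"
    using J.rcos_ring_hom unfolding hecke_algebra_def hecke_class_def .
  have c: "\<exists>p \<in> carrier ?P. x = hecke_class G R p" if "x \<in> carrier (hecke_algebra G R)" for x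
    using that by (auto simp: hecke_algebra_def FactRing_def A_RCOSETS_def' hecke_class_def)
  show ?thesis
  proof (rule Module.moduleI)
    show "cring (hecke_algebra G R :: ('v,'f) mpoly set ring)" by (rule hecke_cring[OF wf_digraph assms(2)])
    show "abelian_group (C_module I :: (('v,'f) mpoly set, 'f) module)"
      by (rule abelian_groupI) (auto simp: C_module_def intro: exI[of _ "- x" for x])
  next
    fix x y :: "('v,'f) mpoly set" and d :: 'f
    assume xy: "x \<in> carrier (hecke_algebra G R)" "y \<in> carrier (hecke_algebra G R)"
    obtain p q where p: "p \<in> carrier ?P" "x = hecke_class G R p" and q: "q \<in> carrier ?P" "y = hecke_class G R q"
      using c[OF xy(1)] c[OF xy(2)] by blast
    have "x \<oplus>\<^bsub>hecke_algebra G R\<^esub> y = hecke_class G R (p + q)" "x \<otimes>\<^bsub>hecke_algebra G R\<^esub> y = hecke_class G R (p * q)"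
      using ring_hom_add[OF h p(1) q(1)] ring_hom_mult[OF h p(1) q(1)] p q by (simp_all add: poly_ring_def)
    then show "(x \<oplus>\<^bsub>hecke_algebra G R\<^esub> y) \<odot>\<^bsub>C_module I\<^esub> d = x \<odot>\<^bsub>C_module I\<^esub> d \<oplus>\<^bsub>C_module I\<^esub> y \<odot>\<^bsub>C_module I\<^esub> d"
      "(x \<otimes>\<^bsub>hecke_algebra G R\<^esub> y) \<odot>\<^bsub>C_module I\<^esub> d = x \<odot>\<^bsub>C_module I\<^esub> (y \<odot>\<^bsub>C_module I\<^esub> d)"
      using p q by (simp_all add: C_module_smult[OF assms] poly_eval_add poly_eval_mult distrib_right)
        (simp add: C_module_def)
  next
    fix d :: 'f
    have "\<one>\<^bsub>hecke_algebra G R\<^esub> = (hecke_class G R 1 :: ('v,'f) mpoly set)"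
      using ring_hom_one[OF h] by (simp add: poly_ring_def)
    then show "\<one>\<^bsub>hecke_algebra G R\<^esub> \<odot>\<^bsub>(C_module I :: (('v,'f) mpoly set, 'f) module)\<^esub> d = d"
      by (simp add: C_module_smult[OF assms] poly_eval_1)
  qed (auto simp: C_module_def distrib_left)
qed

lemma hecke_incl_class:
  fixes G :: "('v,'e) pre_digraph" and p :: "('v,'f::field) mpoly"
  assumes "graph G" "R \<subseteq> verts G"
  shows "hecke_incl G R (hecke_class (G \<restriction> (verts G - R)) {} p) = hecke_class G R p"
proof -
  interpret graph G by fact
  let ?G = "G \<restriction> (verts G - R)"
  let ?J = "hecke_ideal G R :: ('v,'f) mpoly set" and ?P = "poly_ring (verts G) :: ('v,'f) mpoly ring"
  let ?J' = "hecke_ideal ?G {} :: ('v,'f) mpoly set" and ?P' = "poly_ring (verts ?G) :: ('v,'f) mpoly ring"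
  interpret P: cring ?P by (rule poly_ring_cring)
  interpret J: ideal ?J ?P by (rule hecke_ideal_ideal[OF wf_digraph assms(2)])
  interpret P': cring ?P' by (rule poly_ring_cring)
  have wf': "wf_digraph ?G" by (intro wellformed_induce_subgraph)
  interpret J': ideal ?J' ?P' by (rule hecke_ideal_ideal[OF wf']) simp
  have sub: "carrier ?P' \<subseteq> carrier ?P" by (auto simp: poly_ring_def)
  have ops: "\<zero>\<^bsub>?P'\<^esub> = \<zero>\<^bsub>?P\<^esub>" "monoid.mult ?P' = monoid.mult ?P" "ring.add ?P' = ring.add ?P"
    by (simp_all add: poly_ring_def)
  have inv: "\<ominus>\<^bsub>?P'\<^esub> p = - p" if "p \<in> carrier ?P'" for p
    using that by (intro P'.minus_equality) (auto simp: poly_ring_def)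
  have inv2: "\<ominus>\<^bsub>?P\<^esub> p = - p" if "p \<in> carrier ?P" for p
    using that by (intro P.minus_equality) (auto simp: poly_ring_def)
  have "ideal (?J \<inter> carrier ?P') ?P'"
  proof (rule idealI)
    show "ring ?P'" by (rule P'.ring_axioms)
    show "subgroup (?J \<inter> carrier ?P') (add_monoid ?P')"
    proof (rule P'.add.subgroupI)
      show "?J \<inter> carrier ?P' \<noteq> {}" using J.zero_closed P'.zero_closed unfolding ops by blast
    next
      fix a assume "a \<in> ?J \<inter> carrier ?P'"
      then show "\<ominus>\<^bsub>?P'\<^esub> a \<in> ?J \<inter> carrier ?P'"
        using J.a_inv_closed[of a] P'.a_inv_closed[of a] inv[of a] inv2[of a] sub by auto
    next
      fix a b assume "a \<in> ?J \<inter> carrier ?P'" "b \<in> ?J \<inter> carrier ?P'"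
      then show "a \<oplus>\<^bsub>?P'\<^esub> b \<in> ?J \<inter> carrier ?P'"
        using J.a_closed[of a b] P'.a_closed[of a b] unfolding ops by blast
    qed blast
  next
    fix a x assume "a \<in> ?J \<inter> carrier ?P'" "x \<in> carrier ?P'"
    then show "x \<otimes>\<^bsub>?P'\<^esub> a \<in> ?J \<inter> carrier ?P'" "a \<otimes>\<^bsub>?P'\<^esub> x \<in> ?J \<inter> carrier ?P'"
      using J.I_l_closed[of a x] J.I_r_closed[of a x] P'.m_closed[of a x] P'.m_closed[of x a] sub
      unfolding ops by blast+
  qed
  moreover have "({(pvar r)\<^sup>2 | r. r \<in> {}} \<union>
      {(pvar v)\<^sup>2 - pvar v | v. v \<in> verts ?G - {}} \<union>
      {pvar u * pvar v | u v. u \<rightarrow>\<^bsub>?G\<^esub> v}) \<subseteq> ?J \<inter> carrier ?P'" (is "?S \<subseteq> _")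
  proof (rule Int_greatest)
    show "?S \<subseteq> carrier ?P'" by (rule hecke_relations_closed[OF wf']) simp
    have "?S \<subseteq> ({(pvar r)\<^sup>2 | r. r \<in> R} \<union>
      {(pvar v)\<^sup>2 - pvar v | v. v \<in> verts G - R} \<union>
      {pvar u * pvar v | u v. u \<rightarrow>\<^bsub>G\<^esub> v})"
      (is "_ \<subseteq> ?T")
    proof (intro Un_least)
      show "{pvar u * pvar v | u v. u \<rightarrow>\<^bsub>?G\<^esub> v} \<subseteq> ?T"
        by (blast dest: dominates_induce_subgraphD)
    qed auto
    also have "\<dots> \<subseteq> ?J" unfolding hecke_ideal_def by (rule P.genideal_self[OF hecke_relations_closed[OF wf_digraph assms(2)]])
    finally show "?S \<subseteq> ?J" .
  qed
  ultimately have JJ: "?J' \<subseteq> ?J" unfolding hecke_ideal_def[of ?G] genideal_def by blast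
  have cosets: "hecke_class G R q = {j + q | j. j \<in> ?J}" "hecke_class ?G {} q = {j + q | j. j \<in> ?J'}" for q
    by (auto simp: hecke_class_def a_r_coset_def' poly_ring_def)
  have zero: "0 \<in> ?J'" using J'.zero_closed by (simp add: poly_ring_def)
  have plus: "i + j \<in> ?J" if "i \<in> ?J" "j \<in> ?J" for i j
    using J.a_closed[OF that] by (simp add: poly_ring_def)
  have minus: "- j \<in> ?J" if "j \<in> ?J" for j
    using J.a_inv_closed[OF that] inv2[of j] J.a_subset that by auto
  have shift: "hecke_class G R (j + p) = hecke_class G R p" if "j \<in> ?J'" for j
  proof (rule Set.set_eqI)
    have j: "j \<in> ?J" using that JJ by blast
    fix x
    show "x \<in> hecke_class G R (j + p) \<longleftrightarrow> x \<in> hecke_class G R p"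
    proof
      assume "x \<in> hecke_class G R (j + p)"
      then obtain i where "i \<in> ?J" "x = (i + j) + p" unfolding cosets by (auto simp: add.assoc)
      then show "x \<in> hecke_class G R p" unfolding cosets using plus[of i j] j by blast
    next
      assume "x \<in> hecke_class G R p"
      then obtain i where "i \<in> ?J" "x = (i + - j) + (j + p)" unfolding cosets by (auto simp: add.assoc)
      then show "x \<in> hecke_class G R (j + p)" unfolding cosets using plus[of i "- j"] minus[OF j] by blast
    qed
  qed
  have "hecke_class G R ` hecke_class ?G {} p = {hecke_class G R p}"
    unfolding cosets(2)
  proof (intro equalityI subsetI)
    fix y assume "y \<in> hecke_class G R ` {j + p | j. j \<in> ?J'}"
    then show "y \<in> {hecke_class G R p}" using shift by auto
  next
    fix y assume "y \<in> {hecke_class G R p}"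
    then have "y = hecke_class G R (0 + p)" by simp
    then show "y \<in> hecke_class G R ` {j + p | j. j \<in> ?J'}" using zero by blast
  qed
  then show ?thesis by (simp add: hecke_incl_def)
qed

end

theory Submission
  imports
    Defs
    "HOL-Algebra.Multiplicative_Group"
    "HOL-Library.Function_Algebras"
begin

text \<open>
  Substituting 1 for the variables in I and 0 for the other variables outside R, the coefficients of
  the squarefree monomials \<open>X\<^sub>J\<close>, for J independent in \<open>R - N(I)\<close>, are well-defined linear functionals
  on the algebra. They separate its points and are dual to the elements
  \<open>X\<^bsub>I+J\<^esub> X\<^sup>-\<^bsub>G-R-I\<^esub>\<close>, so the algebra is a product over I of local algebras of squarefree polynomials.
  In the block of I every element is a scalar plus a nilpotent, hence every simple subquotient is a
  line isomorphic to \<open>C\<^sub>I\<close>: composition multiplicities are dimensions, the socle is spanned by the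
  basis elements with J maximal, and an idempotent without scalar part in a block vanishes there.
\<close>

section \<open>Modules\<close>

text \<open>Socle, semisimplicity, composition factors and idempotents are treated in the locale
  \<open>coordinate_algebra\<close> from the coordinates alone: equality of elements is tested by
  \<open>lam_inject\<close>, and products are governed by the convolution rule
  \<open>lam_mult\<close>. This rule is multiplication modulo the squares of the variables, read on
  coefficients; it is also why the functionals descend to the quotient, since it makes their common
  kernel an ideal. Separation of points does not go through the dimension of the quotient. The
  relations rewrite each class as a combination of monomials over independent sets, and a minimal
  set occurring in a nonzero combination is seen by some coordinate. Two definitions force extra
  work. Multiplicity is a definite description, so the count has to be shown equal for all
  composition series. The tensor product is a quotient of a free abelian group by generated
  relations, so injectivity of a map into it needs a homomorphism out of it.\<close>

lemma submodule_iff: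
  assumes "Module.module A M"
  shows "submodule N A M \<longleftrightarrow> N \<subseteq> carrier M \<and> \<zero>\<^bsub>M\<^esub> \<in> N \<and> (\<forall>x\<in>N. \<forall>y\<in>N. x \<oplus>\<^bsub>M\<^esub> y \<in> N) \<and>
    (\<forall>a\<in>carrier A. \<forall>x\<in>N. a \<odot>\<^bsub>M\<^esub> x \<in> N)"
proof -
  interpret Module.module A M by fact
  show ?thesis
  proof
    assume N: "submodule N A M"
    then show "N \<subseteq> carrier M \<and> \<zero>\<^bsub>M\<^esub> \<in> N \<and> (\<forall>x\<in>N. \<forall>y\<in>N. x \<oplus>\<^bsub>M\<^esub> y \<in> N) \<and>
      (\<forall>a\<in>carrier A. \<forall>x\<in>N. a \<odot>\<^bsub>M\<^esub> x \<in> N)"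
      using submoduleE[OF N] subgroup.one_closed[OF submodule.axioms(1)[OF N]] by auto
  next
    assume N: "N \<subseteq> carrier M \<and> \<zero>\<^bsub>M\<^esub> \<in> N \<and> (\<forall>x\<in>N. \<forall>y\<in>N. x \<oplus>\<^bsub>M\<^esub> y \<in> N) \<and>
      (\<forall>a\<in>carrier A. \<forall>x\<in>N. a \<odot>\<^bsub>M\<^esub> x \<in> N)"
    \<comment> \<open>Negation is scalar multiplication by - 1, hence the missing clause.\<close>
    have "\<ominus>\<^bsub>M\<^esub> x \<in> N" if "x \<in> N" for x
    proof -
      have "x \<in> carrier M" using N that by blast
      then have "\<ominus>\<^bsub>M\<^esub> x = (\<ominus>\<^bsub>A\<^esub> \<one>\<^bsub>A\<^esub>) \<odot>\<^bsub>M\<^esub> x" by (simp add: smult_l_minus)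
      then show ?thesis using N that by simp
    qed
    with N show "submodule N A M" by (intro submoduleI) auto
  qed
qed

lemma submodule_module:
  "Module.module A M \<Longrightarrow> submodule N A M \<Longrightarrow> Module.module A (M\<lparr>carrier := N\<rparr>)"
  by (rule submodule.submodule_is_module)

lemma submodule_restrict_iff:
  assumes "Module.module A M" "submodule N A M"
  shows "submodule K A (M\<lparr>carrier := N\<rparr>) \<longleftrightarrow> submodule K A M \<and> K \<subseteq> N"
  using assms(2) unfolding submodule_iff[OF assms(1)] submodule_iff[OF submodule_module[OF assms]]
  by auto

text \<open>By commutativity the image of multiplication by a is a submodule, so it is zero or
  everything. If it were everything, every power of a would act surjectively, also the n-th, which
  acts as zero.\<close>

lemma simple_module_nilpotent:
  assumes S: "simple_module A S" and a: "a \<in> carrier A"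
    and nil: "\<And>s. s \<in> carrier S \<Longrightarrow> (a [^]\<^bsub>A\<^esub> (n::nat)) \<odot>\<^bsub>S\<^esub> s = \<zero>\<^bsub>S\<^esub>" and s: "s \<in> carrier S"
  shows "a \<odot>\<^bsub>S\<^esub> s = \<zero>\<^bsub>S\<^esub>"
proof -
  interpret Module.module A S using S by (simp add: simple_module_def)
  let ?N = "(\<lambda>s. a \<odot>\<^bsub>S\<^esub> s) ` carrier S"
  have "submodule ?N A S"
    unfolding submodule_iff[OF module_axioms]
  proof (intro conjI ballI)
    show "?N \<subseteq> carrier S" using a by auto
    have "a \<odot>\<^bsub>S\<^esub> \<zero>\<^bsub>S\<^esub> = \<zero>\<^bsub>S\<^esub>" using a by simp
    then show "\<zero>\<^bsub>S\<^esub> \<in> ?N" by (metis M.zero_closed imageI)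
  next
    fix x y assume "x \<in> ?N" "y \<in> ?N"
    then show "x \<oplus>\<^bsub>S\<^esub> y \<in> ?N" using a by (auto simp: smult_r_distr[symmetric])
  next
    fix b x assume b: "b \<in> carrier A" "x \<in> ?N"
    then obtain t where t: "t \<in> carrier S" "x = a \<odot>\<^bsub>S\<^esub> t" by auto
    then have "b \<odot>\<^bsub>S\<^esub> x = a \<odot>\<^bsub>S\<^esub> (b \<odot>\<^bsub>S\<^esub> t)"
      using a b by (simp add: smult_assoc1[symmetric] R.m_comm)
    then show "b \<odot>\<^bsub>S\<^esub> x \<in> ?N" using b t by auto
  qed
  moreover have "?N \<noteq> carrier S"
  proof
    assume surj: "?N = carrier S"
    have "(\<lambda>s. (a [^]\<^bsub>A\<^esub> k) \<odot>\<^bsub>S\<^esub> s) ` carrier S = carrier S" for k :: nat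
    proof (induction k)
      case (Suc k)
      have "(\<lambda>s. (a [^]\<^bsub>A\<^esub> Suc k) \<odot>\<^bsub>S\<^esub> s) ` carrier S =
        (\<lambda>s. (a [^]\<^bsub>A\<^esub> k) \<odot>\<^bsub>S\<^esub> s) ` ((\<lambda>s. a \<odot>\<^bsub>S\<^esub> s) ` carrier S)"
        using a by (auto simp: image_image smult_assoc1 intro!: image_cong)
      then show ?case using surj Suc by simp
    qed simp
    from this[of n] nil have "carrier S \<subseteq> {\<zero>\<^bsub>S\<^esub>}" by auto
    then have "carrier S = {\<zero>\<^bsub>S\<^esub>}" using M.zero_closed by blast
    then show False using S by (simp add: simple_module_def)
  qed
  ultimately have "?N = {\<zero>\<^bsub>S\<^esub>}" using S by (auto simp: simple_module_def)
  then show ?thesis using s by blast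
qed

lemma simple_moduleI:
  assumes "Module.module A S" "carrier S \<noteq> {\<zero>\<^bsub>S\<^esub>}"
    and "\<And>s t. s \<in> carrier S \<Longrightarrow> s \<noteq> \<zero>\<^bsub>S\<^esub> \<Longrightarrow> t \<in> carrier S \<Longrightarrow> \<exists>a\<in>carrier A. t = a \<odot>\<^bsub>S\<^esub> s"
  shows "simple_module A S"
  unfolding simple_module_def submodule_iff[OF assms(1)]
proof (intro conjI allI impI)
  fix N
  assume N: "N \<subseteq> carrier S \<and> \<zero>\<^bsub>S\<^esub> \<in> N \<and> (\<forall>x\<in>N. \<forall>y\<in>N. x \<oplus>\<^bsub>S\<^esub> y \<in> N) \<and>
    (\<forall>a\<in>carrier A. \<forall>x\<in>N. a \<odot>\<^bsub>S\<^esub> x \<in> N)"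
  show "N = {\<zero>\<^bsub>S\<^esub>} \<or> N = carrier S"
  proof (cases "N = {\<zero>\<^bsub>S\<^esub>}")
    case False
    with N obtain s where "s \<in> N" "s \<noteq> \<zero>\<^bsub>S\<^esub>" by blast
    with N assms(3)[of s] have "carrier S \<subseteq> N" by fast
    with N show ?thesis by blast
  qed simp
qed (use assms in auto)

text \<open>The multiples of s form a submodule, nonzero because it contains s.\<close>

lemma simple_module_generated:
  assumes S: "simple_module A S" and s: "s \<in> carrier S" "s \<noteq> \<zero>\<^bsub>S\<^esub>" and t: "t \<in> carrier S"
  shows "\<exists>a\<in>carrier A. t = a \<odot>\<^bsub>S\<^esub> s"
proof -
  interpret Module.module A S using S by (simp add: simple_module_def)
  let ?N = "(\<lambda>a. a \<odot>\<^bsub>S\<^esub> s) ` carrier A"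
  have "submodule ?N A S"
    unfolding submodule_iff[OF module_axioms]
  proof (intro conjI ballI)
    show "?N \<subseteq> carrier S" using s by auto
    have "\<zero>\<^bsub>A\<^esub> \<odot>\<^bsub>S\<^esub> s = \<zero>\<^bsub>S\<^esub>" using s by simp
    then show "\<zero>\<^bsub>S\<^esub> \<in> ?N" by (metis R.zero_closed imageI)
  next
    fix x y assume "x \<in> ?N" "y \<in> ?N"
    then show "x \<oplus>\<^bsub>S\<^esub> y \<in> ?N" using s by (auto simp: smult_l_distr[symmetric])
  next
    fix b x assume "b \<in> carrier A" "x \<in> ?N"
    then show "b \<odot>\<^bsub>S\<^esub> x \<in> ?N" using s by (auto simp: smult_assoc1[symmetric])
  qed
  moreover have "s \<in> ?N" using s by (auto intro!: image_eqI[of _ _ "\<one>\<^bsub>A\<^esub>"])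
  ultimately have "?N = carrier S" using S s by (auto simp: simple_module_def)
  then show ?thesis using t by blast
qed

section \<open>The regular module and quotient modules\<close>

lemma regular_module_simps [simp]:
  "carrier (regular_module A) = carrier A" "\<zero>\<^bsub>regular_module A\<^esub> = \<zero>\<^bsub>A\<^esub>"
  "x \<oplus>\<^bsub>regular_module A\<^esub> y = x \<oplus>\<^bsub>A\<^esub> y" "a \<odot>\<^bsub>regular_module A\<^esub> y = a \<otimes>\<^bsub>A\<^esub> y"
  by (simp_all add: regular_module_def)

lemma (in cring) regular_module: "Module.module R (regular_module R)"
proof (rule Module.moduleI)
  show "abelian_group (regular_module R)"
    by (rule abelian_groupI) (auto intro: a_assoc a_comm bexI[of _ "\<ominus> _"] l_neg)
qed (auto intro: is_cring l_distr r_distr m_assoc)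

lemma submodule_abelian_subgroup:
  assumes "Module.module A M" "submodule N A M"
  shows "abelian_subgroup N M"
proof -
  interpret Module.module A M by fact
  have "additive_subgroup N M"
    using assms(2) by (simp add: additive_subgroup_def submodule_def)
  then show ?thesis by (intro abelian_subgroupI3 M.abelian_group_axioms)
qed

lemma submodule_coset_eq_iff:
  assumes "Module.module A M" "submodule N A M" "x \<in> carrier M" "y \<in> carrier M"
  shows "N +>\<^bsub>M\<^esub> x = N +>\<^bsub>M\<^esub> y \<longleftrightarrow> x \<ominus>\<^bsub>M\<^esub> y \<in> N"
proof -
  interpret Module.module A M by fact
  interpret N: abelian_subgroup N M by (rule submodule_abelian_subgroup[OF assms(1,2)])
  show ?thesis
    using N.a_rcos_module[OF assms(4,3)] N.a_rcos_self[OF assms(3)]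
      N.a_repr_independence'[OF _ assms(4), of x]
    by (auto simp: M.minus_eq)
qed

lemma quotient_module_simps:
  assumes "Module.module A M" "submodule N A M"
  shows "carrier (quotient_module M N) = (\<lambda>x. N +>\<^bsub>M\<^esub> x) ` carrier M"
    and "\<zero>\<^bsub>quotient_module M N\<^esub> = N"
    and "x \<in> carrier M \<Longrightarrow> y \<in> carrier M \<Longrightarrow>
      (N +>\<^bsub>M\<^esub> x) \<oplus>\<^bsub>quotient_module M N\<^esub> (N +>\<^bsub>M\<^esub> y) = N +>\<^bsub>M\<^esub> (x \<oplus>\<^bsub>M\<^esub> y)"
    and "a \<in> carrier A \<Longrightarrow> x \<in> carrier M \<Longrightarrow>
      a \<odot>\<^bsub>quotient_module M N\<^esub> (N +>\<^bsub>M\<^esub> x) = N +>\<^bsub>M\<^esub> (a \<odot>\<^bsub>M\<^esub> x)"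
proof -
  interpret Module.module A M by fact
  interpret N: abelian_subgroup N M by (rule submodule_abelian_subgroup[OF assms])
  show "carrier (quotient_module M N) = (\<lambda>x. N +>\<^bsub>M\<^esub> x) ` carrier M"
    by (auto simp: quotient_module_def A_RCOSETS_def')
  show "\<zero>\<^bsub>quotient_module M N\<^esub> = N" by (simp add: quotient_module_def)
  show "x \<in> carrier M \<Longrightarrow> y \<in> carrier M \<Longrightarrow>
      (N +>\<^bsub>M\<^esub> x) \<oplus>\<^bsub>quotient_module M N\<^esub> (N +>\<^bsub>M\<^esub> y) = N +>\<^bsub>M\<^esub> (x \<oplus>\<^bsub>M\<^esub> y)"
    by (simp add: quotient_module_def N.a_rcos_sum)
  assume a: "a \<in> carrier A" and x: "x \<in> carrier M"
  \<comment> \<open>The action on cosets is defined by \<open>the_elem\<close>, so it means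
    something only once this image is a singleton: a (n + x) and a x differ by a n, which lies in
    N.\<close>
  have "(\<lambda>y. N +>\<^bsub>M\<^esub> (a \<odot>\<^bsub>M\<^esub> y)) ` (N +>\<^bsub>M\<^esub> x) = {N +>\<^bsub>M\<^esub> (a \<odot>\<^bsub>M\<^esub> x)}"
  proof (intro equalityI subsetI)
    fix z assume "z \<in> (\<lambda>y. N +>\<^bsub>M\<^esub> (a \<odot>\<^bsub>M\<^esub> y)) ` (N +>\<^bsub>M\<^esub> x)"
    then obtain n where n: "n \<in> N" and z: "z = N +>\<^bsub>M\<^esub> (a \<odot>\<^bsub>M\<^esub> (n \<oplus>\<^bsub>M\<^esub> x))"
      by (auto simp: a_r_coset_def')
    have nM: "n \<in> carrier M" using n N.a_subset by blast
    have "a \<odot>\<^bsub>M\<^esub> (n \<oplus>\<^bsub>M\<^esub> x) \<ominus>\<^bsub>M\<^esub> a \<odot>\<^bsub>M\<^esub> x = a \<odot>\<^bsub>M\<^esub> n"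
      using a x nM by (simp add: smult_r_distr M.minus_eq M.a_assoc M.r_neg)
    also have "\<dots> \<in> N" using a n submodule.smult_closed[OF assms(2)] by blast
    finally show "z \<in> {N +>\<^bsub>M\<^esub> (a \<odot>\<^bsub>M\<^esub> x)}"
      unfolding z using a x nM by (simp add: submodule_coset_eq_iff[OF assms])
  next
    fix z assume "z \<in> {N +>\<^bsub>M\<^esub> (a \<odot>\<^bsub>M\<^esub> x)}"
    then show "z \<in> (\<lambda>y. N +>\<^bsub>M\<^esub> (a \<odot>\<^bsub>M\<^esub> y)) ` (N +>\<^bsub>M\<^esub> x)"
      using N.a_rcos_self[OF x] by blast
  qed
  then show "a \<odot>\<^bsub>quotient_module M N\<^esub> (N +>\<^bsub>M\<^esub> x) = N +>\<^bsub>M\<^esub> (a \<odot>\<^bsub>M\<^esub> x)"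
    by (simp add: quotient_module_def)
qed

lemma quotient_module_module:
  assumes "Module.module A M" "submodule N A M"
  shows "Module.module A (quotient_module M N)"
proof -
  interpret Module.module A M by fact
  interpret N: abelian_subgroup N M by (rule submodule_abelian_subgroup[OF assms])
  note q = quotient_module_simps[OF assms]
  have zero: "N = N +>\<^bsub>M\<^esub> \<zero>\<^bsub>M\<^esub>" using N.a_subset by simp
  show ?thesis
  proof (rule Module.moduleI)
    show "abelian_group (quotient_module M N)"
    proof (rule abelian_groupI)
      fix X assume "X \<in> carrier (quotient_module M N)"
      then obtain x where x: "x \<in> carrier M" "X = N +>\<^bsub>M\<^esub> x" by (auto simp: q)
      then have "(N +>\<^bsub>M\<^esub> (\<ominus>\<^bsub>M\<^esub> x)) \<oplus>\<^bsub>quotient_module M N\<^esub> X = \<zero>\<^bsub>quotient_module M N\<^esub>"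
        using zero by (simp add: q M.l_neg)
      then show "\<exists>Y\<in>carrier (quotient_module M N). Y \<oplus>\<^bsub>quotient_module M N\<^esub> X = \<zero>\<^bsub>quotient_module M N\<^esub>"
        using x by (auto simp: q(1))
      have "(N +>\<^bsub>M\<^esub> \<zero>\<^bsub>M\<^esub>) \<oplus>\<^bsub>quotient_module M N\<^esub> X = X" using x by (simp add: q(3) del: M.a_coset_add_zero)
      then show "\<zero>\<^bsub>quotient_module M N\<^esub> \<oplus>\<^bsub>quotient_module M N\<^esub> X = X" using zero by (simp add: q(2))
    next
      have "N +>\<^bsub>M\<^esub> \<zero>\<^bsub>M\<^esub> \<in> carrier (quotient_module M N)" unfolding q by blast
      then show "\<zero>\<^bsub>quotient_module M N\<^esub> \<in> carrier (quotient_module M N)" using zero by (simp add: q(2))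
    qed (auto simp: q M.a_ac)
  qed (auto simp: q smult_l_distr smult_r_distr smult_assoc1 R.is_cring)
qed

text \<open>Isomorphisms are built below out of the one-dimensional module, by scaling a vector;
  this turns them round.\<close>

lemma module_iso_sym:
  assumes "Module.module A M" "Module.module A N" "module_iso A M N"
  shows "module_iso A N M"
proof -
  interpret M: Module.module A M by fact
  interpret N: Module.module A N by fact
  obtain f where f: "f \<in> iso (add_monoid M) (add_monoid N)"
    and lin: "\<forall>a\<in>carrier A. \<forall>x\<in>carrier M. f (a \<odot>\<^bsub>M\<^esub> x) = a \<odot>\<^bsub>N\<^esub> f x"
    using assms(3) by (auto simp: module_iso_def)
  let ?g = "inv_into (carrier M) f"
  have g: "?g \<in> iso (add_monoid N) (add_monoid M)"
    using group.iso_set_sym[OF M.add.is_group f] by simp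
  have bij: "bij_betw f (carrier M) (carrier N)" using f by (simp add: iso_def)
  have "?g (a \<odot>\<^bsub>N\<^esub> y) = a \<odot>\<^bsub>M\<^esub> ?g y" if a: "a \<in> carrier A" and y: "y \<in> carrier N" for a y
  proof -
    obtain x where x: "x \<in> carrier M" "y = f x" using bij y by (auto simp: bij_betw_def)
    then have "?g y = x" "?g (a \<odot>\<^bsub>N\<^esub> y) = a \<odot>\<^bsub>M\<^esub> x"
      using lin a bij_betw_inv_into_left[OF bij] by (auto simp: lin[rule_format, symmetric])
    then show ?thesis by simp
  qed
  then show ?thesis using g by (auto simp: module_iso_def)
qed

section \<open>Sums of families of submodules\<close>

lemma submodule_sum_induct [consumes 1, case_names module submodule zero mem add]:
  assumes x: "x \<in> submodule_sum M T N"
    and M: "Module.module A M" and N: "\<And>i. i \<in> T \<Longrightarrow> submodule (N i) A M"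
    and zero: "P \<zero>\<^bsub>M\<^esub>" and mem: "\<And>i x. i \<in> T \<Longrightarrow> x \<in> N i \<Longrightarrow> P x"
    and add: "\<And>x y. x \<in> carrier M \<Longrightarrow> y \<in> carrier M \<Longrightarrow> P x \<Longrightarrow> P y \<Longrightarrow> P (x \<oplus>\<^bsub>M\<^esub> y)"
  shows "P x"
proof -
  have closed: "N i \<subseteq> carrier M" if "i \<in> T" for i using N[OF that] by (simp add: submodule_iff[OF M])
  have "P x \<and> x \<in> carrier M" using x unfolding submodule_sum_def
  proof (induction x rule: generate.induct)
    case one
    then show ?case using zero M by (simp add: Module.module_def abelian_group_def abelian_monoid.zero_closed)
  next
    case (incl h)
    then show ?case using mem closed by blast
  next
    case (inv h)
    then obtain i where i: "i \<in> T" "h \<in> N i" by blast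
    have "inv\<^bsub>add_monoid M\<^esub> h \<in> N i"
      using subgroup.m_inv_closed[OF submodule.axioms(1)[OF N[OF i(1)]] i(2)] .
    then show ?case using mem closed i by blast
  next
    case (eng x y)
    then show ?case using add M by (simp add: Module.module_def abelian_group_def abelian_monoid.a_closed)
  qed
  then show ?thesis ..
qed

lemma submodule_sum_submodule:
  assumes M: "Module.module A M" and N: "\<And>i. i \<in> T \<Longrightarrow> submodule (N i) A M"
  shows "submodule (submodule_sum M T N) A M"
proof -
  interpret Module.module A M by (rule M)
  let ?S = "submodule_sum M T N"
  have zero: "\<zero>\<^bsub>M\<^esub> \<in> ?S" using generate.one[of "add_monoid M"] by (simp add: submodule_sum_def)
  have add: "x \<oplus>\<^bsub>M\<^esub> y \<in> ?S" if "x \<in> ?S" "y \<in> ?S" for x y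
    using generate.eng[of x "add_monoid M" _ y] that by (simp add: submodule_sum_def)
  have closed: "N i \<subseteq> carrier M" if "i \<in> T" for i using N[OF that] by (simp add: submodule_iff[OF M])
  have mem: "x \<in> ?S" if "i \<in> T" "x \<in> N i" for i x
    unfolding submodule_sum_def by (rule generate.incl) (use that in blast)
  show ?thesis unfolding submodule_iff[OF M]
  proof (intro conjI subsetI ballI zero add)
    fix x assume "x \<in> ?S"
    then show "x \<in> carrier M" by (induction rule: submodule_sum_induct) (use M N closed in auto)
  next
    fix a x assume a: "a \<in> carrier A" and "x \<in> ?S"
    from this(2) show "a \<odot>\<^bsub>M\<^esub> x \<in> ?S"
    proof (induction rule: submodule_sum_induct)
      case (mem i x)
      then show ?case using \<open>\<And>i x. i \<in> T \<Longrightarrow> x \<in> N i \<Longrightarrow> x \<in> ?S\<close> a N[OF mem(1)] by (meson submodule.smult_closed)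
    qed (use M N a zero add in \<open>auto simp: smult_r_distr\<close>)
  qed
qed

lemma submodule_sum_least:
  assumes M: "Module.module A M" and N: "\<And>i. i \<in> T \<Longrightarrow> submodule (N i) A M"
    and Q: "submodule Q A M" "\<And>i. i \<in> T \<Longrightarrow> N i \<subseteq> Q"
  shows "submodule_sum M T N \<subseteq> Q"
proof
  fix x assume "x \<in> submodule_sum M T N"
  then show "x \<in> Q"
  proof (induction rule: submodule_sum_induct)
    case (mem i x)
    then show ?case using Q(2) by blast
  qed (use M N Q(1) in \<open>auto simp: submodule_iff[OF M]\<close>)
qed

lemma submodule_sum_mem: "i \<in> T \<Longrightarrow> x \<in> N i \<Longrightarrow> x \<in> submodule_sum M T N"
  unfolding submodule_sum_def by (rule generate.incl) blast

section \<open>Extension of scalars along a character\<close>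

text \<open>In the application A is the algebra of G, B that of G - R, C the line on which B acts by
  the character \<chi>, and e the idempotent of I. By \<open>act\<close>, B acts on e inside A
  through \<chi>. By \<open>idem_lift\<close> and \<open>sc_lift\<close>, e and the scalars come
  from B, so they can be moved across the tensor sign.\<close>

locale scalar_extension =
  A: cring A for A :: "('a, 'm) ring_scheme" (structure) +
  fixes B :: "('b, 'k) ring_scheme" and \<phi> :: "'b \<Rightarrow> 'a" and C :: "('b, 'f::field) module"
    and \<chi> :: "'b \<Rightarrow> 'f" and sc :: "'f \<Rightarrow> 'a" and e :: 'a
  assumes hom_closed: "b \<in> carrier B \<Longrightarrow> \<phi> b \<in> carrier A"
    and sc_closed: "sc c \<in> carrier A"
    and sc_add: "sc (c + d) = sc c \<oplus> sc d"
    and sc_mult: "sc (c * d) = sc c \<otimes> sc d"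
    and sc_1: "sc 1 = \<one>"
    and e_closed: "e \<in> carrier A"
    and e_idem: "e \<otimes> e = e"
    and C: "carrier C = UNIV" "\<And>c d. c \<oplus>\<^bsub>C\<^esub> d = c + d"
      "\<And>b c. b \<in> carrier B \<Longrightarrow> b \<odot>\<^bsub>C\<^esub> c = \<chi> b * c"
    and act: "b \<in> carrier B \<Longrightarrow> \<phi> b \<otimes> e = sc (\<chi> b) \<otimes> e"
    and idem_lift: "\<exists>b\<in>carrier B. \<phi> b = e \<and> \<chi> b = 1"
    and sc_lift: "\<exists>b\<in>carrier B. \<phi> b = sc c \<and> \<chi> b = c"
begin

definition F where "F = free_Abelian_group (carrier A \<times> carrier C)"
definition K where "K = generate F (tensor_relations B \<phi> A C)"
text \<open>The action of a on representatives in the free group, before passing to cosets of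
  K.\<close>

definition ext where "ext a = frag_extend (\<lambda>(a', c). frag_of (a \<otimes> a', c :: 'f))"

abbreviation T where "T \<equiv> extension_of_scalars B \<phi> A C"

lemma F_comm_group: "comm_group F"
  unfolding F_def by (rule abelian_free_Abelian_group)

lemma F_simps [simp]: "x \<otimes>\<^bsub>F\<^esub> y = x + y" "\<one>\<^bsub>F\<^esub> = 0" "frag_of p \<in> carrier F \<longleftrightarrow> fst p \<in> carrier A"
  by (auto simp: F_def C split: prod.split intro: prod.collapse[THEN subst])

lemma F_inv: "x \<in> carrier F \<Longrightarrow> inv\<^bsub>F\<^esub> x = - x"
  by (simp add: F_def)

lemma F_diff: "x \<in> carrier F \<Longrightarrow> y \<in> carrier F \<Longrightarrow> x - y \<in> carrier F"
  using keys_diff[of x y] by (auto simp: F_def)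

lemma relations_closed: "tensor_relations B \<phi> A C \<subseteq> carrier F"
proof -
  have "frag_of (a, c) \<in> carrier F" if "a \<in> carrier A" for a c using that by simp
  then show ?thesis
    by (auto simp: tensor_relations_def hom_closed simp del: F_simps(3) intro!: F_diff)
qed

lemma K_subgroup: "subgroup K F"
proof -
  interpret comm_group F by (rule F_comm_group)
  show ?thesis unfolding K_def by (rule generate_is_subgroup[OF relations_closed])
qed

lemma K_diff: "x \<in> K \<Longrightarrow> y \<in> K \<Longrightarrow> x - y \<in> K"
  using subgroup.m_closed[OF K_subgroup, of x "- y"] subgroup.m_inv_closed[OF K_subgroup, of y]
    F_inv[of y] subgroup.subset[OF K_subgroup] by auto

lemma K_add: "x \<in> K \<Longrightarrow> y \<in> K \<Longrightarrow> x + y \<in> K"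
  using subgroup.m_closed[OF K_subgroup, of x y] by simp

lemma K_0: "0 \<in> K"
  using subgroup.one_closed[OF K_subgroup] by simp

lemma K_uminus: "x \<in> K \<Longrightarrow> - x \<in> K"
  using K_diff[OF K_0, of x] by simp

lemma relation_in_K: "x \<in> tensor_relations B \<phi> A C \<Longrightarrow> x \<in> K"
  unfolding K_def by (rule generate.incl)

lemma coset: "K #>\<^bsub>F\<^esub> x = {k + x | k. k \<in> K}"
  by (auto simp: r_coset_def)

lemma coset_eq_iff: "K #>\<^bsub>F\<^esub> x = K #>\<^bsub>F\<^esub> y \<longleftrightarrow> x - y \<in> K"
proof
  assume "K #>\<^bsub>F\<^esub> x = K #>\<^bsub>F\<^esub> y"
  moreover have "x \<in> K #>\<^bsub>F\<^esub> x" using K_0 by (force simp: coset)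
  ultimately obtain k where "k \<in> K" "x = k + y" by (auto simp: coset)
  then show "x - y \<in> K" by simp
next
  assume xy: "x - y \<in> K"
  have "k + x \<in> K #>\<^bsub>F\<^esub> y" if "k \<in> K" for k
    using K_add[OF that xy] by (auto simp: coset intro!: exI[of _ "k + (x - y)"])
  moreover have "k + y \<in> K #>\<^bsub>F\<^esub> x" if "k \<in> K" for k
    using K_diff[OF that xy] by (auto simp: coset intro!: exI[of _ "k - (x - y)"])
  ultimately show "K #>\<^bsub>F\<^esub> x = K #>\<^bsub>F\<^esub> y" unfolding coset[of x] coset[of y] by (auto simp: coset)
qed

lemma additive_congruence: "a \<in> carrier A \<Longrightarrow> a' \<in> carrier A \<Longrightarrow>
    frag_of (a \<oplus> a', c) - frag_of (a, c) - frag_of (a', c) \<in> K"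
  by (rule relation_in_K) (unfold tensor_relations_def C, blast)

lemma balanced_congruence:
  assumes "a \<in> carrier A" "b \<in> carrier B"
  shows "frag_of (a \<otimes> \<phi> b, c) - frag_of (a, \<chi> b * c) \<in> K"
proof (rule relation_in_K)
  have "frag_of (a \<otimes> \<phi> b, c) - frag_of (a, b \<odot>\<^bsub>C\<^esub> c) \<in> tensor_relations B \<phi> A C"
    unfolding tensor_relations_def C using assms by blast
  then show "frag_of (a \<otimes> \<phi> b, c) - frag_of (a, \<chi> b * c) \<in> tensor_relations B \<phi> A C"
    using assms by (simp add: C)
qed

text \<open>Left multiplication by a carries each defining relation to one of the same kind. This
  makes the action on the tensor product independent of the representative.\<close>

lemma ext_K:
  assumes "a \<in> carrier A" "x \<in> K"
  shows "ext a x \<in> K"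
proof -
  have "ext a x \<in> K" if "x \<in> tensor_relations B \<phi> A C" for x
  proof -
    from that[unfolded tensor_relations_def] have "ext a x \<in> tensor_relations B \<phi> A C"
    proof (elim UnE CollectE exE conjE)
      fix a' a'' n assume h: "x = frag_of (a' \<oplus> a'', n) - frag_of (a', n) - frag_of (a'', n)"
        "a' \<in> carrier A" "a'' \<in> carrier A" "n \<in> carrier C"
      have "ext a x = frag_of (a \<otimes> a' \<oplus> a \<otimes> a'', n) - frag_of (a \<otimes> a', n) - frag_of (a \<otimes> a'', n)"
        using h assms by (simp add: ext_def frag_extend_diff A.r_distr)
      then show ?thesis unfolding tensor_relations_def
        using h assms by blast
    next
      fix a' n n' assume h: "x = frag_of (a', n \<oplus>\<^bsub>C\<^esub> n') - frag_of (a', n) - frag_of (a', n')"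
        "a' \<in> carrier A" "n \<in> carrier C" "n' \<in> carrier C"
      have "ext a x = frag_of (a \<otimes> a', n \<oplus>\<^bsub>C\<^esub> n') - frag_of (a \<otimes> a', n) - frag_of (a \<otimes> a', n')"
        using h by (simp add: ext_def frag_extend_diff)
      then show ?thesis unfolding tensor_relations_def
        using h assms A.m_closed[of a a'] by blast
    next
      fix a' b n assume h: "x = frag_of (a' \<otimes> \<phi> b, n) - frag_of (a', b \<odot>\<^bsub>C\<^esub> n)"
        "a' \<in> carrier A" "b \<in> carrier B" "n \<in> carrier C"
      have "ext a x = frag_of ((a \<otimes> a') \<otimes> \<phi> b, n) - frag_of (a \<otimes> a', b \<odot>\<^bsub>C\<^esub> n)"
        using h assms by (simp add: ext_def frag_extend_diff A.m_assoc hom_closed)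
      then show ?thesis unfolding tensor_relations_def
        using h assms A.m_closed[of a a'] by blast
    qed
    then show ?thesis by (rule relation_in_K)
  qed
  note rel = this
  show ?thesis using assms(2) unfolding K_def
  proof (induction x rule: generate.induct)
    case one
    then show ?case using K_0 by (simp add: ext_def K_def)
  next
    case (incl h)
    then show ?case using rel by (simp add: K_def)
  next
    case (inv h)
    then have "h \<in> carrier F" using relations_closed by blast
    then show ?case using K_uminus[OF rel[OF inv]] by (simp add: F_inv ext_def frag_extend_minus K_def)
  next
    case (eng x y)
    then show ?case using K_add[of "ext a x" "ext a y"] by (simp add: ext_def frag_extend_add K_def)
  qed
qed

lemma T_simps:
  "carrier T = (\<lambda>x. K #>\<^bsub>F\<^esub> x) ` carrier F"
  "x \<in> carrier F \<Longrightarrow> y \<in> carrier F \<Longrightarrow> (K #>\<^bsub>F\<^esub> x) \<oplus>\<^bsub>T\<^esub> (K #>\<^bsub>F\<^esub> y) = K #>\<^bsub>F\<^esub> (x + y)"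
proof -
  interpret comm_group F by (rule F_comm_group)
  have "normal K F" by (rule subgroup_imp_normal[OF K_subgroup])
  from normal.rcos_sum[OF this]
  show "x \<in> carrier F \<Longrightarrow> y \<in> carrier F \<Longrightarrow> (K #>\<^bsub>F\<^esub> x) \<oplus>\<^bsub>T\<^esub> (K #>\<^bsub>F\<^esub> y) = K #>\<^bsub>F\<^esub> (x + y)"
    by (simp add: extension_of_scalars_def Let_def F_def[symmetric] K_def[symmetric] FactGroup_def)
  show "carrier T = (\<lambda>x. K #>\<^bsub>F\<^esub> x) ` carrier F"
    by (auto simp: extension_of_scalars_def Let_def F_def[symmetric] K_def[symmetric] FactGroup_def RCOSETS_def)
qed

lemma T_smult:
  assumes "a \<in> carrier A"
  shows "a \<odot>\<^bsub>T\<^esub> (K #>\<^bsub>F\<^esub> x) = K #>\<^bsub>F\<^esub> ext a x"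
proof -
  have "(\<lambda>c. K #>\<^bsub>F\<^esub> ext a c) ` (K #>\<^bsub>F\<^esub> x) = {K #>\<^bsub>F\<^esub> ext a x}"
  proof (intro equalityI subsetI)
    fix z assume "z \<in> (\<lambda>c. K #>\<^bsub>F\<^esub> ext a c) ` (K #>\<^bsub>F\<^esub> x)"
    then obtain k where "k \<in> K" "z = K #>\<^bsub>F\<^esub> ext a (k + x)" by (auto simp: coset)
    then show "z \<in> {K #>\<^bsub>F\<^esub> ext a x}"
      using ext_K[OF assms] by (simp add: coset_eq_iff) (simp add: ext_def frag_extend_add)
  next
    fix z assume "z \<in> {K #>\<^bsub>F\<^esub> ext a x}"
    moreover have "x \<in> K #>\<^bsub>F\<^esub> x" using K_0 by (force simp: coset)
    ultimately show "z \<in> (\<lambda>c. K #>\<^bsub>F\<^esub> ext a c) ` (K #>\<^bsub>F\<^esub> x)" by blast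
  qed
  then show ?thesis
    by (simp add: extension_of_scalars_def F_def[symmetric] K_def[symmetric] Let_def ext_def[symmetric])
qed

text \<open>Lifting the scalar c to B moves it to the left factor, leaving 1 on the right; lifting
  e, whose character value is 1, then inserts e on the left without changing the right. So every
  pure tensor has a representative in A e.\<close>

lemma pure_tensor_congruence:
  assumes "a \<in> carrier A"
  shows "frag_of (a, c) - frag_of (a \<otimes> sc c \<otimes> e, 1) \<in> K"
proof -
  obtain b where b: "b \<in> carrier B" "\<phi> b = sc c" "\<chi> b = c" using sc_lift by blast
  obtain b' where b': "b' \<in> carrier B" "\<phi> b' = e" "\<chi> b' = 1" using idem_lift by blast
  have "frag_of (a \<otimes> sc c, 1) - frag_of (a, c) \<in> K"
    using balanced_congruence[OF assms b(1), of 1] b by simp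
  moreover have "frag_of (a \<otimes> sc c \<otimes> e, 1) - frag_of (a \<otimes> sc c, 1) \<in> K"
    using balanced_congruence[of "a \<otimes> sc c" b' 1] assms b' sc_closed by simp
  ultimately show ?thesis using K_uminus[OF K_add] by force
qed

text \<open>The map sends p to the tensor of p and 1. It is onto by
  \<open>pure_tensor_congruence\<close>. It is injective because the map g, taking the tensor of a
  and c to \<open>a \<otimes> e \<otimes> sc c\<close>, gives back p on A e.\<close>

lemma module_iso_extension_of_scalars:
  "module_iso A ((regular_module A)\<lparr>carrier := PIdl e\<rparr>) T"
proof -
  let ?M = "(regular_module A)\<lparr>carrier := PIdl e\<rparr>"
  let ?f = "\<lambda>p. K #>\<^bsub>F\<^esub> frag_of (p, 1)"
  have P: "PIdl e \<subseteq> carrier A" "\<And>p. p \<in> PIdl e \<Longrightarrow> p \<otimes> e = p"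
    using e_closed e_idem by (auto simp: cgenideal_def A.m_assoc)
  have eP: "a \<otimes> e \<in> PIdl e" if "a \<in> carrier A" for a using that by (auto simp: cgenideal_def)
  interpret P: ideal "PIdl e" A by (rule A.cgenideal_ideal[OF e_closed])
  have add: "?f (p \<oplus> q) = ?f p \<oplus>\<^bsub>T\<^esub> ?f q" if "p \<in> carrier A" "q \<in> carrier A" for p q
    using additive_congruence[OF that, of 1] that by (simp add: T_simps coset_eq_iff diff_diff_eq)
  have "?f \<in> hom (add_monoid ?M) (add_monoid T)"
    using add P by (auto simp: hom_def T_simps(1))
  moreover have "bij_betw ?f (PIdl e) (carrier T)"
    unfolding bij_betw_def
  proof
    \<comment> \<open>The retraction g is defined on the free group by its universal property; it
      passes to the tensor product once it is seen to kill K.\<close>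
    have "(\<lambda>(a, c). a \<otimes> e \<otimes> sc c) ` (carrier A \<times> carrier C) \<subseteq> carrier (add_monoid A)"
      using e_closed sc_closed by auto
    from comm_group.free_Abelian_group_universal[OF A.a_comm_group this, folded F_def]
    obtain g where g: "g \<in> hom F (add_monoid A)"
      and g_of: "\<And>x. x \<in> carrier A \<times> carrier C \<Longrightarrow> g (frag_of x) = (\<lambda>(a, c). a \<otimes> e \<otimes> sc c) x"
      by metis
    have g_of': "g (frag_of (a, c)) = a \<otimes> e \<otimes> sc c" if "a \<in> carrier A" for a c
      using g_of[of "(a, c)"] that by (simp add: C)
    interpret g: group_hom F "add_monoid A" g
      using g F_comm_group A.a_comm_group by (simp add: group_hom_def group_hom_axioms_def comm_group_def)
    have g_diff: "g (x - y) = g x \<ominus> g y" if "x \<in> carrier F" "y \<in> carrier F" for x y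
    proof -
      have y: "inv\<^bsub>F\<^esub> y \<in> carrier F" using that by (intro group.inv_closed g.is_group)
      have "g (x - y) = g (x \<otimes>\<^bsub>F\<^esub> inv\<^bsub>F\<^esub> y)" using that by (simp add: F_inv)
      also have "\<dots> = g x \<oplus> g (inv\<^bsub>F\<^esub> y)" using g.hom_mult[OF that(1) y] by simp
      also have "\<dots> = g x \<ominus> g y" using g.hom_inv[OF that(2)] by (simp add: A.minus_eq a_inv_def)
      finally show ?thesis .
    qed
    have g_closed: "g x \<in> carrier A" if "x \<in> carrier F" for x using g.hom_closed[OF that] by simp
    \<comment> \<open>This is why g respects the balancing relation: on e, the element
      \<open>\<phi> b\<close> acts as the scalar \<open>\<chi> b\<close>.\<close>
    have e_sc: "a \<otimes> \<phi> b \<otimes> e \<otimes> sc c = a \<otimes> e \<otimes> sc (\<chi> b * c)" if "a \<in> carrier A" "b \<in> carrier B" for a b c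
    proof -
      have "a \<otimes> \<phi> b \<otimes> e \<otimes> sc c = a \<otimes> (\<phi> b \<otimes> e) \<otimes> sc c"
        using that e_closed sc_closed hom_closed by (simp add: A.m_assoc)
      also have "\<dots> = a \<otimes> e \<otimes> sc (\<chi> b * c)"
        using that e_closed sc_closed by (simp add: act sc_mult A.m_ac)
      finally show ?thesis .
    qed
    have minus2: "x \<ominus> y \<ominus> z = \<zero>" if "x = y \<oplus> z" "y \<in> carrier A" "z \<in> carrier A" for x y z
    proof -
      have "x \<ominus> y \<ominus> z = (y \<oplus> z) \<oplus> \<ominus> (y \<oplus> z)"
        using that by (simp add: A.minus_eq A.a_assoc A.minus_add)
      then show ?thesis using that by (simp add: A.r_neg del: A.minus_add)
    qed
    have "tensor_relations B \<phi> A C \<subseteq> kernel F (add_monoid A) g"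
    proof
      fix x assume x: "x \<in> tensor_relations B \<phi> A C"
      have "g x = \<zero>" using x unfolding tensor_relations_def
      proof (elim UnE CollectE exE conjE)
        fix a a' n assume "x = frag_of (a \<oplus> a', n) - frag_of (a, n) - frag_of (a', n)"
          "a \<in> carrier A" "a' \<in> carrier A"
        then show ?thesis
          by (simp add: g_diff F_diff g_of' e_closed sc_closed A.l_distr minus2)
      next
        fix a n n' assume "x = frag_of (a, n \<oplus>\<^bsub>C\<^esub> n') - frag_of (a, n) - frag_of (a, n')" "a \<in> carrier A"
        then show ?thesis
          by (simp add: g_diff F_diff g_of' e_closed sc_closed A.r_distr minus2 C sc_add)
      next
        fix a b n assume "x = frag_of (a \<otimes> \<phi> b, n) - frag_of (a, b \<odot>\<^bsub>C\<^esub> n)" "a \<in> carrier A" "b \<in> carrier B"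
        then show ?thesis
          by (simp add: g_diff g_of' e_closed sc_closed hom_closed C e_sc A.minus_eq A.r_neg)
      qed
      then show "x \<in> kernel F (add_monoid A) g" using x relations_closed by (auto simp: kernel_def)
    qed
    then have K: "K \<subseteq> kernel F (add_monoid A) g"
      unfolding K_def by (rule g.G.generate_subgroup_incl) (rule g.subgroup_kernel)
    show "inj_on ?f (PIdl e)"
    proof (rule inj_onI)
      fix p q assume pq: "p \<in> PIdl e" "q \<in> PIdl e" and "?f p = ?f q"
      then have "frag_of (p, 1) - frag_of (q, 1) \<in> kernel F (add_monoid A) g"
        using K by (auto simp: coset_eq_iff)
      then have "p \<otimes> e \<otimes> sc 1 \<ominus> q \<otimes> e \<otimes> sc 1 = \<zero>"
        using pq P(1) by (auto simp: kernel_def g_diff g_of')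
      moreover have "p \<in> carrier A" "q \<in> carrier A" using pq P(1) by auto
      ultimately have "p \<ominus> q = \<zero>" using pq by (simp add: P(2) sc_1)
      moreover have "p = (p \<ominus> q) \<oplus> q"
        using \<open>p \<in> carrier A\<close> \<open>q \<in> carrier A\<close> by (simp add: A.minus_eq A.a_assoc A.l_neg)
      ultimately show "p = q" using \<open>q \<in> carrier A\<close> by simp
    qed
    have surj: "K #>\<^bsub>F\<^esub> x \<in> ?f ` (PIdl e)" if "x \<in> carrier F" for x
    proof -
      have "Poly_Mapping.keys x \<subseteq> carrier A \<times> carrier C" using that by (simp add: F_def)
      then show ?thesis
      proof (rule free_Abelian_group_induct[where P = "\<lambda>x. K #>\<^bsub>F\<^esub> x \<in> ?f ` (PIdl e)"])
        \<comment> \<open>The additivity relation for 0 + 0 = 0 is the negative of this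
          generator.\<close>
        have "frag_of (\<zero>, 1) \<in> K"
          using K_uminus[OF additive_congruence[of \<zero> \<zero> 1]] by simp
        then have "K #>\<^bsub>F\<^esub> 0 = ?f \<zero>" using K_uminus by (simp add: coset_eq_iff)
        then show "K #>\<^bsub>F\<^esub> 0 \<in> ?f ` (PIdl e)" using P.zero_closed by blast
      next
        fix x y assume "K #>\<^bsub>F\<^esub> x \<in> ?f ` (PIdl e)" "K #>\<^bsub>F\<^esub> y \<in> ?f ` (PIdl e)"
        then obtain p q where pq: "p \<in> PIdl e" "q \<in> PIdl e"
          and "K #>\<^bsub>F\<^esub> x = ?f p" "K #>\<^bsub>F\<^esub> y = ?f q" by blast
        then have xy: "x - frag_of (p, 1) \<in> K" "y - frag_of (q, 1) \<in> K" by (simp_all add: coset_eq_iff)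
        have pqA: "p \<in> carrier A" "q \<in> carrier A" using pq P(1) by auto
        \<comment> \<open>Additivity applied to p = (p - q) + q, since the induction on the free
          group proceeds by differences.\<close>
        have "frag_of (p, 1) - frag_of (p \<ominus> q, 1) - frag_of (q, 1) \<in> K"
          using additive_congruence[of "p \<ominus> q" q 1] pqA by (simp add: A.minus_eq A.a_assoc A.l_neg)
        from K_add[OF this K_diff[OF xy]] have "x - y - frag_of (p \<ominus> q, 1) \<in> K"
          by (simp add: algebra_simps)
        moreover have "p \<ominus> q \<in> PIdl e" using pq by (simp add: A.minus_eq)
        ultimately show "K #>\<^bsub>F\<^esub> (x - y) \<in> ?f ` (PIdl e)"
          by (intro image_eqI[of _ _ "p \<ominus> q"]) (auto simp: coset_eq_iff)
      next
        fix x assume "x \<in> carrier A \<times> carrier C"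
        then obtain a c where x: "x = (a, c)" "a \<in> carrier A" by auto
        then have "K #>\<^bsub>F\<^esub> frag_of x = ?f (a \<otimes> sc c \<otimes> e)"
          using pure_tensor_congruence by (simp add: coset_eq_iff)
        then show "K #>\<^bsub>F\<^esub> frag_of x \<in> ?f ` (PIdl e)" using eP[of "a \<otimes> sc c"] x sc_closed by blast
      qed
    qed
    show "?f ` (PIdl e) = carrier T"
      using surj P(1) by (force simp: T_simps(1))
  qed
  moreover have "?f (a \<otimes> p) = a \<odot>\<^bsub>T\<^esub> ?f p" if "a \<in> carrier A" for a p
    using that by (simp add: T_smult ext_def)
  ultimately show ?thesis unfolding module_iso_def iso_def by (intro bexI[of _ ?f]) auto
qed

end

text \<open>Supplies span, independence and dimension for the coordinate functions of a
  block.\<close>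

lemma vector_space_pointwise: "vector_space (\<lambda>(c::'f::field) (f :: 'b \<Rightarrow> 'f) x. c * f x)"
  by unfold_locales (auto simp: algebra_simps fun_eq_iff)

section \<open>Algebras with local coordinates\<close>

text \<open>
  The elements \<open>b I J\<close> form a basis with dual coordinates \<open>lam I J\<close>. For fixed I they multiply like
  squarefree monomials, \<open>b I J\<close> times \<open>b I K\<close> being \<open>b I (J \<union> K)\<close> for disjoint J and K with union in
  \<open>\<J> I\<close> and zero otherwise; for different I the products vanish.
\<close>

locale coordinate_algebra = cring A for A :: "('a, 'm) ring_scheme" (structure) +
  fixes \<I> :: "'i set" and \<J> :: "'i \<Rightarrow> 'v set set"
    and lam :: "'i \<Rightarrow> 'v set \<Rightarrow> 'a \<Rightarrow> 'f::field" and sc :: "'f \<Rightarrow> 'a" and b :: "'i \<Rightarrow> 'v set \<Rightarrow> 'a"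
  assumes finite_\<I>: "finite \<I>"
    and finite_\<J>: "I \<in> \<I> \<Longrightarrow> finite (\<J> I)"
    and finite_index: "I \<in> \<I> \<Longrightarrow> J \<in> \<J> I \<Longrightarrow> finite J"
    and empty_index: "I \<in> \<I> \<Longrightarrow> {} \<in> \<J> I"
    and subset_index: "I \<in> \<I> \<Longrightarrow> J \<in> \<J> I \<Longrightarrow> K \<subseteq> J \<Longrightarrow> K \<in> \<J> I"
    and sc_closed [simp]: "sc c \<in> carrier A"
    and b_closed [simp]: "I \<in> \<I> \<Longrightarrow> J \<in> \<J> I \<Longrightarrow> b I J \<in> carrier A"
    and lam_add: "I \<in> \<I> \<Longrightarrow> J \<in> \<J> I \<Longrightarrow> x \<in> carrier A \<Longrightarrow> y \<in> carrier A \<Longrightarrow>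
      lam I J (x \<oplus> y) = lam I J x + lam I J y"
    and lam_mult: "I \<in> \<I> \<Longrightarrow> J \<in> \<J> I \<Longrightarrow> x \<in> carrier A \<Longrightarrow> y \<in> carrier A \<Longrightarrow>
      lam I J (x \<otimes> y) = (\<Sum>K\<in>Pow J. lam I K x * lam I (J - K) y)"
    and lam_sc: "I \<in> \<I> \<Longrightarrow> J \<in> \<J> I \<Longrightarrow> lam I J (sc c) = (if J = {} then c else 0)"
    and lam_b: "I \<in> \<I> \<Longrightarrow> J \<in> \<J> I \<Longrightarrow> I' \<in> \<I> \<Longrightarrow> J' \<in> \<J> I' \<Longrightarrow>
      lam I' J' (b I J) = (if I' = I \<and> J' = J then 1 else 0)"
    and lam_inject: "x \<in> carrier A \<Longrightarrow> y \<in> carrier A \<Longrightarrow>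
      (\<And>I J. I \<in> \<I> \<Longrightarrow> J \<in> \<J> I \<Longrightarrow> lam I J x = lam I J y) \<Longrightarrow> x = y"
begin

lemma lam_sc_mult:
  assumes "I \<in> \<I>" "J \<in> \<J> I" "x \<in> carrier A"
  shows "lam I J (sc c \<otimes> x) = c * lam I J x"
proof -
  have "lam I J (sc c \<otimes> x) = (\<Sum>K\<in>Pow J. lam I K (sc c) * lam I (J - K) x)"
    by (rule lam_mult) (use assms in auto)
  also have "\<dots> = (\<Sum>K\<in>Pow J. if K = {} then c * lam I J x else 0)"
  proof (rule sum.cong)
    fix K assume "K \<in> Pow J"
    then have "K \<in> \<J> I" using subset_index assms by blast
    then show "lam I K (sc c) * lam I (J - K) x = (if K = {} then c * lam I J x else 0)"
      using assms(1) by (simp add: lam_sc)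
  qed simp
  also have "\<dots> = c * lam I J x"
    using finite_index[OF assms(1,2)] by simp
  finally show ?thesis .
qed

text \<open>Convolution with the delta function at J keeps only the term K = J, so multiplication by
  \<open>b I J\<close> shifts the coordinates of block I by J and erases the other blocks.\<close>

lemma lam_b_mult:
  assumes "I \<in> \<I>" "J \<in> \<J> I" "x \<in> carrier A" "I' \<in> \<I>" "J' \<in> \<J> I'"
  shows "lam I' J' (x \<otimes> b I J) = (if I' = I \<and> J \<subseteq> J' then lam I (J' - J) x else 0)"
proof -
  have "lam I' J' (x \<otimes> b I J) = lam I' J' (b I J \<otimes> x)"
    using assms by (simp add: m_comm)
  also have "\<dots> = (\<Sum>K\<in>Pow J'. lam I' K (b I J) * lam I' (J' - K) x)"
    by (rule lam_mult) (use assms in auto)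
  also have "\<dots> = (\<Sum>K\<in>Pow J'. if K = J then (if I' = I then lam I (J' - J) x else 0) else 0)"
  proof (rule sum.cong)
    fix K assume "K \<in> Pow J'"
    then have "K \<in> \<J> I'" using subset_index assms by blast
    then show "lam I' K (b I J) * lam I' (J' - K) x =
      (if K = J then (if I' = I then lam I (J' - J) x else 0) else 0)"
      using assms by (auto simp: lam_b)
  qed simp
  also have "\<dots> = (if I' = I \<and> J \<subseteq> J' then lam I (J' - J) x else 0)"
    using finite_index[OF assms(4,5)] by (simp add: sum.delta)
  finally show ?thesis .
qed

lemma lam_empty_mult:
  "I \<in> \<I> \<Longrightarrow> x \<in> carrier A \<Longrightarrow> y \<in> carrier A \<Longrightarrow> lam I {} (x \<otimes> y) = lam I {} x * lam I {} y"
  using lam_mult[of I "{}" x y] empty_index by simp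

lemma sc_1: "sc 1 = \<one>"
proof -
  \<comment> \<open>The coordinates of \<one> are not known yet. \<open>lam_sc_mult\<close> compares
    both sides without them, so the factor \<one> must not be simplified away.\<close>
  have "sc 1 \<otimes> \<one> = \<one>" by (rule lam_inject) (auto simp: lam_sc_mult simp del: r_one)
  then show ?thesis by simp
qed

lemma lam_one: "I \<in> \<I> \<Longrightarrow> J \<in> \<J> I \<Longrightarrow> lam I J \<one> = (if J = {} then 1 else 0)"
  using lam_sc[of I J 1] by (simp add: sc_1)

lemma lam_zero [simp]: "I \<in> \<I> \<Longrightarrow> J \<in> \<J> I \<Longrightarrow> lam I J \<zero> = 0"
  using lam_sc_mult[of I J \<zero> 0] by simp

lemma lam_minus: "I \<in> \<I> \<Longrightarrow> J \<in> \<J> I \<Longrightarrow> x \<in> carrier A \<Longrightarrow> lam I J (\<ominus> x) = - lam I J x"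
  using lam_add[of I J x "\<ominus> x"] by (simp add: r_neg eq_neg_iff_add_eq_0 add.commute)

lemma lam_diff: "I \<in> \<I> \<Longrightarrow> J \<in> \<J> I \<Longrightarrow> x \<in> carrier A \<Longrightarrow> y \<in> carrier A \<Longrightarrow>
  lam I J (x \<ominus> y) = lam I J x - lam I J y"
  by (simp add: minus_eq lam_add lam_minus)

lemma sc_0: "sc 0 = \<zero>"
  by (rule lam_inject) (auto simp: lam_sc)

lemma sc_add: "sc (c + d) = sc c \<oplus> sc d"
  by (rule lam_inject) (auto simp: lam_sc lam_add)

lemma sc_mult: "sc (c * d) = sc c \<otimes> sc d"
  by (rule lam_inject) (auto simp: lam_sc lam_sc_mult)

text \<open>Expansion in the basis, phrased as membership in a set closed under sums: S bounds the
  support of x, and subtracting the term of x at one index of S shrinks it.\<close>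

lemma coordinate_induct:
  assumes "finite S" "S \<subseteq> Sigma \<I> \<J>"
    and zero: "\<zero> \<in> Q" and add: "\<And>x y. x \<in> Q \<Longrightarrow> y \<in> Q \<Longrightarrow> x \<oplus> y \<in> Q"
    and basis: "\<And>I J c. (I, J) \<in> S \<Longrightarrow> sc c \<otimes> b I J \<in> Q"
    and x: "x \<in> carrier A" "\<And>I J. I \<in> \<I> \<Longrightarrow> J \<in> \<J> I \<Longrightarrow> (I, J) \<notin> S \<Longrightarrow> lam I J x = 0"
  shows "x \<in> Q"
  using assms(1,2) basis x
proof (induction S arbitrary: x rule: finite_induct)
  case empty
  have "x = \<zero>" by (rule lam_inject) (use empty in auto)
  then show ?case using zero by simp
next
  case (insert p S)
  obtain I J where p: "p = (I, J)" by (cases p)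
  then have IJ: "I \<in> \<I>" "J \<in> \<J> I" using insert.prems(1) by auto
  let ?z = "sc (lam I J x) \<otimes> b I J"
  let ?y = "x \<ominus> ?z"
  have z: "?z \<in> carrier A" using IJ by simp
  have "?y \<in> Q"
  proof (rule insert.IH)
    fix I' J' assume I'J': "I' \<in> \<I>" "J' \<in> \<J> I'" "(I', J') \<notin> S"
    have "lam I' J' ?y = lam I' J' x - lam I J x * lam I' J' (b I J)"
      using I'J' IJ insert.prems(3) by (simp add: lam_diff lam_sc_mult)
    then show "lam I' J' ?y = 0"
      using insert.prems(4)[OF I'J'(1,2)] I'J' IJ by (auto simp: lam_b p)
  qed (use insert.prems z in auto)
  moreover have "?z \<in> Q" by (rule insert.prems(2)) (simp add: p)
  ultimately have "?y \<oplus> ?z \<in> Q" by (rule add)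
  moreover have "?y \<oplus> ?z = x"
    using z insert.prems(3) by (simp add: minus_eq a_assoc l_neg)
  ultimately show ?case by simp
qed

section \<open>Blocks and their simple modules\<close>

definition block :: "'i \<Rightarrow> 'a set" where
  "block I = {x \<in> carrier A. \<forall>I'\<in>\<I>. I' \<noteq> I \<longrightarrow> (\<forall>J\<in>\<J> I'. lam I' J x = 0)}"

definition line :: "'i \<Rightarrow> 'v set \<Rightarrow> 'a set" where
  "line I J = {sc c \<otimes> b I J | c. True}"

abbreviation projective :: "'i \<Rightarrow> ('a, 'a) module" where
  "projective I \<equiv> (regular_module A)\<lparr>carrier := PIdl (b I {})\<rparr>"

text \<open>The coordinate at the empty set is a character of the algebra. All fields are filled as
  in \<open>C_module\<close>, so that the two records turn out equal rather than merely
  isomorphic.\<close>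

definition simple :: "'i \<Rightarrow> ('a, 'f) module" where
  "simple I = \<lparr>carrier = UNIV, monoid.mult = (*), monoid.one = 1, ring.zero = 0, ring.add = (+),
     module.smult = (\<lambda>a c. lam I {} a * c)\<rparr>"

lemma mult_idempotent:
  assumes "I \<in> \<I>" "x \<in> carrier A" "I' \<in> \<I>" "J \<in> \<J> I'"
  shows "lam I' J (x \<otimes> b I {}) = (if I' = I then lam I J x else 0)"
  using assms by (auto simp: lam_b_mult empty_index)

text \<open>Multiplication by \<open>b I {}\<close> keeps the coordinates of block I and erases all
  others, so it is the projection onto the block.\<close>

lemma PIdl_eq_block:
  assumes "I \<in> \<I>"
  shows "PIdl (b I {}) = block I"
proof
  show "PIdl (b I {}) \<subseteq> block I"
    using assms by (auto simp: cgenideal_def block_def mult_idempotent empty_index)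
  show "block I \<subseteq> PIdl (b I {})"
  proof
    fix x assume x: "x \<in> block I"
    have "x \<otimes> b I {} = x"
      by (rule lam_inject) (use assms x in \<open>auto simp: block_def mult_idempotent empty_index\<close>)
    then show "x \<in> PIdl (b I {})"
      using x by (auto simp: cgenideal_def block_def intro!: exI[of _ x])
  qed
qed

lemma block_closed: "x \<in> block I \<Longrightarrow> x \<in> carrier A"
  by (simp add: block_def)

lemma block_mult_idempotent: "I \<in> \<I> \<Longrightarrow> x \<in> block I \<Longrightarrow> x \<otimes> b I {} = x"
  by (rule lam_inject) (auto simp: block_def mult_idempotent empty_index)

lemma block_eqI: "I \<in> \<I> \<Longrightarrow> x \<in> block I \<Longrightarrow> y \<in> block I \<Longrightarrow> (\<And>J. J \<in> \<J> I \<Longrightarrow> lam I J x = lam I J y) \<Longrightarrow> x = y"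
  by (rule lam_inject) (auto simp: block_def, metis)

lemma block_ops:
  assumes "I \<in> \<I>"
  shows "\<zero> \<in> block I" "x \<in> block I \<Longrightarrow> y \<in> block I \<Longrightarrow> x \<oplus> y \<in> block I"
    "x \<in> block I \<Longrightarrow> y \<in> block I \<Longrightarrow> x \<ominus> y \<in> block I"
    "a \<in> carrier A \<Longrightarrow> x \<in> block I \<Longrightarrow> a \<otimes> x \<in> block I"
    "J \<in> \<J> I \<Longrightarrow> b I J \<in> block I"
proof -
  interpret ideal "PIdl (b I {})" A using assms by (simp add: cgenideal_ideal empty_index)
  show "\<zero> \<in> block I" "x \<in> block I \<Longrightarrow> y \<in> block I \<Longrightarrow> x \<oplus> y \<in> block I"
    "x \<in> block I \<Longrightarrow> y \<in> block I \<Longrightarrow> x \<ominus> y \<in> block I"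
    "a \<in> carrier A \<Longrightarrow> x \<in> block I \<Longrightarrow> a \<otimes> x \<in> block I"
    using zero_closed a_closed I_l_closed a_inv_closed by (auto simp: PIdl_eq_block[OF assms] minus_eq)
  show "J \<in> \<J> I \<Longrightarrow> b I J \<in> block I" using assms by (auto simp: block_def lam_b)
qed

lemma projective_eq: "I \<in> \<I> \<Longrightarrow> projective I = (regular_module A)\<lparr>carrier := block I\<rparr>"
  by (simp add: PIdl_eq_block)

lemma block_submodule: "I \<in> \<I> \<Longrightarrow> submodule (block I) A (regular_module A)"
  using block_ops[of I] by (auto simp: submodule_iff[OF regular_module] block_closed)

lemma projective_module: "I \<in> \<I> \<Longrightarrow> Module.module A (projective I)"
  by (simp add: projective_eq submodule_module[OF regular_module block_submodule])

lemma submodule_projective_iff: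
  "I \<in> \<I> \<Longrightarrow> submodule N A (projective I) \<longleftrightarrow> submodule N A (regular_module A) \<and> N \<subseteq> block I"
  by (simp add: projective_eq submodule_restrict_iff[OF regular_module block_submodule])

lemma submodule_regular_iff:
  "submodule N A (regular_module A) \<longleftrightarrow> N \<subseteq> carrier A \<and> \<zero> \<in> N \<and> (\<forall>x\<in>N. \<forall>y\<in>N. x \<oplus> y \<in> N) \<and>
    (\<forall>a\<in>carrier A. \<forall>x\<in>N. a \<otimes> x \<in> N)"
  by (simp add: submodule_iff[OF regular_module])

lemma simple_sel [simp]:
  "carrier (simple I) = UNIV" "\<zero>\<^bsub>simple I\<^esub> = 0" "x \<oplus>\<^bsub>simple I\<^esub> y = x + y" "a \<odot>\<^bsub>simple I\<^esub> c = lam I {} a * c"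
  by (simp_all add: simple_def)

lemma simple_is_module:
  assumes "I \<in> \<I>"
  shows "Module.module A (simple I)"
proof (rule Module.moduleI)
  show "abelian_group (simple I)"
    by (rule abelian_groupI) (auto intro: exI[of _ "- x" for x])
qed (use assms in \<open>auto simp: lam_add lam_empty_mult lam_one empty_index algebra_simps intro: is_cring\<close>)

text \<open>The maximal ideal of a local block is nilpotent.\<close>

lemma lam_pow_eq_0:
  assumes "I \<in> \<I>" "x \<in> carrier A" "lam I {} x = 0" "J \<in> \<J> I" "card J < n"
  shows "lam I J (x [^] n) = 0"
  using assms(4,5)
proof (induction n arbitrary: J)
  case (Suc n)
  have "lam I J (x [^] Suc n) = (\<Sum>K\<in>Pow J. lam I K (x [^] n) * lam I (J - K) x)"
    using lam_mult[OF assms(1) Suc.prems(1), of "x [^] n" x] assms(2) by simp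
  also have "\<dots> = 0"
  proof (intro sum.neutral ballI)
    \<comment> \<open>For K = J the second factor is the coordinate of x at the empty set; for
      smaller K the first factor vanishes by induction.\<close>
    fix K assume K: "K \<in> Pow J"
    show "lam I K (x [^] n) * lam I (J - K) x = 0"
    proof (cases "K = J")
      case False
      then have "card K < card J" using K finite_index[OF assms(1) Suc.prems(1)]
        by (intro psubset_card_mono) auto
      then have "lam I K (x [^] n) = 0"
        using Suc.IH[of K] subset_index[OF assms(1) Suc.prems(1)] K Suc.prems(2) by auto
      then show ?thesis by simp
    qed (simp add: assms(3))
  qed
  finally show ?case .
qed simp

text \<open>An exponent exceeding the size of all indices in \<open>\<J> I\<close> kills every
  coordinate in block I, and \<open>b I {}\<close> removes the other blocks.\<close>

lemma pow_mult_block_eq_0: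
  assumes "I \<in> \<I>" "x \<in> carrier A" "lam I {} x = 0"
  obtains n :: nat where "x [^] n \<otimes> b I {} = \<zero>"
proof -
  obtain n where n: "\<And>J. J \<in> \<J> I \<Longrightarrow> card J < n"
    using finite_\<J>[OF assms(1)] by (metis finite_imageI finite_nat_set_iff_bounded image_eqI)
  have "x [^] n \<otimes> b I {} = \<zero>"
    by (rule lam_inject) (use assms n in \<open>auto simp: mult_idempotent empty_index lam_pow_eq_0\<close>)
  then show thesis by (rule that)
qed

text \<open>The hypothesis \<open>unit\<close> places S in block I. There a minus its scalar part is
  nilpotent, hence acts as zero on a simple module. The residue field is the base field itself, so
  nothing has to be assumed about the latter.\<close>

lemma simple_module_scalar:
  assumes S: "simple_module A S" and I: "I \<in> \<I>"
    and unit: "\<And>s. s \<in> carrier S \<Longrightarrow> b I {} \<odot>\<^bsub>S\<^esub> s = s"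
    and a: "a \<in> carrier A" and s: "s \<in> carrier S"
  shows "a \<odot>\<^bsub>S\<^esub> s = sc (lam I {} a) \<odot>\<^bsub>S\<^esub> s"
proof -
  interpret S: Module.module A S using S by (simp add: simple_module_def)
  let ?d = "a \<ominus> sc (lam I {} a)"
  have d: "?d \<in> carrier A" "lam I {} ?d = 0"
    using a I by (simp_all add: lam_diff lam_sc empty_index)
  obtain n :: nat where n: "?d [^] n \<otimes> b I {} = \<zero>" using pow_mult_block_eq_0[OF I d] by blast
  have "?d \<odot>\<^bsub>S\<^esub> s = \<zero>\<^bsub>S\<^esub>"
  proof (rule simple_module_nilpotent[OF S d(1) _ s])
    fix t assume t: "t \<in> carrier S"
    have "(?d [^] n) \<odot>\<^bsub>S\<^esub> t = (?d [^] n) \<odot>\<^bsub>S\<^esub> (b I {} \<odot>\<^bsub>S\<^esub> t)" using unit[OF t] by simp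
    also have "\<dots> = \<zero>\<^bsub>S\<^esub>"
      using d t I n by (simp add: S.smult_assoc1[symmetric] empty_index)
    finally show "(?d [^] n) \<odot>\<^bsub>S\<^esub> t = \<zero>\<^bsub>S\<^esub>" .
  qed
  moreover have "a = ?d \<oplus> sc (lam I {} a)"
    using a by (simp add: minus_eq a_assoc l_neg)
  ultimately show ?thesis using a s d(1)
    by (metis S.M.l_zero S.smult_l_distr S.smult_closed sc_closed)
qed

lemma simple_module_generated_by:
  assumes S: "simple_module A S" and I: "I \<in> \<I>"
    and unit: "\<And>s. s \<in> carrier S \<Longrightarrow> b I {} \<odot>\<^bsub>S\<^esub> s = s"
    and s: "s \<in> carrier S" "s \<noteq> \<zero>\<^bsub>S\<^esub>" and t: "t \<in> carrier S"
  shows "\<exists>c. t = sc c \<odot>\<^bsub>S\<^esub> s"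
  using simple_module_generated[OF S s t] simple_module_scalar[OF S I unit _ s(1)] by metis

text \<open>Scaling a fixed nonzero vector s is onto because s generates S and the algebra acts by
  scalars; it is injective because a nonzero scalar killing s could be inverted.\<close>

lemma simple_module_iso:
  assumes S: "simple_module A S" and I: "I \<in> \<I>"
    and unit: "\<And>s. s \<in> carrier S \<Longrightarrow> b I {} \<odot>\<^bsub>S\<^esub> s = s"
  shows "module_iso A S (simple I)"
proof -
  interpret S: Module.module A S using S by (simp add: simple_module_def)
  obtain s where s: "s \<in> carrier S" "s \<noteq> \<zero>\<^bsub>S\<^esub>"
    using S S.M.zero_closed by (auto simp: simple_module_def)
  let ?g = "\<lambda>c. sc c \<odot>\<^bsub>S\<^esub> s"
  have "module_iso A (simple I) S"
    unfolding module_iso_def iso_def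
  proof (intro bexI[of _ ?g] ballI CollectI conjI)
    show "?g \<in> hom (add_monoid (simple I)) (add_monoid S)"
      using s by (auto simp: hom_def sc_add S.smult_l_distr)
    show "bij_betw ?g (carrier (add_monoid (simple I))) (carrier (add_monoid S))"
      unfolding bij_betw_def
    proof
      show "inj_on ?g (carrier (add_monoid (simple I)))"
      proof (rule inj_onI)
        fix c d assume eq: "?g c = ?g d"
        show "c = d"
        proof (rule ccontr)
          assume "c \<noteq> d"
          then have 1: "inverse (c - d) * (c - d) = 1" by simp
          have "sc c = sc (c - d) \<oplus> sc d" by (simp add: sc_add[symmetric])
          then have "?g c = ?g (c - d) \<oplus>\<^bsub>S\<^esub> ?g d" using s by (simp add: S.smult_l_distr)
          then have "?g (c - d) = \<zero>\<^bsub>S\<^esub>" using eq s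
            by (metis S.M.add.r_cancel_one' S.smult_closed sc_closed)
          then have "sc (inverse (c - d)) \<odot>\<^bsub>S\<^esub> ?g (c - d) = \<zero>\<^bsub>S\<^esub>" by simp
          then have "?g 1 = \<zero>\<^bsub>S\<^esub>" using s 1 by (simp add: S.smult_assoc1[symmetric] sc_mult[symmetric])
          then show False using s by (simp add: sc_1)
        qed
      qed
      show "?g ` carrier (add_monoid (simple I)) = carrier (add_monoid S)"
        using simple_module_generated_by[OF S I unit s] s(1) by auto
    qed
    fix a c assume a: "a \<in> carrier A"
    have "?g (lam I {} a * c) = sc (lam I {} a) \<odot>\<^bsub>S\<^esub> ?g c" using s by (simp add: sc_mult S.smult_assoc1)
    then show "?g (a \<odot>\<^bsub>simple I\<^esub> c) = a \<odot>\<^bsub>S\<^esub> ?g c"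
      using simple_module_scalar[OF S I unit a, of "?g c"] s by simp
  qed
  then show ?thesis using module_iso_sym[OF simple_is_module[OF I] S.module_axioms] by blast
qed

text \<open>The idempotent \<open>b I {}\<close> acts as the identity on S and as zero on
  \<open>simple I'\<close>.\<close>

lemma not_iso_simple:
  assumes "I \<in> \<I>" "I' \<in> \<I>" "I \<noteq> I'"
    and unit: "\<And>s. s \<in> carrier S \<Longrightarrow> b I {} \<odot>\<^bsub>S\<^esub> s = s"
  shows "\<not> module_iso A S (simple I')"
proof
  assume "module_iso A S (simple I')"
  then obtain f where f: "bij_betw f (carrier S) UNIV"
    and lin: "\<And>a s. a \<in> carrier A \<Longrightarrow> s \<in> carrier S \<Longrightarrow> f (a \<odot>\<^bsub>S\<^esub> s) = lam I' {} a * f s"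
    by (auto simp: module_iso_def iso_def)
  have "1 \<in> f ` carrier S" using f by (simp add: bij_betw_def)
  then obtain s where s: "s \<in> carrier S" "f s = 1" by auto
  have "f s = lam I' {} (b I {}) * f s"
    using lin[of "b I {}" s] unit[OF s(1)] s assms by (simp add: empty_index)
  then show False using s assms by (simp add: lam_b empty_index)
qed


section \<open>Lines, socle and semisimplicity\<close>

lemma line_closed: "I \<in> \<I> \<Longrightarrow> J \<in> \<J> I \<Longrightarrow> line I J \<subseteq> block I"
  using block_ops[of I] by (auto simp: line_def)

lemma basis_in_line: "I \<in> \<I> \<Longrightarrow> J \<in> \<J> I \<Longrightarrow> b I J \<in> line I J"
  using sc_1 by (auto simp: line_def intro!: exI[of _ 1])

text \<open>For J maximal, every element of positive degree annihilates the basis element of J.\<close>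

lemma mult_maximal_basis:
  assumes I: "I \<in> \<I>" and J: "J \<in> \<J> I" and max: "\<And>K. K \<in> \<J> I \<Longrightarrow> J \<subseteq> K \<Longrightarrow> K = J"
    and a: "a \<in> carrier A"
  shows "a \<otimes> b I J = sc (lam I {} a) \<otimes> b I J"
proof (rule lam_inject)
  fix I' J' assume I': "I' \<in> \<I>" "J' \<in> \<J> I'"
  show "lam I' J' (a \<otimes> b I J) = lam I' J' (sc (lam I {} a) \<otimes> b I J)"
    using max[of J'] I J a I' by (auto simp: lam_b_mult lam_sc lam_b empty_index)
qed (use I J a in auto)

lemma line_submodule:
  assumes I: "I \<in> \<I>" and J: "J \<in> \<J> I" and max: "\<And>K. K \<in> \<J> I \<Longrightarrow> J \<subseteq> K \<Longrightarrow> K = J"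
  shows "submodule (line I J) A (regular_module A)"
  unfolding submodule_regular_iff
proof (intro conjI ballI)
  show "line I J \<subseteq> carrier A" using line_closed[OF I J] block_closed by blast
  have "\<zero> = sc 0 \<otimes> b I J" using I J by (simp add: sc_0)
  then show "\<zero> \<in> line I J" by (auto simp: line_def)
next
  fix x y assume "x \<in> line I J" "y \<in> line I J"
  then obtain c d where "x = sc c \<otimes> b I J" "y = sc d \<otimes> b I J" by (auto simp: line_def)
  then have "x \<oplus> y = sc (c + d) \<otimes> b I J" using I J by (simp add: sc_add l_distr)
  then show "x \<oplus> y \<in> line I J" by (auto simp: line_def)
next
  fix a x assume a: "a \<in> carrier A" and "x \<in> line I J"
  then obtain c where x: "x = sc c \<otimes> b I J" by (auto simp: line_def)
  have "a \<otimes> x = sc c \<otimes> (a \<otimes> b I J)" using I J a by (simp add: x m_lcomm)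
  also have "\<dots> = sc (c * lam I {} a) \<otimes> b I J"
    using I J by (simp add: mult_maximal_basis[OF I J max a] sc_mult m_assoc)
  finally show "a \<otimes> x \<in> line I J" by (auto simp: line_def)
qed

lemma line_simple:
  assumes I: "I \<in> \<I>" and J: "J \<in> \<J> I" and max: "\<And>K. K \<in> \<J> I \<Longrightarrow> J \<subseteq> K \<Longrightarrow> K = J"
  shows "simple_module A ((regular_module A)\<lparr>carrier := line I J\<rparr>)"
proof (rule simple_moduleI)
  show "Module.module A ((regular_module A)\<lparr>carrier := line I J\<rparr>)"
    by (rule submodule_module[OF regular_module line_submodule[OF assms]])
  have "lam I J (b I J) = 1" using I J by (simp add: lam_b)
  then have "b I J \<noteq> \<zero>" using I J by auto
  then show "carrier ((regular_module A)\<lparr>carrier := line I J\<rparr>) \<noteq> {\<zero>\<^bsub>(regular_module A)\<lparr>carrier := line I J\<rparr>\<^esub>}"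
    using basis_in_line[OF I J] by auto
next
  fix s t assume "s \<in> carrier ((regular_module A)\<lparr>carrier := line I J\<rparr>)"
    "s \<noteq> \<zero>\<^bsub>(regular_module A)\<lparr>carrier := line I J\<rparr>\<^esub>" "t \<in> carrier ((regular_module A)\<lparr>carrier := line I J\<rparr>)"
  then obtain c d where s: "s = sc c \<otimes> b I J" "s \<noteq> \<zero>" and t: "t = sc d \<otimes> b I J"
    by (auto simp: line_def)
  then have "c \<noteq> 0" using I J by (auto simp: sc_0)
  then have "t = sc (d / c) \<otimes> s" using I J by (simp add: s t m_assoc[symmetric] sc_mult[symmetric])
  then show "\<exists>a\<in>carrier A. t = a \<odot>\<^bsub>(regular_module A)\<lparr>carrier := line I J\<rparr>\<^esub> s" by auto
qed

lemma line_iso: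
  assumes I: "I \<in> \<I>" and J: "J \<in> \<J> I" and max: "\<And>K. K \<in> \<J> I \<Longrightarrow> J \<subseteq> K \<Longrightarrow> K = J"
  shows "module_iso A ((regular_module A)\<lparr>carrier := line I J\<rparr>) (simple I)"
proof (rule simple_module_iso[OF line_simple[OF assms] I])
  fix s assume "s \<in> carrier ((regular_module A)\<lparr>carrier := line I J\<rparr>)"
  then have "s \<in> block I" using line_closed[OF I J] by auto
  then show "b I {} \<odot>\<^bsub>(regular_module A)\<lparr>carrier := line I J\<rparr>\<^esub> s = s"
    using block_mult_idempotent[OF I] I by (simp add: m_comm block_closed empty_index)
qed

text \<open>A basis element of degree one squares to zero, hence annihilates every simple submodule.\<close>

lemma simple_submodule_annihilated:
  assumes N: "simple_module A ((regular_module A)\<lparr>carrier := N\<rparr>)" and N_closed: "N \<subseteq> carrier A"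
    and I: "I \<in> \<I>" and r: "{r} \<in> \<J> I" and x: "x \<in> N"
  shows "x \<otimes> b I {r} = \<zero>"
proof -
  have sq: "b I {r} \<otimes> b I {r} = \<zero>"
  proof (rule lam_inject)
    fix I' J assume I': "I' \<in> \<I>" "J \<in> \<J> I'"
    then have "J - {r} \<in> \<J> I'" using subset_index[of I' J "J - {r}"] by blast
    then show "lam I' J (b I {r} \<otimes> b I {r}) = lam I' J \<zero>"
      using I r I' by (auto simp: lam_b_mult lam_b)
  qed (use I r in auto)
  interpret N: Module.module A "(regular_module A)\<lparr>carrier := N\<rparr>" using N by (simp add: simple_module_def)
  have br: "b I {r} \<in> carrier A" using I r by simp
  have "b I {r} \<odot>\<^bsub>(regular_module A)\<lparr>carrier := N\<rparr>\<^esub> x = \<zero>\<^bsub>(regular_module A)\<lparr>carrier := N\<rparr>\<^esub>"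
  proof (rule simple_module_nilpotent[OF N br, of 2])
    fix s assume s: "s \<in> carrier ((regular_module A)\<lparr>carrier := N\<rparr>)"
    have "(b I {r} [^] (2::nat)) = \<zero>" using br sq by (simp add: numeral_2_eq_2)
    then show "(b I {r} [^] (2::nat)) \<odot>\<^bsub>(regular_module A)\<lparr>carrier := N\<rparr>\<^esub> s = \<zero>\<^bsub>(regular_module A)\<lparr>carrier := N\<rparr>\<^esub>"
      using N.smult_l_null[OF s] by simp
  qed (use x in simp)
  then have bx: "b I {r} \<otimes> x = \<zero>" by simp
  moreover have "x \<in> carrier A" using N_closed x by blast
  ultimately show ?thesis using br by (simp add: m_comm)
qed

text \<open>The lines at maximal J are simple. Conversely, simple submodules are annihilated by
  every \<open>b I {r}\<close>, and this forces their coordinates at non-maximal indices to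
  vanish.\<close>

lemma socle_projective:
  assumes I: "I \<in> \<I>"
  defines "\<M> \<equiv> {J \<in> \<J> I. \<forall>K\<in>\<J> I. J \<subseteq> K \<longrightarrow> K = J}"
  shows "internal_direct_sum A (projective I) \<M> (line I) (socle A (projective I))"
    and "J \<in> \<M> \<Longrightarrow> module_iso A ((projective I)\<lparr>carrier := line I J\<rparr>) (simple I)"
proof -
  have M: "I \<in> \<I>" "J \<in> \<J> I" "\<And>K. K \<in> \<J> I \<Longrightarrow> J \<subseteq> K \<Longrightarrow> K = J" if "J \<in> \<M>" for J
    using that I by (auto simp: \<M>_def)
  show "module_iso A ((projective I)\<lparr>carrier := line I J\<rparr>) (simple I)" if "J \<in> \<M>"
    using line_iso[OF M[OF that]] by simp
  interpret P: Module.module A "projective I" by (rule projective_module[OF I])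
  have sub: "submodule (line I J) A (projective I)" if "J \<in> \<M>" for J
    using line_submodule[OF M[OF that]] line_closed M[OF that]
    by (simp add: submodule_projective_iff)
  have simple: "line I J \<in> simple_submodules A (projective I)" if "J \<in> \<M>" for J
    using line_simple[OF M[OF that]] sub[OF that] by (simp add: simple_submodules_def)
  have socle_supp: "lam I J x = 0" 
    if N: "N \<in> simple_submodules A (projective I)" and x: "x \<in> N" and J: "J \<in> \<J> I" "J \<notin> \<M>" for N x J
  proof -
    \<comment> \<open>Pick r outside J such that J with r added is still an index. The coordinate of
      x at J reappears as the coordinate of \<open>x \<otimes> b I {r}\<close> at
      \<open>insert r J\<close>, and this product is zero.\<close>
    obtain K where K: "K \<in> \<J> I" "J \<subset> K" using J by (auto simp: \<M>_def)
    then obtain r where r: "r \<in> K" "r \<notin> J" by auto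
    have index: "{r} \<in> \<J> I" "insert r J \<in> \<J> I"
      using subset_index[OF I K(1)] K r by auto
    have "N \<subseteq> block I" and simple: "simple_module A ((regular_module A)\<lparr>carrier := N\<rparr>)"
      using N by (auto simp: simple_submodules_def submodule_projective_iff[OF I])
    then have xA: "x \<in> carrier A" using x block_closed by blast
    have "x \<otimes> b I {r} = \<zero>" by (rule simple_submodule_annihilated[OF simple _ I index(1) x])
      (use \<open>N \<subseteq> block I\<close> block_closed in blast)
    then have "lam I (insert r J) (x \<otimes> b I {r}) = 0" using I index by simp
    then show ?thesis using I index xA r by (simp add: lam_b_mult)
  qed
  let ?sum = "submodule_sum (projective I) \<M> (line I)"
  have sum: "submodule ?sum A (projective I)" by (rule submodule_sum_submodule[OF P.module_axioms sub])
  have simple_sub: "submodule N A (projective I)" if "N \<in> simple_submodules A (projective I)" for N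
    using that by (simp add: simple_submodules_def)
  have socle: "socle A (projective I) = ?sum"
  proof
    have "N \<subseteq> ?sum" if N: "N \<in> simple_submodules A (projective I)" for N
    proof
      fix x assume x: "x \<in> N"
      have "N \<subseteq> block I" using simple_sub[OF N] by (simp add: submodule_projective_iff[OF I])
      then have xb: "x \<in> block I" using x by blast
      show "x \<in> ?sum"
      proof (rule coordinate_induct[where S = "{I} \<times> \<M>"])
        show "finite ({I} \<times> \<M>)" using finite_\<J>[OF I] by (simp add: \<M>_def)
        show "{I} \<times> \<M> \<subseteq> Sigma \<I> \<J>" using M by auto
        show "\<zero> \<in> ?sum" "\<And>x y. x \<in> ?sum \<Longrightarrow> y \<in> ?sum \<Longrightarrow> x \<oplus> y \<in> ?sum"
          using sum by (auto simp: submodule_iff[OF P.module_axioms])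
        show "sc c \<otimes> b I' J \<in> ?sum" if "(I', J) \<in> {I} \<times> \<M>" for I' J c
          using that by (intro submodule_sum_mem[of J]) (auto simp: line_def)
        show "x \<in> carrier A" using xb by (rule block_closed)
        show "lam I' J x = 0" if "I' \<in> \<I>" "J \<in> \<J> I'" "(I', J) \<notin> {I} \<times> \<M>" for I' J
          using that xb socle_supp[OF N x] by (cases "I' = I") (auto simp: block_def)
      qed
    qed
    then show "socle A (projective I) \<subseteq> ?sum"
      unfolding socle_def by (intro submodule_sum_least[OF P.module_axioms simple_sub sum])
    show "?sum \<subseteq> socle A (projective I)"
      unfolding socle_def
    proof (intro submodule_sum_least[OF P.module_axioms sub submodule_sum_submodule[OF P.module_axioms simple_sub]])
      fix J assume "J \<in> \<M>"
      then show "line I J \<subseteq> submodule_sum (projective I) (simple_submodules A (projective I)) (\<lambda>N. N)"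
        using submodule_sum_mem[OF simple, where M = "projective I" and N = "\<lambda>N. N"] by blast
    qed
  qed
  show "internal_direct_sum A (projective I) \<M> (line I) (socle A (projective I))"
    unfolding internal_direct_sum_def socle
  proof (intro conjI ballI refl sub)
    fix J assume J: "J \<in> \<M>"
    let ?S = "submodule_sum (projective I) (\<M> - {J}) (line I)"
    have sub': "submodule (line I J') A (projective I)" if "J' \<in> \<M> - {J}" for J' using sub that by blast
    \<comment> \<open>The coordinate at J vanishes on all other lines, which makes the sum
      direct.\<close>
    have coord: "lam I J x = 0" if "x \<in> ?S" for x
      using that
    proof (induction rule: submodule_sum_induct)
      case zero
      then show ?case using M[OF J] by simp
    next
      case (mem J' x)
      then obtain c where c: "x = sc c \<otimes> b I J'" by (auto simp: line_def)
      have "J' \<in> \<M>" "J \<noteq> J'" using mem(1) by auto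
      then show ?case using M(1,2)[OF J] M(2)[of J'] by (simp add: c lam_sc_mult lam_b)
    next
      case (add x y)
      then show ?case using M[OF J] block_closed[of _ I] by (simp add: lam_add PIdl_eq_block[OF I])
    qed (use P.module_axioms sub' in auto)
    have "line I J \<inter> ?S \<subseteq> {\<zero>}"
    proof
      fix x assume x: "x \<in> line I J \<inter> ?S"
      then obtain c where c: "x = sc c \<otimes> b I J" by (auto simp: line_def)
      then have "c = 0" using coord[of x] x M[OF J] by (simp add: lam_sc_mult lam_b)
      then show "x \<in> {\<zero>}" using M[OF J] c by (simp add: sc_0)
    qed
    moreover have "submodule ?S A (projective I)" by (rule submodule_sum_submodule[OF P.module_axioms sub'])
    then have "\<zero> \<in> line I J" "\<zero> \<in> ?S"
      using sub[OF J] by (auto simp: submodule_iff[OF P.module_axioms])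
    ultimately show "line I J \<inter> ?S = {\<zero>\<^bsub>projective I\<^esub>}" by auto
  qed
qed

text \<open>If some index contains r, then \<open>b I {r}\<close> annihilates every simple
  submodule, hence their sum; were 1 in that sum, \<open>b I {r}\<close> would be zero. If all
  indices are empty, each empty index is maximal, so the algebra is the direct sum of simple
  lines.\<close>

lemma semisimple_iff: "semisimple_algebra A \<longleftrightarrow> (\<forall>I\<in>\<I>. \<J> I = {{}})"
proof
  assume "semisimple_algebra A"
  then obtain \<N> where \<N>: "\<N> \<subseteq> simple_submodules A (regular_module A)"
    and dec: "internal_direct_sum A (regular_module A) \<N> (\<lambda>N. N) (carrier A)"
    by (auto simp: semisimple_algebra_def semisimple_module_def)
  have sub: "submodule N A (regular_module A)" if "N \<in> \<N>" for N
    using \<N> that by (auto simp: simple_submodules_def)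
  show "\<forall>I\<in>\<I>. \<J> I = {{}}"
  proof (rule ccontr)
    assume "\<not> (\<forall>I\<in>\<I>. \<J> I = {{}})"
    then obtain I J r where I: "I \<in> \<I>" and "J \<in> \<J> I" "r \<in> J" using empty_index by fastforce
    then have r: "{r} \<in> \<J> I" using subset_index[of I J "{r}"] by simp
    have "x \<otimes> b I {r} = \<zero>" if "x \<in> submodule_sum (regular_module A) \<N> (\<lambda>N. N)" for x
      using that
    proof (induction rule: submodule_sum_induct)
      case (mem N x)
      then show ?case using \<N> sub[OF mem(1)] simple_submodule_annihilated[OF _ _ I r]
        by (auto simp: simple_submodules_def submodule_regular_iff)
    qed (use regular_module sub I r in \<open>simp_all add: l_distr\<close>)
    moreover have "\<one> \<in> submodule_sum (regular_module A) \<N> (\<lambda>N. N)"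
      using dec one_closed unfolding internal_direct_sum_def by blast
    ultimately have "\<one> \<otimes> b I {r} = \<zero>" by blast
    then have "lam I {r} (b I {r}) = 0" using I r by simp
    then show False using I r by (simp add: lam_b)
  qed
next
  assume triv: "\<forall>I\<in>\<I>. \<J> I = {{}}"
  then have max: "\<And>K. K \<in> \<J> I \<Longrightarrow> {} \<subseteq> K \<Longrightarrow> K = {}" if "I \<in> \<I>" for I using that by simp
  note sub = line_submodule[OF _ empty_index max] and simp = line_simple[OF _ empty_index max]
  let ?N = "(\<lambda>I. line I {}) ` \<I>"
  let ?M = "regular_module A"
  have subN: "submodule N A ?M" if "N \<in> ?N" for N using sub that by auto
  have "?N \<subseteq> simple_submodules A ?M"
    using sub simp by (auto simp: simple_submodules_def)
  moreover have "internal_direct_sum A ?M ?N (\<lambda>N. N) (carrier ?M)"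
    unfolding internal_direct_sum_def
  proof (intro conjI ballI subN)
    let ?S = "submodule_sum ?M ?N (\<lambda>N. N)"
    have S: "submodule ?S A ?M" by (rule submodule_sum_submodule[OF regular_module subN])
    have "x \<in> ?S" if "x \<in> carrier A" for x
    proof (rule coordinate_induct[where S = "Sigma \<I> \<J>"])
      show "finite (Sigma \<I> \<J>)" using finite_\<I> finite_\<J> by auto
      show "\<zero> \<in> ?S" "\<And>x y. x \<in> ?S \<Longrightarrow> y \<in> ?S \<Longrightarrow> x \<oplus> y \<in> ?S" using S by (auto simp: submodule_regular_iff)
      show "sc c \<otimes> b I J \<in> ?S" if "(I, J) \<in> Sigma \<I> \<J>" for I J c
        using that triv by (intro submodule_sum_mem[of "line I {}"]) (auto simp: line_def)
    qed (use that in auto)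
    then show "carrier ?M = ?S" using S by (auto simp: submodule_regular_iff)
    fix N assume "N \<in> ?N"
    then obtain I where I: "I \<in> \<I>" and N: "N = line I {}" by blast
    let ?S' = "submodule_sum ?M (?N - {N}) (\<lambda>N. N)"
    have sub': "submodule N' A ?M" if "N' \<in> ?N - {N}" for N' using subN that by blast
    have coord: "lam I {} x = 0" if "x \<in> ?S'" for x
      using that
    proof (induction rule: submodule_sum_induct)
      case (mem N' x)
      then obtain I' where "I' \<in> \<I>" "I' \<noteq> I" "N' = line I' {}" using N by auto
      then show ?case using mem I by (auto simp: line_def lam_sc_mult lam_b empty_index)
    qed (use regular_module sub' I in \<open>simp_all add: lam_add empty_index\<close>)
    have "N \<inter> ?S' \<subseteq> {\<zero>}"
    proof
      fix x assume x: "x \<in> N \<inter> ?S'"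
      then obtain c where c: "x = sc c \<otimes> b I {}" by (auto simp: line_def N)
      then have "c = 0" using coord[of x] x I by (simp add: lam_sc_mult lam_b empty_index)
      then show "x \<in> {\<zero>}" using I c by (simp add: sc_0 empty_index)
    qed
    moreover have "submodule ?S' A ?M" by (rule submodule_sum_submodule[OF regular_module sub'])
    then have "\<zero> \<in> N" "\<zero> \<in> ?S'"
      using subN[OF \<open>N \<in> ?N\<close>] by (auto simp: submodule_regular_iff)
    ultimately show "N \<inter> ?S' = {\<zero>\<^bsub>?M\<^esub>}" by auto
  qed
  ultimately show "semisimple_algebra A"
    using regular_module by (auto simp: semisimple_algebra_def semisimple_module_def)
qed

section \<open>Primitive idempotents\<close>

text \<open>In the expansion of f = f f at J, the term K = J contains the vanishing scalar part, and
  every other term contains a coordinate at a proper subset of J, zero by induction.\<close>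

lemma idempotent_coordinates_zero:
  assumes f: "idempotent A f" and I: "I \<in> \<I>" and zero: "lam I {} f = 0" and J: "J \<in> \<J> I"
  shows "lam I J f = 0"
proof -
  have "finite J" by (rule finite_index[OF I J])
  then show ?thesis using J
  proof (induction J rule: finite_psubset_induct)
    case (psubset J)
    have "lam I J f = lam I J (f \<otimes> f)" using f by (simp add: idempotent_def)
    also have "\<dots> = (\<Sum>K\<in>Pow J. lam I K f * lam I (J - K) f)"
      by (rule lam_mult) (use f I psubset.prems in \<open>auto simp: idempotent_def\<close>)
    also have "\<dots> = 0"
    proof (intro sum.neutral ballI)
      fix K assume K: "K \<in> Pow J"
      show "lam I K f * lam I (J - K) f = 0"
      proof (cases "K = J")
        case False
        then have "lam I K f = 0" using psubset.IH[of K] K subset_index[OF I psubset.prems] by auto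
        then show ?thesis by simp
      qed (simp add: zero)
    qed
    finally show ?case .
  qed
qed

lemma basis_idempotent: "I \<in> \<I> \<Longrightarrow> idempotent A (b I {})"
  using block_mult_idempotent[of I "b I {}"] block_ops(5)[of I "{}"]
  by (simp add: idempotent_def empty_index)

text \<open>In a splitting into f + g the scalar parts of f and g have product zero in every block.
  Outside I their sum is also zero, so both vanish; at I one of them vanishes. That summand then has
  no scalar part in any block and is zero.\<close>

lemma basis_primitive:
  assumes I: "I \<in> \<I>"
  shows "primitive_idempotent A (b I {})"
  unfolding primitive_idempotent_def
proof (intro conjI notI)
  show "idempotent A (b I {})" by (rule basis_idempotent[OF I])
  show False if "b I {} = \<zero>"
    using that I lam_b[of I "{}" I "{}"] by (simp add: empty_index)
next
  assume "\<exists>f g. idempotent A f \<and> idempotent A g \<and> orthogonal A f g \<and> f \<noteq> \<zero> \<and> g \<noteq> \<zero> \<and> b I {} = f \<oplus> g"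
  then obtain f g where f: "idempotent A f" and g: "idempotent A g" and orth: "f \<otimes> g = \<zero>"
    and nz: "f \<noteq> \<zero>" "g \<noteq> \<zero>" and sum: "b I {} = f \<oplus> g" by (auto simp: orthogonal_def)
  have closed: "f \<in> carrier A" "g \<in> carrier A" using f g by (auto simp: idempotent_def)
  have add: "lam I' {} (b I {}) = lam I' {} f + lam I' {} g" if "I' \<in> \<I>" for I'
    using that closed by (simp add: sum lam_add empty_index)
  have prod: "lam I' {} f * lam I' {} g = 0" if "I' \<in> \<I>" for I'
    using that closed orth lam_empty_mult[of I' f g] by (simp add: empty_index)
  have vanish: "lam I' {} f = 0 \<and> lam I' {} g = 0" if "I' \<in> \<I>" "I' \<noteq> I" for I'
    using add[OF that(1)] prod[OF that(1)] that I by (auto simp: lam_b empty_index)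
  have "h = \<zero>" if "h \<in> {f, g}" "lam I {} h = 0" for h
  proof (rule lam_inject)
    fix I' J assume I': "I' \<in> \<I>" "J \<in> \<J> I'"
    have "lam I' {} h = 0" using vanish[of I'] that I' by (cases "I' = I") auto
    then show "lam I' J h = lam I' J \<zero>"
      using idempotent_coordinates_zero[of h I' J] that f g I' by auto
  qed (use that closed in auto)
  then show False using prod[OF I] nz by auto
qed

lemma complete_idempotents: "complete_primitive_orthogonal_idempotents A \<I> (\<lambda>I. b I {})"
  unfolding complete_primitive_orthogonal_idempotents_def
proof (intro conjI ballI impI)
  fix I I' assume "I \<in> \<I>" "I' \<in> \<I>" "I \<noteq> I'"
  then show "orthogonal A (b I {}) (b I' {})"
    unfolding orthogonal_def
    by (intro conjI lam_inject) (auto simp: mult_idempotent lam_b empty_index)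
next
  have sum: "lam I J (\<Oplus>I'\<in>S. b I' {}) = (\<Sum>I'\<in>S. lam I J (b I' {}))"
    if "finite S" "S \<subseteq> \<I>" "I \<in> \<I>" "J \<in> \<J> I" for S I J
    using that
  proof (induction S rule: finite_induct)
    case (insert I' S)
    have c: "(\<lambda>I'. b I' {}) \<in> S \<rightarrow> carrier A" "b I' {} \<in> carrier A"
      using insert.prems empty_index by auto
    with insert show ?case by (simp add: lam_add finsum_insert finsum_closed)
  qed simp
  have c: "(\<lambda>I'. b I' {}) \<in> \<I> \<rightarrow> carrier A" using empty_index by auto
  show "(\<Oplus>I\<in>\<I>. b I {}) = \<one>"
  proof (rule lam_inject)
    fix I J assume IJ: "I \<in> \<I>" "J \<in> \<J> I"
    have "(\<Sum>I'\<in>\<I>. lam I J (b I' {})) = (\<Sum>I'\<in>\<I>. if I' = I then (if J = {} then 1 else 0) else 0)"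
      by (rule sum.cong) (use IJ in \<open>auto simp: lam_b empty_index\<close>)
    then show "lam I J (\<Oplus>I\<in>\<I>. b I {}) = lam I J \<one>"
      using IJ finite_\<I> by (simp add: sum lam_one)
  qed (use c in \<open>simp_all add: finsum_closed\<close>)
qed (use finite_\<I> basis_primitive in auto)

section \<open>Composition factors inside a block\<close>

context
  fixes I N N'
  assumes I: "I \<in> \<I>" and N: "submodule N A (regular_module A)"
    and N': "submodule N' A (regular_module A)" and NN': "N \<subseteq> N'" and N'_block: "N' \<subseteq> block I"
begin

abbreviation (input) factor where "factor \<equiv> quotient_module ((regular_module A)\<lparr>carrier := N'\<rparr>) N"

lemma factor_base: "Module.module A ((regular_module A)\<lparr>carrier := N'\<rparr>)"
  by (rule submodule_module[OF regular_module N'])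

lemma factor_sub: "submodule N A ((regular_module A)\<lparr>carrier := N'\<rparr>)"
  using N NN' by (simp add: submodule_restrict_iff[OF regular_module N'])

lemma factor_module: "Module.module A factor"
  by (rule quotient_module_module[OF factor_base factor_sub])

text \<open>Subtraction in the restricted record uses the additive inverse computed within N', which
  has to be identified with the inverse in A.\<close>

lemma factor_minus:
  assumes "x \<in> N'" "y \<in> N'"
  shows "x \<ominus>\<^bsub>(regular_module A)\<lparr>carrier := N'\<rparr>\<^esub> y = x \<ominus> y"
proof -
  interpret M: Module.module A "(regular_module A)\<lparr>carrier := N'\<rparr>" by (rule factor_base)
  have N'_ops: "N' \<subseteq> carrier A" "\<And>a z. a \<in> carrier A \<Longrightarrow> z \<in> N' \<Longrightarrow> a \<otimes> z \<in> N'"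
    using N' by (auto simp: submodule_regular_iff)
  have y: "y \<in> carrier A" using N'_ops assms by blast
  have "\<ominus> y = \<ominus> \<one> \<otimes> y" using y by (simp add: l_minus)
  then have "\<ominus> y \<in> N'" using N'_ops(2)[of "\<ominus> \<one>" y] assms by simp
  then have "\<ominus>\<^bsub>(regular_module A)\<lparr>carrier := N'\<rparr>\<^esub> y = \<ominus> y"
    using assms y by (intro M.M.minus_equality) (auto simp: l_neg)
  then show ?thesis by (simp add: a_minus_def)
qed

lemma factor_coset_eq_iff:
  "x \<in> N' \<Longrightarrow> y \<in> N' \<Longrightarrow>
    N +>\<^bsub>(regular_module A)\<lparr>carrier := N'\<rparr>\<^esub> x = N +>\<^bsub>(regular_module A)\<lparr>carrier := N'\<rparr>\<^esub> y \<longleftrightarrow> x \<ominus> y \<in> N"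
  using submodule_coset_eq_iff[OF factor_base factor_sub, of x y] by (simp add: factor_minus)

lemma factor_zero_iff:
  assumes "x \<in> N'"
  shows "N +>\<^bsub>(regular_module A)\<lparr>carrier := N'\<rparr>\<^esub> x = \<zero>\<^bsub>factor\<^esub> \<longleftrightarrow> x \<in> N"
proof -
  interpret M: Module.module A "(regular_module A)\<lparr>carrier := N'\<rparr>" by (rule factor_base)
  have "\<zero> \<in> N'" "x \<in> carrier A" using N' assms by (auto simp: submodule_regular_iff)
  moreover have "N +>\<^bsub>(regular_module A)\<lparr>carrier := N'\<rparr>\<^esub> \<zero> = N" using M.M.a_coset_add_zero[of N] NN' by simp
  ultimately show ?thesis
    using factor_coset_eq_iff[OF assms, of \<zero>] by (simp add: quotient_module_simps[OF factor_base factor_sub] minus_eq)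
qed

text \<open>Makes the classification of simple modules over block I applicable to every subquotient
  of the block.\<close>

lemma factor_unit:
  assumes "s \<in> carrier factor"
  shows "b I {} \<odot>\<^bsub>factor\<^esub> s = s"
proof -
  obtain x where x: "x \<in> N'" and s: "s = N +>\<^bsub>(regular_module A)\<lparr>carrier := N'\<rparr>\<^esub> x"
    using assms by (auto simp: quotient_module_simps[OF factor_base factor_sub])
  have xb: "x \<in> block I" using x N'_block by blast
  then have "b I {} \<otimes> x = x"
    using block_mult_idempotent[OF I xb] I by (simp add: m_comm block_closed empty_index)
  then show ?thesis
    using x I by (simp add: s quotient_module_simps[OF factor_base factor_sub] empty_index)
qed

text \<open>A simple subquotient of the block is a line, so N' is N plus the scalar multiples of x:
  each step of a composition series contributes one basis vector.\<close>

lemma factor_simple_step: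
  assumes "simple_module A factor"
  obtains x where "x \<in> N'" "x \<notin> N" "\<And>y. y \<in> N' \<Longrightarrow> \<exists>c. y \<ominus> sc c \<otimes> x \<in> N"
proof -
  interpret S: Module.module A factor by (rule factor_module)
  obtain s where s: "s \<in> carrier factor" "s \<noteq> \<zero>\<^bsub>factor\<^esub>"
    using assms S.M.zero_closed by (auto simp: simple_module_def)
  then obtain x where x: "x \<in> N'" and sx: "s = N +>\<^bsub>(regular_module A)\<lparr>carrier := N'\<rparr>\<^esub> x"
    by (auto simp: quotient_module_simps[OF factor_base factor_sub])
  have "x \<notin> N" using s x by (simp add: sx factor_zero_iff)
  moreover have "\<exists>c. y \<ominus> sc c \<otimes> x \<in> N" if y: "y \<in> N'" for y
  proof -
    have "N +>\<^bsub>(regular_module A)\<lparr>carrier := N'\<rparr>\<^esub> y \<in> carrier factor"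
      using y by (simp add: quotient_module_simps[OF factor_base factor_sub])
    then obtain c where "N +>\<^bsub>(regular_module A)\<lparr>carrier := N'\<rparr>\<^esub> y = sc c \<odot>\<^bsub>factor\<^esub> s"
      using simple_module_generated_by[OF assms I factor_unit s] by blast
    moreover have "sc c \<otimes> x \<in> N'" using x N' by (simp add: submodule_regular_iff)
    ultimately have "y \<ominus> sc c \<otimes> x \<in> N"
      using x y by (simp add: sx quotient_module_simps[OF factor_base factor_sub] factor_coset_eq_iff)
    then show ?thesis ..
  qed
  ultimately show thesis using that x by blast
qed

lemma factor_simpleI:
  assumes "N \<noteq> N'" and "\<And>x y. x \<in> N' \<Longrightarrow> x \<notin> N \<Longrightarrow> y \<in> N' \<Longrightarrow> \<exists>c. y \<ominus> sc c \<otimes> x \<in> N"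
  shows "simple_module A factor"
proof (rule simple_moduleI[OF factor_module])
  obtain x where "x \<in> N'" "x \<notin> N" using assms(1) NN' by blast
  then have "N +>\<^bsub>(regular_module A)\<lparr>carrier := N'\<rparr>\<^esub> x \<in> carrier factor"
    "N +>\<^bsub>(regular_module A)\<lparr>carrier := N'\<rparr>\<^esub> x \<noteq> \<zero>\<^bsub>factor\<^esub>"
    by (simp_all only: factor_zero_iff) (simp_all add: quotient_module_simps[OF factor_base factor_sub])
  then show "carrier factor \<noteq> {\<zero>\<^bsub>factor\<^esub>}" by blast
next
  fix s t assume st: "s \<in> carrier factor" "s \<noteq> \<zero>\<^bsub>factor\<^esub>" "t \<in> carrier factor"
  then obtain x y where x: "x \<in> N'" "s = N +>\<^bsub>(regular_module A)\<lparr>carrier := N'\<rparr>\<^esub> x"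
    and y: "y \<in> N'" "t = N +>\<^bsub>(regular_module A)\<lparr>carrier := N'\<rparr>\<^esub> y"
    by (auto simp: quotient_module_simps[OF factor_base factor_sub])
  then have "x \<notin> N" using st factor_zero_iff by blast
  then obtain c where "y \<ominus> sc c \<otimes> x \<in> N" using assms(2) x y by blast
  moreover have "sc c \<otimes> x \<in> N'" using x N' by (simp add: submodule_regular_iff)
  ultimately have "t = sc c \<odot>\<^bsub>factor\<^esub> s"
    using x y by (simp add: quotient_module_simps[OF factor_base factor_sub] factor_coset_eq_iff)
  then show "\<exists>a\<in>carrier A. t = a \<odot>\<^bsub>factor\<^esub> s" by auto
qed

end

lemma composition_series_projective_iff:
  assumes I: "I \<in> \<I>"
  shows "composition_series A (projective I) Ns \<longleftrightarrow>
    Ns \<noteq> [] \<and> hd Ns = {\<zero>} \<and> last Ns = block I \<and>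
    (\<forall>N\<in>set Ns. submodule N A (regular_module A) \<and> N \<subseteq> block I) \<and>
    (\<forall>i. Suc i < length Ns \<longrightarrow> Ns ! i \<subset> Ns ! Suc i \<and>
      simple_module A (quotient_module ((regular_module A)\<lparr>carrier := Ns ! Suc i\<rparr>) (Ns ! i)))"
  by (simp add: composition_series_def composition_factor_def PIdl_eq_block[OF I]
      submodule_restrict_iff[OF regular_module block_submodule[OF I]])

lemma composition_series_step:
  assumes I: "I \<in> \<I>" and Ns: "composition_series A (projective I) Ns" and i: "Suc i < length Ns"
  shows "submodule (Ns ! i) A (regular_module A)" "submodule (Ns ! Suc i) A (regular_module A)"
    "Ns ! i \<subseteq> Ns ! Suc i" "Ns ! Suc i \<subseteq> block I"
    "simple_module A (quotient_module ((regular_module A)\<lparr>carrier := Ns ! Suc i\<rparr>) (Ns ! i))"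
  using Ns i unfolding composition_series_projective_iff[OF I] by (auto simp: psubset_imp_subset)

text \<open>Extended by zero because nothing is assumed about \<open>lam I J\<close> outside
  \<open>\<J> I\<close>; this makes \<open>coords I\<close> linear on the block, with values in a
  function space.\<close>

definition coords :: "'i \<Rightarrow> 'a \<Rightarrow> 'v set \<Rightarrow> 'f" where
  "coords I x J = (if J \<in> \<J> I then lam I J x else 0)"

text \<open>Choosing a vector for each step of a composition series gives a basis of the block.\<close>

lemma composition_series_length_unique:
  assumes I: "I \<in> \<I>" and Ns: "composition_series A (projective I) Ns"
    and Ns': "composition_series A (projective I) Ns'"
  shows "length Ns = length Ns'"
proof -
  interpret V: vector_space "\<lambda>(c::'f) (f :: 'v set \<Rightarrow> 'f) J. c * f J" by (rule vector_space_pointwise)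
  have coords_add: "coords I (x \<oplus> y) = coords I x + coords I y" if "x \<in> block I" "y \<in> block I" for x y
    using that I by (auto simp: coords_def fun_eq_iff lam_add block_closed)
  have coords_sc: "coords I (sc c \<otimes> x) = (\<lambda>J. c * coords I x J)" if "x \<in> block I" for c x
    using that I by (auto simp: coords_def fun_eq_iff lam_sc_mult block_closed)
  have coords_diff: "coords I (x \<ominus> y) = coords I x - coords I y" if "x \<in> block I" "y \<in> block I" for x y
    using that I by (auto simp: coords_def fun_eq_iff lam_diff block_closed)
  have inj: "x = y" if "x \<in> block I" "y \<in> block I" "coords I x = coords I y" for x y
    using that by (intro block_eqI[OF I]) (auto simp: coords_def dest: fun_cong split: if_splits)
  have basis: "\<exists>B. card B = i \<and> V.independent B \<and> finite B \<and> V.span B = coords I ` (Ns ! i)"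
    if Ns: "composition_series A (projective I) Ns" and i: "i < length Ns" for Ns i
    using i
  proof (induction i)
    case 0
    have "Ns ! 0 = {\<zero>}" using Ns unfolding composition_series_projective_iff[OF I] by (metis hd_conv_nth)
    moreover have "coords I \<zero> = 0" using I by (auto simp: coords_def)
    ultimately show ?case by (intro exI[of _ "{}"]) (simp add: V.independent_empty zero_fun_def)
  next
    case (Suc i)
    then obtain B where B: "card B = i" "V.independent B" "finite B" "V.span B = coords I ` (Ns ! i)" by auto
    note step = composition_series_step[OF I Ns Suc.prems]
    obtain x where x: "x \<in> Ns ! Suc i" "x \<notin> Ns ! i"
      and gen: "\<And>y. y \<in> Ns ! Suc i \<Longrightarrow> \<exists>c. y \<ominus> sc c \<otimes> x \<in> Ns ! i"
      using factor_simple_step[OF I step] by blast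
    have xb: "x \<in> block I" and sub: "Ns ! i \<subseteq> block I" using x step by auto
    \<comment> \<open>\<open>coords I\<close> is injective on the block, so a vector outside
      \<open>Ns ! i\<close> has coordinates outside the span.\<close>
    have new: "coords I x \<notin> V.span B" unfolding B using inj[OF xb] sub x by blast
    have "V.span (insert (coords I x) B) = coords I ` (Ns ! Suc i)"
    proof (intro equalityI subsetI)
      fix f assume "f \<in> V.span (insert (coords I x) B)"
      then obtain c y where y: "y \<in> Ns ! i" "f - (\<lambda>J. c * coords I x J) = coords I y"
        by (auto simp: V.span_insert B)
      then have "f = coords I y + (\<lambda>J. c * coords I x J)" by (metis diff_add_cancel)
      also have "\<dots> = coords I (y \<oplus> sc c \<otimes> x)"
        using y sub xb block_ops[OF I] by (simp add: coords_add coords_sc subset_iff)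
      finally show "f \<in> coords I ` (Ns ! Suc i)"
        using step(2,3) x y by (auto simp: submodule_regular_iff)
    next
      fix f assume "f \<in> coords I ` (Ns ! Suc i)"
      then obtain y where y: "y \<in> Ns ! Suc i" "f = coords I y" by blast
      then obtain c where c: "y \<ominus> sc c \<otimes> x \<in> Ns ! i" using gen by blast
      have "coords I (y \<ominus> sc c \<otimes> x) = f - (\<lambda>J. c * coords I x J)"
        using y xb step(4) block_ops[OF I] by (simp add: coords_diff coords_sc subset_iff)
      then show "f \<in> V.span (insert (coords I x) B)" unfolding V.span_insert B
        using c by (intro CollectI exI[of _ c]) (metis imageI)
    qed
    moreover have "V.independent (insert (coords I x) B)"
      using new B by (simp add: V.independent_insert)
    moreover have "card (insert (coords I x) B) = Suc i"
      using new B V.span_base by (subst card_insert_disjoint) auto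
    ultimately show ?case using B(3) by (intro exI[of _ "insert (coords I x) B"]) simp
  qed
  \<comment> \<open>The series starts with the zero module, so the member at position i has
    dimension i and the last position is the length minus one.\<close>
  have "V.dim (coords I ` block I) = length Ns - 1" if Ns: "composition_series A (projective I) Ns" for Ns
  proof -
    have "Ns \<noteq> []" "last Ns = block I" using Ns unfolding composition_series_projective_iff[OF I] by auto
    then obtain B where B: "card B = length Ns - 1" "V.independent B" "V.span B = coords I ` block I"
      using basis[OF Ns, of "length Ns - 1"] by (auto simp: last_conv_nth)
    have "V.span B = V.span (coords I ` block I)" by (metis B(3) V.span_span)
    then show ?thesis using V.dim_eq_card[OF _ B(2)] B(1) by simp
  qed
  moreover have "length Ns \<noteq> 0" "length Ns' \<noteq> 0"
    using Ns Ns' unfolding composition_series_projective_iff[OF I] by auto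
  ultimately show ?thesis using Ns Ns' by (metis Suc_pred' bot_nat_0.not_eq_extremum diff_Suc_1)
qed

definition coordinate_space :: "'i \<Rightarrow> 'v set set \<Rightarrow> 'a set" where
  "coordinate_space I U = {x \<in> block I. \<forall>J\<in>\<J> I. J \<notin> U \<longrightarrow> lam I J x = 0}"

text \<open>The coordinate of a x at J involves x only at subsets of J, so multiplication carries
  support upwards only, and an upward closed set of allowed indices is respected.\<close>

lemma coordinate_space_submodule:
  assumes I: "I \<in> \<I>" and up: "\<And>J K. J \<in> U \<Longrightarrow> K \<in> \<J> I \<Longrightarrow> J \<subseteq> K \<Longrightarrow> K \<in> U"
  shows "submodule (coordinate_space I U) A (regular_module A)"
  unfolding submodule_regular_iff
proof (intro conjI ballI)
  show "coordinate_space I U \<subseteq> carrier A" by (auto simp: coordinate_space_def block_closed)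
  show "\<zero> \<in> coordinate_space I U" using I by (auto simp: coordinate_space_def block_ops)
  show "x \<oplus> y \<in> coordinate_space I U" if "x \<in> coordinate_space I U" "y \<in> coordinate_space I U" for x y
    using that I by (auto simp: coordinate_space_def block_ops lam_add block_closed)
  fix a x assume a: "a \<in> carrier A" and x: "x \<in> coordinate_space I U"
  have "lam I J (a \<otimes> x) = 0" if J: "J \<in> \<J> I" "J \<notin> U" for J
  proof -
    have "lam I J (a \<otimes> x) = (\<Sum>K\<in>Pow J. lam I K a * lam I (J - K) x)"
      by (rule lam_mult) (use I J a x in \<open>auto simp: coordinate_space_def block_closed\<close>)
    also have "\<dots> = 0"
    proof (intro sum.neutral ballI)
      fix K
      have "J - K \<in> \<J> I" "J - K \<notin> U" using subset_index[OF I J(1)] up[of "J - K" J] J by auto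
      then show "lam I K a * lam I (J - K) x = 0" using x by (simp add: coordinate_space_def)
    qed
    finally show ?thesis .
  qed
  then show "a \<otimes> x \<in> coordinate_space I U"
    using x a I by (auto simp: coordinate_space_def block_ops)
qed

text \<open>With the indices listed by decreasing cardinality, every initial segment is upward
  closed and hence gives a submodule; each further index adds one dimension.\<close>

lemma composition_series_exists:
  assumes I: "I \<in> \<I>"
  obtains Ns where "composition_series A (projective I) Ns" "length Ns = Suc (card (\<J> I))"
proof -
  obtain ys where ys: "set ys = \<J> I" "distinct ys" using finite_distinct_list[OF finite_\<J>[OF I]] by blast
  define xs where "xs = rev (sort_key card ys)"
  have xs: "set xs = \<J> I" "distinct xs" "length xs = card (\<J> I)"
    using ys distinct_card[of ys] by (auto simp: xs_def)
  have "sorted (map card (sort_key card ys))" by simp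
  then have sorted: "sorted_wrt (\<lambda>J K. card K \<le> card J) xs"
    by (simp add: xs_def sorted_wrt_rev sorted_wrt_map)
  have up: "K \<in> set (take i xs)" if "J \<in> set (take i xs)" "K \<in> \<J> I" "J \<subseteq> K" for i J K
  proof (rule ccontr)
    assume K: "K \<notin> set (take i xs)"
    have "K \<in> set (drop i xs)" using that(2) K xs(1) by (metis Un_iff append_take_drop_id set_append)
    moreover have "sorted_wrt (\<lambda>J K. card K \<le> card J) (take i xs @ drop i xs)" using sorted by simp
    ultimately have "card K \<le> card J" using that(1) unfolding sorted_wrt_append by blast
    \<comment> \<open>Indices of equal size may come in any order: a superset of J that is not
      larger is J itself.\<close>
    then have "J = K" using that finite_index[OF I] card_seteq by blast
    then show False using K that by simp
  qed
  define W where "W i = coordinate_space I (set (take i xs))" for i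
  have W: "submodule (W i) A (regular_module A)" for i
    unfolding W_def using coordinate_space_submodule[OF I] up by blast
  have Wb: "W i \<subseteq> block I" for i by (auto simp: W_def coordinate_space_def)
  have step: "W i \<subset> W (Suc i) \<and> simple_module A (quotient_module ((regular_module A)\<lparr>carrier := W (Suc i)\<rparr>) (W i))"
    if i: "i < length xs" for i
  proof -
    let ?J = "xs ! i"
    have J: "?J \<in> \<J> I" using i xs(1) nth_mem by blast
    have tk: "set (take (Suc i) xs) = insert ?J (set (take i xs))"
      using i by (simp add: take_Suc_conv_app_nth)
    have notin: "?J \<notin> set (take i xs)"
    proof
      assume "?J \<in> set (take i xs)"
      then obtain k where "k < i" "xs ! k = xs ! i" using i by (auto simp: in_set_conv_nth)
      then show False using i xs(2) by (simp add: nth_eq_iff_index_eq)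
    qed
    have mem: "x \<in> W i \<longleftrightarrow> lam I ?J x = 0" if "x \<in> W (Suc i)" for x
      using that J notin by (auto simp: W_def coordinate_space_def tk)
    have sub: "W i \<subseteq> W (Suc i)" by (auto simp: W_def coordinate_space_def tk)
    have "b I ?J \<in> W (Suc i)" using I J by (auto simp: W_def coordinate_space_def tk lam_b block_ops)
    moreover have "lam I ?J (b I ?J) \<noteq> 0" using I J by (simp add: lam_b)
    ultimately have ne: "W i \<noteq> W (Suc i)" using mem by blast
    have "simple_module A (quotient_module ((regular_module A)\<lparr>carrier := W (Suc i)\<rparr>) (W i))"
    proof (rule factor_simpleI[OF I W W sub Wb ne])
      fix x y assume x: "x \<in> W (Suc i)" "x \<notin> W i" and y: "y \<in> W (Suc i)"
      have lx: "lam I ?J x \<noteq> 0" using x mem by blast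
      \<comment> \<open>Chosen to cancel the only coordinate that distinguishes
        \<open>W (Suc i)\<close> from \<open>W i\<close>.\<close>
      let ?c = "lam I ?J y / lam I ?J x"
      have xb: "x \<in> block I" "y \<in> block I" using x y Wb by auto
      have "y \<ominus> sc ?c \<otimes> x \<in> W (Suc i)"
        using x y I xb by (auto simp: W_def coordinate_space_def block_ops lam_diff lam_sc_mult block_closed)
      moreover have "lam I ?J (y \<ominus> sc ?c \<otimes> x) = 0"
        using I J xb lx by (simp add: lam_diff lam_sc_mult block_closed)
      ultimately show "\<exists>c. y \<ominus> sc c \<otimes> x \<in> W i" using mem by blast
    qed
    then show ?thesis using sub ne by blast
  qed
  let ?Ns = "map W [0..<Suc (length xs)]"
  have "W 0 = {\<zero>}"
    using I by (auto simp: W_def coordinate_space_def block_ops intro: block_eqI[OF I])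
  moreover have "W (length xs) = block I" by (auto simp: W_def coordinate_space_def xs)
  ultimately have "composition_series A (projective I) ?Ns"
    unfolding composition_series_projective_iff[OF I]
    using step W Wb by (auto simp: hd_map last_map nth_append simp del: upt_Suc)
  moreover have "length ?Ns = Suc (card (\<J> I))" using xs(3) by simp
  ultimately show thesis by (rule that)
qed

text \<open>All composition series of the block have the same length and all their factors are
  isomorphic to \<open>simple I\<close>. So the count is either the number of steps or zero,
  whatever the series, which settles existence and uniqueness in the definite description.\<close>

lemma composition_multiplicity_projective:
  assumes I: "I \<in> \<I>" and I': "I' \<in> \<I>"
  shows "composition_multiplicity A (projective I) (simple I') = (if I = I' then card (\<J> I) else 0)"
proof -
  obtain Ns0 where Ns0: "composition_series A (projective I) Ns0" "length Ns0 = Suc (card (\<J> I))"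
    using composition_series_exists[OF I] by blast
  have count: "card {i. Suc i < length Ns \<and> module_iso A (composition_factor (projective I) Ns i) (simple I')} =
      (if I = I' then card (\<J> I) else 0)" if Ns: "composition_series A (projective I) Ns" for Ns
  proof -
    have len: "length Ns = Suc (card (\<J> I))"
      using composition_series_length_unique[OF I Ns Ns0(1)] Ns0(2) by simp
    have factor: "composition_factor (projective I) Ns i =
        quotient_module ((regular_module A)\<lparr>carrier := Ns ! Suc i\<rparr>) (Ns ! i)" for i
      by (simp add: composition_factor_def)
    have "module_iso A (composition_factor (projective I) Ns i) (simple I') \<longleftrightarrow> I = I'" if i: "Suc i < length Ns" for i
    proof -
      note step = composition_series_step[OF I Ns i]
      note unit = factor_unit[OF I step(1-4)]
      show ?thesis unfolding factor
        using simple_module_iso[OF step(5) I unit] not_iso_simple[OF I I' _ unit] by blast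
    qed
    then have "{i. Suc i < length Ns \<and> module_iso A (composition_factor (projective I) Ns i) (simple I')} =
      (if I = I' then {..<card (\<J> I)} else {})" by (auto simp: len)
    then show ?thesis by simp
  qed
  show ?thesis unfolding composition_multiplicity_def
  proof (rule the_equality)
    show "\<exists>Ns. composition_series A (projective I) Ns \<and> (if I = I' then card (\<J> I) else 0) =
      card {i. Suc i < length Ns \<and> module_iso A (composition_factor (projective I) Ns i) (simple I')}"
      using Ns0(1) count[OF Ns0(1)] by (intro exI[of _ Ns0] conjI) simp_all
  qed (elim exE conjE, simp only: count)
qed

end

section \<open>Coordinates of the algebra\<close>

text \<open>Exponents on I are arbitrary, since those variables become 1; exponents on J must be
  exactly 1.\<close>

definition coord_monom :: "'v set \<Rightarrow> 'v set \<Rightarrow> ('v \<Rightarrow>\<^sub>0 nat) \<Rightarrow> 'f::field" where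
  "coord_monom I J m =
     (if Poly_Mapping.keys m \<subseteq> I \<union> J \<and> (\<forall>r\<in>J. Poly_Mapping.lookup m r = 1) then 1 else 0)"

text \<open>
  Substituting 1 for the variables in I and 0 for those outside I and J, this is the coefficient of
  the squarefree monomial with support J.
\<close>

definition coord :: "'v set \<Rightarrow> 'v set \<Rightarrow> ('v, 'f::field) mpoly \<Rightarrow> 'f" where
  "coord I J p = (\<Sum>m\<in>Poly_Mapping.keys p. Poly_Mapping.lookup p m * coord_monom I J m)"

lemma coord_eq_Sum:
  assumes "finite S" "Poly_Mapping.keys p \<subseteq> S"
  shows "coord I J p = (\<Sum>m\<in>S. Poly_Mapping.lookup p m * coord_monom I J m)"
  unfolding coord_def using assms
  by (intro sum.mono_neutral_left) (auto simp: Poly_Mapping.in_keys_iff)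

lemma coord_add: "coord I J (p + q) = coord I J p + coord I J q"
proof -
  let ?S = "Poly_Mapping.keys p \<union> Poly_Mapping.keys q"
  have "Poly_Mapping.keys (p + q) \<subseteq> ?S" by (rule Poly_Mapping.keys_add)
  then show ?thesis
    by (simp add: coord_eq_Sum[of ?S] lookup_add distrib_right sum.distrib)
qed

lemma coord_single: "coord I J (Poly_Mapping.single m c) = c * coord_monom I J m"
  by (cases "c = 0") (simp_all add: coord_def)

lemma coord_0 [simp]: "coord I J 0 = 0"
  by (simp add: coord_def)

lemma coord_uminus: "coord I J (- p) = - coord I J p"
  using coord_add[of I J p "- p"] by (simp add: eq_neg_iff_add_eq_0 add.commute)

lemma coord_diff: "coord I J (p - q) = coord I J p - coord I J q"
  using coord_add[of I J p "- q"] by (simp add: coord_uminus)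

lemma keys_add_nat:
  "Poly_Mapping.keys (m + n) = Poly_Mapping.keys m \<union> Poly_Mapping.keys (n :: 'v \<Rightarrow>\<^sub>0 nat)"
  by (auto simp: Poly_Mapping.in_keys_iff lookup_add)

text \<open>Only the split with K the part of J occurring in m can contribute: each variable of J
  must come with exponent one from exactly one of the two factors. Disjointness of I and J keeps
  variables of J from being set to 1.\<close>

lemma coord_monom_add:
  fixes m n :: "'v \<Rightarrow>\<^sub>0 nat"
  assumes J: "finite J" and IJ: "I \<inter> J = {}"
  shows "(coord_monom I J (m + n) :: 'f::field) =
    (\<Sum>K\<in>Pow J. coord_monom I K m * coord_monom I (J - K) n)"
proof -
  let ?K = "Poly_Mapping.keys m \<inter> J"
  have "(\<Sum>K\<in>Pow J. coord_monom I K m * coord_monom I (J - K) n :: 'f) =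
    (\<Sum>K\<in>Pow J. if K = ?K then coord_monom I J (m + n) else 0)"
  proof (rule sum.cong)
    fix K assume K: "K \<in> Pow J"
    show "(coord_monom I K m * coord_monom I (J - K) n :: 'f) =
      (if K = ?K then coord_monom I J (m + n) else 0)"
    proof (cases "K = ?K")
      case False
      have "(coord_monom I K m :: 'f) = 0"
      proof (cases "K \<subseteq> Poly_Mapping.keys m")
        case True
        then obtain r where "r \<in> Poly_Mapping.keys m" "r \<in> J" "r \<notin> K" using False K by auto
        then show ?thesis using IJ by (auto simp: coord_monom_def)
      next
        case False
        then obtain r where "r \<in> K" "Poly_Mapping.lookup m r = 0"
          unfolding subset_iff Poly_Mapping.in_keys_iff by blast
        then have "\<not> (\<forall>r\<in>K. Poly_Mapping.lookup m r = 1)" by force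
        then show ?thesis by (simp add: coord_monom_def)
      qed
      then show ?thesis using False by simp
    next
      case eq: True
      have "(coord_monom I ?K m :: 'f) * coord_monom I (J - ?K) n = coord_monom I J (m + n)"
      proof (cases "Poly_Mapping.keys m \<subseteq> I \<union> J \<and> Poly_Mapping.keys n \<subseteq> I \<union> J")
        case True
        have "(Poly_Mapping.keys n \<subseteq> I \<union> (J - ?K) \<and> (\<forall>r\<in>?K. Poly_Mapping.lookup m r = 1) \<and>
            (\<forall>r\<in>J - ?K. Poly_Mapping.lookup n r = 1)) \<longleftrightarrow>
          (\<forall>r\<in>J. Poly_Mapping.lookup m r + Poly_Mapping.lookup n r = 1)" (is "?L \<longleftrightarrow> ?R")
        proof
          assume L: ?L
          show ?R
          proof
            fix r assume "r \<in> J"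
            then show "Poly_Mapping.lookup m r + Poly_Mapping.lookup n r = 1"
              using L IJ by (cases "r \<in> Poly_Mapping.keys m") (auto simp: Poly_Mapping.in_keys_iff)
          qed
        next
          assume R: ?R
          have "Poly_Mapping.lookup m r = 1 \<and> Poly_Mapping.lookup n r = 0" if "r \<in> ?K" for r
            using R that by (fastforce simp: Poly_Mapping.in_keys_iff)
          moreover have "Poly_Mapping.lookup n r = 1" if "r \<in> J - ?K" for r
            using R that by (fastforce simp: Poly_Mapping.in_keys_iff)
          moreover have "Poly_Mapping.keys n \<subseteq> I \<union> (J - ?K)"
            using True calculation(1) by (auto simp: Poly_Mapping.in_keys_iff)
          ultimately show ?L by blast
        qed
        then show ?thesis using True by (auto simp: coord_monom_def keys_add_nat lookup_add)
      next
        case False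
        then show ?thesis by (auto simp: coord_monom_def keys_add_nat)
      qed
      then show ?thesis using eq by simp
    qed
  qed simp
  also have "\<dots> = coord_monom I J (m + n)" using J by (simp add: sum.delta)
  finally show ?thesis by simp
qed

text \<open>Bilinear extension of the rule for monomials, one induction for each factor.\<close>

lemma coord_mult:
  assumes J: "finite J" and IJ: "I \<inter> J = {}"
  shows "coord I J (p * q) = (\<Sum>K\<in>Pow J. coord I K p * coord I (J - K) q)"
proof (induction p rule: mpoly_induct)
  case (2 k v p)
  have "coord I J (Poly_Mapping.single k v * q) =
    (\<Sum>K\<in>Pow J. coord I K (Poly_Mapping.single k v) * coord I (J - K) q)"
  proof (induction q rule: mpoly_induct)
    case (2 k' v' q)
    have "coord I J (Poly_Mapping.single k v * Poly_Mapping.single k' v') =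
      (\<Sum>K\<in>Pow J. coord I K (Poly_Mapping.single k v) * coord I (J - K) (Poly_Mapping.single k' v'))"
      unfolding mult_single coord_single coord_monom_add[OF assms]
      by (simp add: sum_distrib_left mult.assoc mult.left_commute mult.commute)
    with 2 show ?case by (simp add: distrib_left coord_add sum.distrib)
  qed simp
  with 2 show ?case by (simp add: distrib_right coord_add sum.distrib)
qed simp

lemma coord_const: "coord I J (pconst c) = (if J = {} then c else 0)"
  by (auto simp: pconst_def coord_single coord_monom_def)

lemma coord_var:
  "coord I J (pvar v) = (if J = {} \<and> v \<in> I \<or> J = {v} then 1 else 0)"
  by (auto simp: pvar_def coord_single coord_monom_def lookup_single when_def)

text \<open>Identifies the scalar part in a block with the evaluation by which
  \<open>C_module\<close> is defined.\<close>

lemma coord_empty: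
  fixes p :: "('v, 'f::field) mpoly"
  shows "coord I {} p = poly_eval (\<lambda>v. if v \<in> I then 1 else 0) p"
proof -
  have "coord_monom I {} m =
    (\<Prod>v\<in>Poly_Mapping.keys m. (if v \<in> I then 1 else 0 :: 'f) ^ Poly_Mapping.lookup m v)"
    for m :: "'v \<Rightarrow>\<^sub>0 nat"
  proof (cases "Poly_Mapping.keys m \<subseteq> I")
    case True
    then show ?thesis by (auto simp: coord_monom_def subset_iff intro!: prod.neutral[symmetric])
  next
    case False
    then obtain v where v: "v \<in> Poly_Mapping.keys m" "v \<notin> I" by blast
    then have "(\<Prod>v\<in>Poly_Mapping.keys m. (if v \<in> I then 1 else 0 :: 'f) ^ Poly_Mapping.lookup m v) = 0"
      by (intro prod_zero) (auto simp: Poly_Mapping.in_keys_iff intro!: bexI[of _ v])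
    then show ?thesis using False by (simp add: coord_monom_def)
  qed
  then show ?thesis by (simp add: coord_def poly_eval_def)
qed

lemma coord_var_mult:
  assumes "finite J" "I \<inter> J = {}"
  shows "coord I J (pvar v * q) =
    (if v \<in> I then coord I J q else if v \<in> J then coord I (J - {v}) q else 0)"
proof -
  have "coord I J (pvar v * q) = (\<Sum>K\<in>Pow J. coord I K (pvar v) * coord I (J - K) q)"
    by (rule coord_mult[OF assms])
  also have "\<dots> = (\<Sum>K\<in>{{}, {v}} \<inter> Pow J. coord I K (pvar v) * coord I (J - K) q)"
    using assms by (intro sum.mono_neutral_right) (auto simp: coord_var)
  also have "{{}, {v}} \<inter> Pow J = (if v \<in> J then {{}, {v}} else {{}})" by auto
  finally show ?thesis using assms(2) by (auto simp: coord_var)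
qed

section \<open>Squarefree monomials and the polynomial ring\<close>

definition set_monom :: "'v set \<Rightarrow> ('v \<Rightarrow>\<^sub>0 nat)" where
  "set_monom S = (\<Sum>v\<in>S. Poly_Mapping.single v 1)"

lemma set_monom_empty [simp]: "set_monom {} = 0"
  by (simp add: set_monom_def)

lemma set_monom_insert: "finite S \<Longrightarrow> v \<notin> S \<Longrightarrow> set_monom (insert v S) = Poly_Mapping.single v 1 + set_monom S"
  by (simp add: set_monom_def)

lemma keys_set_monom: "finite S \<Longrightarrow> Poly_Mapping.keys (set_monom S) = S"
  by (induction S rule: finite_induct) (simp_all add: set_monom_insert keys_add_nat)

lemma lookup_set_monom: "finite S \<Longrightarrow> Poly_Mapping.lookup (set_monom S) v = (if v \<in> S then 1 else 0)"
  by (induction S rule: finite_induct) (auto simp: set_monom_insert lookup_add lookup_single when_def)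

lemma coord_monom_set_monom:
  "finite S \<Longrightarrow> coord_monom I J (set_monom S) = (if J \<subseteq> S \<and> S \<subseteq> I \<union> J then 1 else 0)"
  by (auto simp: coord_monom_def keys_set_monom lookup_set_monom subset_iff)

lemma poly_ring_sel [simp]:
  "monoid.mult (poly_ring V) = (*)" "monoid.one (poly_ring V) = 1"
  "ring.zero (poly_ring V) = 0" "ring.add (poly_ring V) = (+)"
  by (simp_all add: poly_ring_def)

lemma poly_ring_carrier: "p \<in> carrier (poly_ring V) \<longleftrightarrow> (\<forall>m\<in>Poly_Mapping.keys p. Poly_Mapping.keys m \<subseteq> V)"
  by (simp add: poly_ring_def)

lemma poly_ring_closed:
  "p \<in> carrier (poly_ring V) \<Longrightarrow> q \<in> carrier (poly_ring V) \<Longrightarrow> p + q \<in> carrier (poly_ring V)"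
  "p \<in> carrier (poly_ring V) \<Longrightarrow> q \<in> carrier (poly_ring V) \<Longrightarrow> p * q \<in> carrier (poly_ring V)"
  "p \<in> carrier (poly_ring V) \<Longrightarrow> q \<in> carrier (poly_ring V) \<Longrightarrow> p - q \<in> carrier (poly_ring V)"
  "0 \<in> carrier (poly_ring V)" "1 \<in> carrier (poly_ring V)" "pconst c \<in> carrier (poly_ring V)"
proof -
  interpret cring "poly_ring V :: ('a, 'b) mpoly ring" by (rule poly_ring_cring)
  show "p \<in> carrier (poly_ring V) \<Longrightarrow> q \<in> carrier (poly_ring V) \<Longrightarrow> p + q \<in> carrier (poly_ring V)"
    "p \<in> carrier (poly_ring V) \<Longrightarrow> q \<in> carrier (poly_ring V) \<Longrightarrow> p * q \<in> carrier (poly_ring V)"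
    using a_closed[of p q] m_closed[of p q] by simp_all
  show "p \<in> carrier (poly_ring V) \<Longrightarrow> q \<in> carrier (poly_ring V) \<Longrightarrow> p - q \<in> carrier (poly_ring V)"
    using Poly_Mapping.keys_diff[of p q] by (auto simp: poly_ring_carrier)
  show "0 \<in> carrier (poly_ring V)" "1 \<in> carrier (poly_ring V)" "pconst c \<in> carrier (poly_ring V)"
    using zero_closed one_closed by (simp_all add: poly_ring_carrier pconst_def)
qed

lemma poly_ring_minus:
  assumes "p \<in> carrier (poly_ring V)"
  shows "\<ominus>\<^bsub>poly_ring V\<^esub> p = - p"
proof -
  interpret cring "poly_ring V :: ('a, 'b) mpoly ring" by (rule poly_ring_cring)
  have "- p \<in> carrier (poly_ring V)" using assms by (simp add: poly_ring_carrier)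
  then show ?thesis using assms by (intro minus_equality) auto
qed

text \<open>G and R do not determine the coefficient field; \<open>field_type\<close> carries its
  type, so that all abbreviations refer to the same algebra.\<close>

locale hecke = graph G for G :: "('v, 'e) pre_digraph" +
  fixes R :: "'v set" and field_type :: "'f::field itself"
  assumes R_subset: "R \<subseteq> verts G"
begin

abbreviation P where "P \<equiv> poly_ring (verts G) :: ('v, 'f) mpoly ring"
abbreviation H where "H \<equiv> hecke_algebra G R :: ('v, 'f) mpoly set ring"
abbreviation cls where "cls \<equiv> hecke_class G R :: ('v, 'f) mpoly \<Rightarrow> _"
abbreviation \<I> where "\<I> \<equiv> independent_sets (G \<restriction> (verts G - R))"
abbreviation \<J> where "\<J> I \<equiv> independent_sets (G \<restriction> (R - neighbours G I))"

sublocale P: cring P by (rule poly_ring_cring)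
sublocale H: cring H by (rule hecke_cring[OF wf_digraph R_subset])

lemma ideal: "ideal (hecke_ideal G R) P"
  by (rule hecke_ideal_ideal[OF wf_digraph R_subset])

lemma cls_hom: "cls \<in> ring_hom P H"
  using ideal.rcos_ring_hom[OF ideal] unfolding hecke_algebra_def hecke_class_def .

lemma cls_closed [simp]: "p \<in> carrier P \<Longrightarrow> cls p \<in> carrier H"
  by (rule ring_hom_closed[OF cls_hom])

lemma cls_add: "p \<in> carrier P \<Longrightarrow> q \<in> carrier P \<Longrightarrow> cls (p + q) = cls p \<oplus>\<^bsub>H\<^esub> cls q"
  using ring_hom_add[OF cls_hom, of p q] by simp

lemma cls_mult: "p \<in> carrier P \<Longrightarrow> q \<in> carrier P \<Longrightarrow> cls (p * q) = cls p \<otimes>\<^bsub>H\<^esub> cls q"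
  using ring_hom_mult[OF cls_hom, of p q] by simp

lemma cls_1: "cls 1 = \<one>\<^bsub>H\<^esub>"
  using ring_hom_one[OF cls_hom] by simp

lemma cls_0: "cls 0 = \<zero>\<^bsub>H\<^esub>"
  using ring_hom_zero[OF cls_hom P.ring_axioms H.ring_axioms] by simp

lemma cls_minus: "p \<in> carrier P \<Longrightarrow> q \<in> carrier P \<Longrightarrow> cls (p - q) = cls p \<ominus>\<^bsub>H\<^esub> cls q"
proof -
  assume pq: "p \<in> carrier P" "q \<in> carrier P"
  then have d: "p - q \<in> carrier P" by (rule poly_ring_closed)
  then have "cls p = cls (p - q) \<oplus>\<^bsub>H\<^esub> cls q" using cls_add[OF d pq(2)] by simp
  then show ?thesis using pq d by (simp add: H.minus_eq H.a_assoc H.r_neg)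
qed

lemma cls_surj: "x \<in> carrier H \<Longrightarrow> \<exists>p\<in>carrier P. x = cls p"
  by (auto simp: hecke_algebra_def FactRing_def A_RCOSETS_def' hecke_class_def)

lemma cls_eq_0:
  assumes "p \<in> hecke_ideal G R"
  shows "cls p = \<zero>\<^bsub>H\<^esub>"
proof -
  interpret ideal "hecke_ideal G R" P by (rule ideal)
  show ?thesis using a_rcos_const[OF assms] by (simp add: hecke_class_def hecke_algebra_def FactRing_def)
qed

lemma pvar_in [simp]: "v \<in> verts G \<Longrightarrow> pvar v \<in> carrier P"
  by (rule pvar_closed)

lemma relation_in_ideal:
  fixes p :: "('v, 'f) mpoly"
  assumes "p \<in> {(pvar r)\<^sup>2 | r. r \<in> R} \<union> {(pvar v)\<^sup>2 - pvar v | v. v \<in> verts G - R} \<union>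
    {pvar u * pvar v | u v. u \<rightarrow>\<^bsub>G\<^esub> v}"
  shows "p \<in> hecke_ideal G R"
  unfolding hecke_ideal_def
  by (rule subsetD[OF P.genideal_self[OF hecke_relations_closed[OF wf_digraph R_subset]] assms])

lemma cls_square_R: "r \<in> R \<Longrightarrow> cls (pvar r * pvar r) = \<zero>\<^bsub>H\<^esub>"
  by (rule cls_eq_0, rule relation_in_ideal) (auto simp: power2_eq_square[symmetric])

lemma cls_edge: "u \<rightarrow>\<^bsub>G\<^esub> v \<Longrightarrow> cls (pvar u * pvar v) = \<zero>\<^bsub>H\<^esub>"
  by (rule cls_eq_0, rule relation_in_ideal) auto

lemma cls_square:
  assumes "v \<in> verts G - R"
  shows "cls (pvar v * pvar v) = cls (pvar v)"
proof -
  have "cls ((pvar v)\<^sup>2 - pvar v) = \<zero>\<^bsub>H\<^esub>"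
    by (rule cls_eq_0, rule relation_in_ideal) (use assms in auto)
  moreover have "pvar v * pvar v \<in> carrier P" using assms by (intro poly_ring_closed) auto
  ultimately have "cls (pvar v * pvar v) \<ominus>\<^bsub>H\<^esub> cls (pvar v) = \<zero>\<^bsub>H\<^esub>" using assms
    by (simp add: cls_minus[symmetric] power2_eq_square)
  then show ?thesis using assms \<open>pvar v * pvar v \<in> carrier P\<close> by simp
qed

lemma \<I>_iff: "I \<in> \<I> \<longleftrightarrow> I \<subseteq> verts G - R \<and> (\<forall>u\<in>I. \<forall>v\<in>I. \<not> u \<rightarrow>\<^bsub>G\<^esub> v)"
  by (auto simp: independent_sets_def arcs_ends_conv arc_to_ends_def) fast

lemma \<J>_iff: "J \<in> \<J> I \<longleftrightarrow> J \<subseteq> R - neighbours G I \<and> (\<forall>u\<in>J. \<forall>v\<in>J. \<not> u \<rightarrow>\<^bsub>G\<^esub> v)"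
  by (auto simp: independent_sets_def arcs_ends_conv arc_to_ends_def) fast

lemma independent_iff: "S \<in> independent_sets G \<longleftrightarrow> S \<subseteq> verts G \<and> (\<forall>u\<in>S. \<forall>v\<in>S. \<not> u \<rightarrow>\<^bsub>G\<^esub> v)"
  by (simp add: independent_sets_def)

lemma independent_split:
  assumes "S \<in> independent_sets G"
  shows "S - R \<in> \<I>" "S \<inter> R \<in> \<J> (S - R)"
  using assms unfolding \<I>_iff \<J>_iff independent_iff by (auto simp: neighbours_def)

lemma independent_union: "I \<in> \<I> \<Longrightarrow> J \<in> \<J> I \<Longrightarrow> I \<union> J \<in> independent_sets G"
  using R_subset graph_symmetric unfolding \<I>_iff \<J>_iff independent_iff unfolding neighbours_def by blast

lemma index_finite: "I \<in> \<I> \<Longrightarrow> J \<in> \<J> I \<Longrightarrow> finite J" "I \<in> \<I> \<Longrightarrow> finite I"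
  "I \<in> \<I> \<Longrightarrow> J \<in> \<J> I \<Longrightarrow> I \<inter> J = {}"
proof -
  have "finite R" using R_subset finite_verts finite_subset by blast
  then show "I \<in> \<I> \<Longrightarrow> J \<in> \<J> I \<Longrightarrow> finite J" unfolding \<J>_iff by (meson Diff_subset finite_subset)
  show "I \<in> \<I> \<Longrightarrow> finite I" unfolding \<I>_iff by (meson Diff_subset finite_subset finite_verts)
qed (auto simp: \<I>_iff \<J>_iff)

lemma \<J>_subset: "J \<in> \<J> I \<Longrightarrow> K \<subseteq> J \<Longrightarrow> K \<in> \<J> I"
  by (auto simp: \<J>_iff)

section \<open>Reduction to monomials over independent sets\<close>

definition reduced :: "('v, 'f) mpoly \<Rightarrow> bool" where
  "reduced q \<longleftrightarrow> (\<forall>m\<in>Poly_Mapping.keys q. \<exists>S\<in>independent_sets G. m = set_monom S)"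

lemma independent_finite: "S \<in> independent_sets G \<Longrightarrow> finite S"
  by (auto simp: independent_iff intro: finite_subset[OF _ finite_verts])

lemma reduced_closed: "reduced q \<Longrightarrow> q \<in> carrier P"
  by (fastforce simp: reduced_def poly_ring_carrier keys_set_monom independent_finite independent_iff
      dest: independent_finite)

lemma single_closed: "Poly_Mapping.keys m \<subseteq> verts G \<Longrightarrow> Poly_Mapping.single m c \<in> carrier P"
  by (simp add: poly_ring_carrier)

lemma var_times_single: "pvar v * Poly_Mapping.single m c = Poly_Mapping.single (Poly_Mapping.single v 1 + m) c"
  by (simp add: pvar_def mult_single)

lemma var_times_independent:
  assumes v: "v \<in> verts G" and S: "S \<in> independent_sets G"
  shows "cls (pvar v * Poly_Mapping.single (set_monom S) c) = \<zero>\<^bsub>H\<^esub> \<or>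
    (\<exists>T\<in>independent_sets G. cls (pvar v * Poly_Mapping.single (set_monom S) c) = cls (Poly_Mapping.single (set_monom T) c))"
proof -
  have fin: "finite S" by (rule independent_finite[OF S])
  have S_verts: "S \<subseteq> verts G" using S by (simp add: independent_iff)
  have split: "Poly_Mapping.single (set_monom S) c = pvar u * Poly_Mapping.single (set_monom (S - {u})) c"
    "Poly_Mapping.single (set_monom (S - {u})) c \<in> carrier P" if "u \<in> S" for u
  proof -
    have "set_monom S = Poly_Mapping.single u 1 + set_monom (S - {u})"
      using set_monom_insert[of "S - {u}" u] fin that by (simp add: insert_absorb)
    then show "Poly_Mapping.single (set_monom S) c = pvar u * Poly_Mapping.single (set_monom (S - {u})) c"
      by (simp add: var_times_single)
    show "Poly_Mapping.single (set_monom (S - {u})) c \<in> carrier P"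
      using fin S_verts by (intro single_closed) (auto simp: keys_set_monom)
  qed
  have split_cls: "cls (pvar v * Poly_Mapping.single (set_monom S) c) =
      cls (pvar v * pvar u) \<otimes>\<^bsub>H\<^esub> cls (Poly_Mapping.single (set_monom (S - {u})) c)" if u: "u \<in> S" for u
  proof -
    have "u \<in> verts G" using u S_verts by blast
    then have "pvar v * pvar u \<in> carrier P" using v by (intro poly_ring_closed) auto
    then show ?thesis
      unfolding split(1)[OF u] mult.assoc[symmetric] by (rule cls_mult[OF _ split(2)[OF u]])
  qed
  \<comment> \<open>One case for each kind of relation: the square vanishes in R, the square is
    absorbed outside R, an edge kills the product. Otherwise v can be added to S.\<close>
  consider "v \<in> S" "v \<in> R" | "v \<in> S" "v \<notin> R" | u where "u \<in> S" "v \<rightarrow>\<^bsub>G\<^esub> u"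
    | "v \<notin> S" "\<And>u. u \<in> S \<Longrightarrow> \<not> v \<rightarrow>\<^bsub>G\<^esub> u" by blast
  then show ?thesis
  proof cases
    case 1
    then show ?thesis using split_cls[of v] split(2)[of v] by (simp add: cls_square_R)
  next
    case 2
    then have "cls (pvar v * Poly_Mapping.single (set_monom S) c) = cls (Poly_Mapping.single (set_monom S) c)"
      using split_cls[of v] split(1)[of v] cls_mult[OF pvar_in[OF v] split(2)[of v]] v by (simp add: cls_square)
    then show ?thesis using S by blast
  next
    case 3
    then show ?thesis using split_cls[of u] split(2)[of u] by (simp add: cls_edge)
  next
    case 4
    have "insert v S \<in> independent_sets G"
      using 4 S v graph_symmetric adj_not_same unfolding independent_iff by blast
    moreover have "pvar v * Poly_Mapping.single (set_monom S) c = Poly_Mapping.single (set_monom (insert v S)) c"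
      using 4 fin by (simp add: var_times_single set_monom_insert)
    ultimately show ?thesis by auto
  qed
qed

text \<open>\<open>mpoly_induct\<close> is applied to the exponent function, adding a whole power of
  one variable; the inner induction on the exponent multiplies by that variable once at a
  time.\<close>

lemma monomial_reduction:
  fixes m :: "'v \<Rightarrow>\<^sub>0 nat"
  assumes "Poly_Mapping.keys m \<subseteq> verts G"
  shows "cls (Poly_Mapping.single m c) = \<zero>\<^bsub>H\<^esub> \<or>
    (\<exists>T\<in>independent_sets G. cls (Poly_Mapping.single m c) = cls (Poly_Mapping.single (set_monom T) c))"
  using assms
proof (induction m rule: mpoly_induct)
  case 1
  have "{} \<in> independent_sets G" by (simp add: independent_iff)
  then show ?case by (metis set_monom_empty)
next
  case (2 k n m)
  have step: "cls (Poly_Mapping.single (Poly_Mapping.single k n + m) c) = \<zero>\<^bsub>H\<^esub> \<or>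
    (\<exists>T\<in>independent_sets G. cls (Poly_Mapping.single (Poly_Mapping.single k n + m) c) =
       cls (Poly_Mapping.single (set_monom T) c))"
    if "Poly_Mapping.keys (Poly_Mapping.single k n + m) \<subseteq> verts G" for n
    using that
  proof (induction n)
    case 0
    then show ?case using "2.IH" by (simp add: keys_add_nat)
  next
    case (Suc n)
    have k: "k \<in> verts G" and keys: "Poly_Mapping.keys (Poly_Mapping.single k n + m) \<subseteq> verts G"
      using Suc.prems by (auto simp: keys_add_nat split: if_splits)
    have "Poly_Mapping.single k (Suc n) + m = Poly_Mapping.single k 1 + (Poly_Mapping.single k n + m)"
      by (simp add: add.assoc[symmetric] single_add[symmetric])
    then have "cls (Poly_Mapping.single (Poly_Mapping.single k (Suc n) + m) c) =
        cls (pvar k) \<otimes>\<^bsub>H\<^esub> cls (Poly_Mapping.single (Poly_Mapping.single k n + m) c)"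
      using cls_mult[OF pvar_in[OF k] single_closed[OF keys]] by (simp add: var_times_single)
    moreover have "cls (pvar k) \<otimes>\<^bsub>H\<^esub> cls (Poly_Mapping.single (set_monom T) c) =
        cls (pvar k * Poly_Mapping.single (set_monom T) c)" if "T \<in> independent_sets G" for T
    proof -
      have "Poly_Mapping.single (set_monom T) c \<in> carrier P"
        using that independent_finite[OF that] by (intro single_closed) (simp add: keys_set_monom independent_iff)
      then show ?thesis using cls_mult[OF pvar_in[OF k]] by simp
    qed
    ultimately have eq: "cls (Poly_Mapping.single (Poly_Mapping.single k (Suc n) + m) c) =
        cls (pvar k) \<otimes>\<^bsub>H\<^esub> cls (Poly_Mapping.single (Poly_Mapping.single k n + m) c)"
      and eq': "\<And>T. T \<in> independent_sets G \<Longrightarrow> cls (pvar k) \<otimes>\<^bsub>H\<^esub> cls (Poly_Mapping.single (set_monom T) c) =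
        cls (pvar k * Poly_Mapping.single (set_monom T) c)" by auto
    show ?case using Suc.IH[OF keys]
    proof (elim disjE bexE)
      assume "cls (Poly_Mapping.single (Poly_Mapping.single k n + m) c) = \<zero>\<^bsub>H\<^esub>"
      then show ?thesis using k by (simp add: eq)
    next
      fix T assume T: "T \<in> independent_sets G"
        "cls (Poly_Mapping.single (Poly_Mapping.single k n + m) c) = cls (Poly_Mapping.single (set_monom T) c)"
      show ?thesis unfolding eq T(2) eq'[OF T(1)] by (rule var_times_independent[OF k T(1)])
    qed
  qed
  then show ?case using "2.prems" by blast
qed

lemma reduction:
  assumes "p \<in> carrier P"
  shows "\<exists>q. reduced q \<and> cls q = cls p"
  using assms
\<comment> \<open>Updating at a fresh monomial excludes cancellation, so p inherits membership in
  the carrier from the updated polynomial.\<close>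
proof (induction p rule: Poly_Mapping.update_induct)
  case const
  show ?case by (intro exI[of _ 0]) (simp add: reduced_def)
next
  case (update p m c)
  have upd: "Poly_Mapping.update m c p = Poly_Mapping.single m c + p"
    using update(1) by (intro poly_mapping_eqI)
      (auto simp: lookup_add lookup_single lookup_update when_def Poly_Mapping.in_keys_iff)
  have keys: "Poly_Mapping.keys (Poly_Mapping.update m c p) = insert m (Poly_Mapping.keys p)"
    using update(2) by (auto simp: Poly_Mapping.in_keys_iff lookup_update split: if_splits)
  have p: "p \<in> carrier P" and m: "Poly_Mapping.keys m \<subseteq> verts G"
    using update.prems by (auto simp: poly_ring_carrier keys)
  obtain q where q: "reduced q" "cls q = cls p" using update.IH[OF p] by blast
  obtain q' where q': "reduced q'" "cls q' = cls (Poly_Mapping.single m c)"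
    using monomial_reduction[OF m, of c]
  proof (elim disjE bexE)
    assume "cls (Poly_Mapping.single m c) = \<zero>\<^bsub>H\<^esub>"
    then show thesis using that[of 0] by (simp add: reduced_def cls_0)
  next
    fix T assume "T \<in> independent_sets G" "cls (Poly_Mapping.single m c) = cls (Poly_Mapping.single (set_monom T) c)"
    then show thesis
      using that[of "Poly_Mapping.single (set_monom T) c"] by (cases "c = 0") (auto simp: reduced_def)
  qed
  have "reduced (q' + q)"
    using q(1) q'(1) Poly_Mapping.keys_add[of q' q] unfolding reduced_def by blast
  moreover have "cls (q' + q) = cls (Poly_Mapping.update m c p)"
    using q q' reduced_closed p single_closed[OF m] by (simp add: upd cls_add)
  ultimately show ?case by blast
qed

text \<open>
  A minimal independent set S occurring in a reduced polynomial is detected by the coordinate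
  indexed by its parts outside and inside R.
\<close>

lemma reduced_eq_0:
  assumes q: "reduced q" and zero: "\<And>I J. I \<in> \<I> \<Longrightarrow> J \<in> \<J> I \<Longrightarrow> coord I J q = 0"
  shows "q = 0"
proof (rule ccontr)
  assume "q \<noteq> 0"
  let ?\<S> = "{S \<in> independent_sets G. set_monom S \<in> Poly_Mapping.keys q}"
  obtain m where m: "m \<in> Poly_Mapping.keys q" using \<open>q \<noteq> 0\<close> by (metis all_not_in_conv keys_eq_empty)
  then obtain T where "T \<in> independent_sets G" "m = set_monom T" using q unfolding reduced_def by metis
  then have ne: "?\<S> \<noteq> {}" using m by auto
  have "finite (independent_sets G)"
    by (rule finite_subset[of _ "Pow (verts G)"]) (auto simp: independent_iff)
  then have "finite ?\<S>" by simp
  from finite_has_minimal[OF this ne]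
  obtain S where S: "S \<in> ?\<S>" and min: "\<forall>T\<in>?\<S>. T \<subseteq> S \<longrightarrow> S = T" by (rule bexE)
  then have indep: "S \<in> independent_sets G" by simp
  \<comment> \<open>This coordinate sees only those occurring T that lie between
    \<open>S \<inter> R\<close> and S; minimality leaves S alone.\<close>
  have "coord (S - R) (S \<inter> R) q =
    (\<Sum>m\<in>Poly_Mapping.keys q. if m = set_monom S then Poly_Mapping.lookup q (set_monom S) else 0)"
    unfolding coord_def
  proof (rule sum.cong)
    fix m assume m: "m \<in> Poly_Mapping.keys q"
    then obtain T where T: "T \<in> independent_sets G" "m = set_monom T" using q by (auto simp: reduced_def)
    have fin: "finite T" "finite S" using T indep independent_finite by auto
    have "T = S" if "T \<subseteq> S" using bspec[OF min, of T] that T m by simp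
    moreover have "T = S" if "m = set_monom S"
      using keys_set_monom[OF fin(1)] keys_set_monom[OF fin(2)] T that by simp
    ultimately show "Poly_Mapping.lookup q m * coord_monom (S - R) (S \<inter> R) m =
        (if m = set_monom S then Poly_Mapping.lookup q (set_monom S) else 0)"
      using fin T by (auto simp: coord_monom_set_monom)
  qed simp
  also have "\<dots> = Poly_Mapping.lookup q (set_monom S)"
    using S by (simp add: sum.delta)
  finally have "Poly_Mapping.lookup q (set_monom S) = 0"
    using zero[OF independent_split[OF indep]] by simp
  then show False using S by (simp add: Poly_Mapping.in_keys_iff)
qed

text \<open>The common kernel of all coordinates is an ideal, because in the convolution every term
  has a coordinate of p at a subset of J, again an index. It contains the generators:
  \<open>I \<union> J\<close> has no edge, variables of R count with exponent one only, and
  variables outside R become 0 or 1.\<close>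

lemma coord_ideal:
  fixes p :: "('v, 'f) mpoly"
  assumes p: "p \<in> hecke_ideal G R" and I: "I \<in> \<I>" and J: "J \<in> \<J> I"
  shows "coord I J p = 0"
proof -
  let ?K = "{p \<in> carrier P. \<forall>I\<in>\<I>. \<forall>J\<in>\<J> I. coord I J p = 0}"
  have mult: "coord I J (p * q) = 0" if "p \<in> ?K" "I \<in> \<I>" "J \<in> \<J> I" for p q I J
  proof -
    have "coord I J (p * q) = (\<Sum>K\<in>Pow J. coord I K p * coord I (J - K) q)"
      using that by (intro coord_mult index_finite)
    also have "\<dots> = 0"
      using that \<J>_subset[OF that(3)] by (intro sum.neutral) auto
    finally show ?thesis .
  qed
  have "ideal ?K P"
  proof (rule idealI)
    show "subgroup ?K (add_monoid P)"
    proof (rule P.add.subgroupI)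
      show "?K \<noteq> {}" using poly_ring_closed(4) by (auto intro: exI[of _ 0])
    next
      fix p assume "p \<in> ?K" then show "\<ominus>\<^bsub>P\<^esub> p \<in> ?K"
        using P.a_inv_closed[of p] by (simp add: poly_ring_minus coord_uminus)
    next
      fix p q assume "p \<in> ?K" "q \<in> ?K" then show "p \<oplus>\<^bsub>P\<^esub> q \<in> ?K"
        by (simp add: coord_add poly_ring_closed)
    qed auto
    show "ring P" by (rule P.ring_axioms)
  next
    fix p q assume pq: "p \<in> ?K" "q \<in> carrier P"
    then show "p \<otimes>\<^bsub>P\<^esub> q \<in> ?K" using mult[OF pq(1)] by (simp add: poly_ring_closed)
    then show "q \<otimes>\<^bsub>P\<^esub> p \<in> ?K" by (simp add: mult.commute)
  qed
  moreover have "({(pvar r)\<^sup>2 | r. r \<in> R} \<union>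
      {(pvar v)\<^sup>2 - pvar v | v. v \<in> verts G - R} \<union>
      {pvar u * pvar v | u v. u \<rightarrow>\<^bsub>G\<^esub> v}) \<subseteq> ?K" (is "?S \<subseteq> _")
  proof (intro subsetI CollectI conjI ballI)
    fix p assume p: "p \<in> ?S"
    show "p \<in> carrier P" using hecke_relations_closed[OF wf_digraph R_subset] p by (rule subsetD)
    fix I J assume I: "I \<in> \<I>" and J: "J \<in> \<J> I"
    note var_mult = coord_var_mult[OF index_finite(1,3)[OF I J]]
    have IR: "I \<subseteq> verts G - R" "J \<subseteq> R" using I J by (auto simp: \<I>_iff \<J>_iff)
    have "coord I J (pvar u * pvar v) = 0" if "u \<rightarrow>\<^bsub>G\<^esub> v" for u v
    proof -
      have "\<not> (u \<in> I \<union> J \<and> v \<in> I \<union> J)" using independent_union[OF I J] that by (auto simp: independent_iff)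
      then show ?thesis by (auto simp: var_mult coord_var)
    qed
    moreover have "coord I J (pvar r * pvar r) = 0" if "r \<in> R" for r
      using that IR by (auto simp: var_mult coord_var)
    moreover have "coord I J (pvar v * pvar v - pvar v) = 0" if "v \<in> verts G - R" for v
      using that IR by (auto simp: coord_diff var_mult coord_var)
    ultimately show "coord I J p = 0" using p by (auto simp: power2_eq_square)
  qed
  ultimately have "hecke_ideal G R \<subseteq> ?K" unfolding hecke_ideal_def genideal_def by blast
  then show ?thesis using p I J by blast
qed

text \<open>The image of a class is a singleton by \<open>coord_ideal\<close>.\<close>

definition lam :: "'v set \<Rightarrow> 'v set \<Rightarrow> ('v, 'f) mpoly set \<Rightarrow> 'f" where
  "lam I J h = the_elem (coord I J ` h)"

lemma lam_cls:
  assumes "I \<in> \<I>" "J \<in> \<J> I"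
  shows "lam I J (cls p) = coord I J p"
proof -
  interpret ideal "hecke_ideal G R" P by (rule ideal)
  have "coord I J ` cls p = {coord I J p}"
    using additive_subgroup.zero_closed[OF is_additive_subgroup] coord_ideal[OF _ assms]
    by (force simp: hecke_class_def a_r_coset_def' coord_add)
  then show ?thesis by (simp add: lam_def)
qed

abbreviation sc where "sc c \<equiv> cls (pconst c)"
abbreviation b where "b I J \<equiv> X_plus G R (I \<union> J) \<otimes>\<^bsub>H\<^esub> X_minus G R (verts G - R - I)"

section \<open>Coordinates of the basis elements\<close>

lemma lam_gen_mult:
  assumes I: "I \<in> \<I>" and J: "J \<in> \<J> I" and v: "v \<in> verts G" and h: "h \<in> carrier H"
  shows "lam I J (hecke_gen G R v \<otimes>\<^bsub>H\<^esub> h) = (if v \<in> I then lam I J h else if v \<in> J then lam I (J - {v}) h else 0)"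
proof -
  obtain p where p: "p \<in> carrier P" "h = cls p" using cls_surj[OF h] by blast
  have "J - {v} \<in> \<J> I" using \<J>_subset[OF J] by blast
  then show ?thesis
    using p v I J by (simp add: hecke_gen_def cls_mult[symmetric] lam_cls coord_var_mult index_finite)
qed

lemma gen_closed: "v \<in> verts G \<Longrightarrow> hecke_gen G R v \<in> carrier H"
  by (simp add: hecke_gen_def)

lemma X_plus_closed: "U \<subseteq> verts G \<Longrightarrow> X_plus G R U \<in> carrier H"
  unfolding X_plus_def using gen_closed by (intro H.finprod_closed) auto

lemma X_minus_closed: "U \<subseteq> verts G \<Longrightarrow> X_minus G R U \<in> carrier H"
  unfolding X_minus_def using gen_closed by (intro H.finprod_closed) auto

lemma X_plus_insert:
  assumes "finite U" "u \<notin> U" "insert u U \<subseteq> verts G"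
  shows "X_plus G R (insert u U) = hecke_gen G R u \<otimes>\<^bsub>H\<^esub> X_plus G R U"
  unfolding X_plus_def using assms gen_closed by (intro H.finprod_insert) auto

lemma X_minus_insert:
  assumes "finite U" "u \<notin> U" "insert u U \<subseteq> verts G"
  shows "X_minus G R (insert u U) = (\<one>\<^bsub>H\<^esub> \<ominus>\<^bsub>H\<^esub> hecke_gen G R u) \<otimes>\<^bsub>H\<^esub> X_minus G R U"
  unfolding X_minus_def using assms gen_closed by (intro H.finprod_insert) auto

text \<open>In these coordinates a variable of I acts as 1, a variable of J is removed from the
  index, and any other one kills. As the index shrinks, J is arbitrary in the induction.\<close>

lemma lam_X_plus_mult:
  assumes "finite U" "U \<subseteq> verts G" "I \<in> \<I>" "J \<in> \<J> I" "h \<in> carrier H"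
  shows "lam I J (X_plus G R U \<otimes>\<^bsub>H\<^esub> h) = (if U \<subseteq> I \<union> J then lam I (J - U) h else 0)"
  using assms
proof (induction U arbitrary: J rule: finite_induct)
  case empty
  then show ?case by (simp add: X_plus_def)
next
  case (insert u U)
  have c: "hecke_gen G R u \<in> carrier H" "X_plus G R U \<in> carrier H" "X_plus G R U \<otimes>\<^bsub>H\<^esub> h \<in> carrier H"
    using insert.prems gen_closed X_plus_closed by auto
  have "lam I J (X_plus G R (insert u U) \<otimes>\<^bsub>H\<^esub> h) = lam I J (hecke_gen G R u \<otimes>\<^bsub>H\<^esub> (X_plus G R U \<otimes>\<^bsub>H\<^esub> h))"
    using c insert by (simp add: X_plus_insert H.m_assoc)
  also have "\<dots> = (if u \<in> I then lam I J (X_plus G R U \<otimes>\<^bsub>H\<^esub> h)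
      else if u \<in> J then lam I (J - {u}) (X_plus G R U \<otimes>\<^bsub>H\<^esub> h) else 0)"
    using insert.prems c by (intro lam_gen_mult) auto
  also have "\<dots> = (if insert u U \<subseteq> I \<union> J then lam I (J - insert u U) h else 0)"
  proof -
    have "J - {u} \<in> \<J> I" using \<J>_subset[OF insert.prems(3)] by blast
    then have IH: "lam I (J - {u}) (X_plus G R U \<otimes>\<^bsub>H\<^esub> h) = (if U \<subseteq> I \<union> (J - {u}) then lam I (J - {u} - U) h else 0)"
      "lam I J (X_plus G R U \<otimes>\<^bsub>H\<^esub> h) = (if U \<subseteq> I \<union> J then lam I (J - U) h else 0)"
      using insert by auto
    have "U \<subseteq> I \<union> (J - {u}) \<longleftrightarrow> U \<subseteq> I \<union> J" using insert.hyps by auto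
    moreover have "J - {u} - U = J - insert u U" by auto
    moreover have "J - insert u U = J - U" if "u \<in> I" using index_finite(3)[OF insert.prems(2,3)] that by auto
    ultimately show ?thesis by (auto simp: IH)
  qed
  finally show ?case .
qed

lemma lam_add:
  assumes "I \<in> \<I>" "J \<in> \<J> I" "x \<in> carrier H" "y \<in> carrier H"
  shows "lam I J (x \<oplus>\<^bsub>H\<^esub> y) = lam I J x + lam I J y"
proof -
  obtain p q where "p \<in> carrier P" "x = cls p" "q \<in> carrier P" "y = cls q" using cls_surj assms by metis
  then show ?thesis using assms by (simp add: cls_add[symmetric] lam_cls coord_add)
qed

lemma lam_diff:
  assumes "I \<in> \<I>" "J \<in> \<J> I" "x \<in> carrier H" "y \<in> carrier H"
  shows "lam I J (x \<ominus>\<^bsub>H\<^esub> y) = lam I J x - lam I J y"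
  using lam_add[OF assms(1,2), of "x \<ominus>\<^bsub>H\<^esub> y" y] assms by (simp add: H.minus_eq H.a_assoc H.l_neg)

text \<open>A vertex w outside R is never in J, so its variable acts as 1 or 0 according to
  membership in I, and one minus it as 0 or 1.\<close>

lemma lam_X_minus_mult:
  assumes "finite W" "W \<subseteq> verts G - R" "I \<in> \<I>" "J \<in> \<J> I" "h \<in> carrier H"
  shows "lam I J (X_minus G R W \<otimes>\<^bsub>H\<^esub> h) = (if W \<inter> I = {} then lam I J h else 0)"
  using assms
proof (induction W rule: finite_induct)
  case empty
  then show ?case by (simp add: X_minus_def)
next
  case (insert w W)
  let ?h = "X_minus G R W \<otimes>\<^bsub>H\<^esub> h"
  have W: "insert w W \<subseteq> verts G" using insert.prems by auto
  have c: "hecke_gen G R w \<in> carrier H" "X_minus G R W \<in> carrier H" "?h \<in> carrier H"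
    using insert.prems W gen_closed X_minus_closed by auto
  have "X_minus G R (insert w W) \<otimes>\<^bsub>H\<^esub> h = ?h \<ominus>\<^bsub>H\<^esub> hecke_gen G R w \<otimes>\<^bsub>H\<^esub> ?h"
    using c W insert by (simp add: X_minus_insert H.minus_eq H.l_distr H.l_minus H.m_assoc)
  moreover have "w \<notin> J" using insert.prems by (auto simp: \<J>_iff)
  ultimately show ?case
    using insert c W by (simp add: lam_diff lam_gen_mult)
qed

lemma b_closed: "I \<in> \<I> \<Longrightarrow> J \<in> \<J> I \<Longrightarrow> b I J \<in> carrier H"
  using independent_union[of I J] by (intro H.m_closed X_plus_closed X_minus_closed) (auto simp: independent_iff)

lemma lam_const: "I \<in> \<I> \<Longrightarrow> J \<in> \<J> I \<Longrightarrow> lam I J (sc c) = (if J = {} then c else 0)"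
  by (simp add: lam_cls coord_const)

lemma lam_one: "I \<in> \<I> \<Longrightarrow> J \<in> \<J> I \<Longrightarrow> lam I J \<one>\<^bsub>H\<^esub> = (if J = {} then 1 else 0)"
  using lam_const[of I J 1] by (simp add: pconst_def cls_1[symmetric])

lemma lam_b:
  assumes I: "I \<in> \<I>" and J: "J \<in> \<J> I" and I': "I' \<in> \<I>" and J': "J' \<in> \<J> I'"
  shows "lam I' J' (b I J) = (if I' = I \<and> J' = J then 1 else 0)"
proof -
  let ?W = "verts G - R - I"
  have sub: "I \<subseteq> verts G - R" "I' \<subseteq> verts G - R" "J \<subseteq> R" "J' \<subseteq> R"
    using assms by (auto simp: \<I>_iff \<J>_iff)
  have fin: "finite (I \<union> J)" using index_finite assms by auto
  have IJ: "I \<union> J \<subseteq> verts G" using sub R_subset by auto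
  have J'': "J' - (I \<union> J) \<in> \<J> I'" using \<J>_subset[OF J'] by blast
  have W: "X_minus G R ?W \<in> carrier H" by (rule X_minus_closed) auto
  have "lam I' J' (b I J) = (if I \<union> J \<subseteq> I' \<union> J' then lam I' (J' - (I \<union> J)) (X_minus G R ?W) else 0)"
    by (rule lam_X_plus_mult[OF fin IJ I' J' W])
  also have "lam I' (J' - (I \<union> J)) (X_minus G R ?W) =
      (if ?W \<inter> I' = {} then (if J' - (I \<union> J) = {} then 1 else 0) else 0)"
    using lam_X_minus_mult[of ?W I' "J' - (I \<union> J)" "\<one>\<^bsub>H\<^esub>"] I' J'' W by (simp add: lam_one)
  finally have "lam I' J' (b I J) = (if I \<union> J \<subseteq> I' \<union> J' \<and> ?W \<inter> I' = {} \<and> J' - (I \<union> J) = {} then 1 else 0)"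
    by simp
  \<comment> \<open>Intersecting the first inclusion with R and its complement gives one inclusion
    for each of I and J; the other two conditions are the reverse inclusions.\<close>
  moreover have "(I \<union> J \<subseteq> I' \<union> J' \<and> ?W \<inter> I' = {} \<and> J' - (I \<union> J) = {}) \<longleftrightarrow> I' = I \<and> J' = J"
    using sub by blast
  ultimately show ?thesis by simp
qed

sublocale coordinate_algebra H \<I> \<J> lam sc b
proof (unfold_locales)
  show "finite \<I>"
    by (rule finite_subset[of _ "Pow (verts G)"]) (auto simp: \<I>_iff)
  show "{} \<in> \<J> I" for I by (simp add: \<J>_iff)
  show "finite (\<J> I)" for I
  proof (rule finite_subset)
    show "\<J> I \<subseteq> Pow (verts G)" using R_subset by (fastforce simp: \<J>_iff)
  qed simp
  show "lam I J (x \<otimes>\<^bsub>H\<^esub> y) = (\<Sum>K\<in>Pow J. lam I K x * lam I (J - K) y)"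
    if IJ: "I \<in> \<I>" "J \<in> \<J> I" and xy: "x \<in> carrier H" "y \<in> carrier H" for I J x y
  proof -
    obtain p q where pq: "p \<in> carrier P" "x = cls p" "q \<in> carrier P" "y = cls q" using cls_surj xy by metis
    then have "lam I J (x \<otimes>\<^bsub>H\<^esub> y) = coord I J (p * q)"
      using IJ by (simp add: cls_mult[symmetric] lam_cls)
    also have "\<dots> = (\<Sum>K\<in>Pow J. coord I K p * coord I (J - K) q)"
      using IJ by (intro coord_mult index_finite)
    also have "\<dots> = (\<Sum>K\<in>Pow J. lam I K x * lam I (J - K) y)"
    proof (rule sum.cong)
      fix K assume "K \<in> Pow J"
      then have "K \<in> \<J> I" "J - K \<in> \<J> I" using \<J>_subset[OF IJ(2)] by auto
      then show "coord I K p * coord I (J - K) q = lam I K x * lam I (J - K) y"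
        using pq IJ(1) by (simp add: lam_cls)
    qed simp
    finally show ?thesis .
  qed
  show "x = y" if x: "x \<in> carrier H" and y: "y \<in> carrier H"
    and eq: "\<And>I J. I \<in> \<I> \<Longrightarrow> J \<in> \<J> I \<Longrightarrow> lam I J x = lam I J y" for x y
  proof -
    \<comment> \<open>Separation of points: the difference has a reduced representative, all of
      whose coordinates vanish.\<close>
    obtain p where "p \<in> carrier P" "x \<ominus>\<^bsub>H\<^esub> y = cls p" using cls_surj[of "x \<ominus>\<^bsub>H\<^esub> y"] x y by auto
    then obtain q where q: "reduced q" "x \<ominus>\<^bsub>H\<^esub> y = cls q" using reduction[of p] by auto
    have "coord I J q = 0" if "I \<in> \<I>" "J \<in> \<J> I" for I J
      using lam_diff[OF that x y] eq[OF that] that by (simp add: q(2) lam_cls)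
    then have "q = 0" by (rule reduced_eq_0[OF q(1)])
    then have "x \<ominus>\<^bsub>H\<^esub> y = \<zero>\<^bsub>H\<^esub>" by (simp add: q(2) cls_0)
    then show ?thesis using x y by simp
  qed
qed (use index_finite \<J>_subset lam_add lam_b lam_const b_closed in
    \<open>auto simp: poly_ring_closed independent_iff\<close>)

lemma C_module_eq_simple: "C_module I = simple I"
  by (simp add: C_module_def simple_def lam_def coord_empty[abs_def] fun_eq_iff)

lemma P_module_eq_projective: "P_module G R I = projective I"
  by (simp add: P_module_def)

lemma maximal_independent_sets_eq:
  "maximal_independent_sets (G \<restriction> (R - neighbours G I)) = {J \<in> \<J> I. \<forall>K\<in>\<J> I. J \<subseteq> K \<longrightarrow> K = J}"
  by (simp add: maximal_independent_sets_def)

lemma scalar_line_eq: "scalar_line G R (b I J) = line I J"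
  by (simp add: scalar_line_def line_def)

text \<open>The empty set I has no neighbours, so every single vertex of R is then an index.\<close>

lemma trivial_index_iff: "(\<forall>I\<in>\<I>. \<J> I = {{}}) \<longleftrightarrow> R = {}"
proof
  assume triv: "\<forall>I\<in>\<I>. \<J> I = {{}}"
  have "{r} \<in> \<J> {}" if "r \<in> R" for r
    using that adj_not_same unfolding \<J>_iff by (auto simp: neighbours_def)
  moreover have "{} \<in> \<I>" by (simp add: \<I>_iff)
  ultimately show "R = {}" using triv by fastforce
next
  assume R: "R = {}"
  have "J \<in> \<J> I \<longleftrightarrow> J = {}" for I J unfolding \<J>_iff using R by auto
  then show "\<forall>I\<in>\<I>. \<J> I = {{}}" by blast
qed

section \<open>Induction from the algebra of G - R\<close>

lemma cls_prod_pvar: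
  assumes "finite U" "U \<subseteq> verts G"
  shows "(\<Prod>u\<in>U. pvar u) \<in> carrier P \<and> cls (\<Prod>u\<in>U. pvar u) = X_plus G R U"
  using assms
proof (induction U rule: finite_induct)
  case empty
  then show ?case by (simp add: X_plus_def cls_1 poly_ring_closed)
next
  case (insert u U)
  then show ?case by (simp add: X_plus_insert cls_mult poly_ring_closed hecke_gen_def)
qed

lemma cls_prod_one_minus_pvar:
  assumes "finite U" "U \<subseteq> verts G"
  shows "(\<Prod>u\<in>U. 1 - pvar u) \<in> carrier P \<and> cls (\<Prod>u\<in>U. 1 - pvar u) = X_minus G R U"
  using assms
proof (induction U rule: finite_induct)
  case empty
  then show ?case by (simp add: X_minus_def cls_1 poly_ring_closed)
next
  case (insert u U)
  have "1 - pvar u \<in> carrier P" using insert by (intro poly_ring_closed) auto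
  moreover have "cls (1 - pvar u) = \<one>\<^bsub>H\<^esub> \<ominus>\<^bsub>H\<^esub> hecke_gen G R u"
    using insert by (simp add: cls_minus cls_1 poly_ring_closed hecke_gen_def)
  ultimately show ?case using insert by (simp add: X_minus_insert cls_mult poly_ring_closed)
qed

text \<open>No variable of J occurs in p, whereas the coordinate requires exponent one. Hence the
  subalgebra acts on \<open>b I {}\<close> by scalars.\<close>

lemma coord_outside_R:
  assumes "p \<in> carrier (poly_ring (verts G - R))" "J \<subseteq> R" "J \<noteq> {}"
  shows "coord I J p = 0"
  unfolding coord_def
proof (intro sum.neutral ballI)
  fix m assume "m \<in> Poly_Mapping.keys p"
  then have "Poly_Mapping.keys m \<subseteq> verts G - R" using assms(1) by (simp add: poly_ring_carrier)
  moreover obtain r where r: "r \<in> J" "r \<in> R" using assms(2,3) by blast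
  ultimately have "Poly_Mapping.lookup m r = 0" by (auto simp: Poly_Mapping.in_keys_iff)
  then show "Poly_Mapping.lookup p m * coord_monom I J m = 0" using r by (force simp: coord_monom_def)
qed

lemma prod_closed:
  assumes "\<And>u. u \<in> U \<Longrightarrow> f u \<in> carrier (poly_ring V)"
  shows "(\<Prod>u\<in>U. f u) \<in> carrier (poly_ring V)"
  using assms by (induction U rule: infinite_finite_induct) (auto simp: poly_ring_closed)

text \<open>An instance of \<open>scalar_extension\<close>, with evaluation at the indicator
  function of I as character and \<open>b I {}\<close> as idempotent.\<close>

lemma projective_iso_extension:
  assumes I: "I \<in> \<I>"
  shows "module_iso H (projective I)
    (extension_of_scalars (hecke_algebra (G \<restriction> (verts G - R)) {}) (hecke_incl G R) H (C_module I))"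
proof -
  let ?G = "G \<restriction> (verts G - R)"
  let ?B = "hecke_algebra ?G {} :: ('v, 'f) mpoly set ring" and ?P = "poly_ring (verts G - R) :: ('v, 'f) mpoly ring"
  let ?cls = "hecke_class ?G {} :: ('v, 'f) mpoly \<Rightarrow> _"
  let ?ind = "\<lambda>v. if v \<in> I then 1 else 0 :: 'f"
  define \<chi> :: "('v, 'f) mpoly set \<Rightarrow> 'f" where "\<chi> h = the_elem (poly_eval ?ind ` h)" for h
  have graph: "graph G" by unfold_locales
  have wf: "wf_digraph ?G" by (rule wellformed_induce_subgraph)
  have "hecke_zero ?G {} ?ind"
    using I by (auto simp: hecke_zero_def independent_sets_def)
  from the_elem_poly_eval[OF wf _ this] have \<chi>: "\<chi> (?cls p) = poly_eval ?ind p" for p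
    by (simp add: \<chi>_def)
  have incl: "hecke_incl G R (?cls p) = cls p" for p
    by (rule hecke_incl_class[OF graph R_subset])
  have sub: "carrier ?P \<subseteq> carrier P" by (fastforce simp: poly_ring_carrier)
  have B: "x \<in> carrier ?B \<longleftrightarrow> (\<exists>p\<in>carrier ?P. x = ?cls p)" for x
    by (auto simp: hecke_algebra_def FactRing_def A_RCOSETS_def' hecke_class_def)
  have e: "b I {} \<in> carrier H" using b_closed[OF I empty_index[OF I]] by simp
  interpret scalar_extension H ?B "hecke_incl G R" "C_module I :: (('v, 'f) mpoly set, 'f) module" \<chi> sc "b I {}"
  proof unfold_locales
    show "hecke_incl G R x \<in> carrier H" if "x \<in> carrier ?B" for x
      using that sub by (auto simp: B incl)
    show "b I {} \<otimes>\<^bsub>H\<^esub> b I {} = b I {}" using basis_idempotent[OF I] by (simp add: idempotent_def)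
    show "x \<odot>\<^bsub>C_module I\<^esub> c = \<chi> x * c" for x and c :: 'f by (simp add: C_module_def \<chi>_def)
    show "hecke_incl G R x \<otimes>\<^bsub>H\<^esub> b I {} = sc (\<chi> x) \<otimes>\<^bsub>H\<^esub> b I {}" if x: "x \<in> carrier ?B" for x
    proof -
      obtain p where p: "p \<in> carrier ?P" "x = ?cls p" using x unfolding B by (rule bexE)
      have pP: "p \<in> carrier P" by (rule subsetD[OF sub p(1)])
      have "cls p \<otimes>\<^bsub>H\<^esub> b I {} = sc (poly_eval ?ind p) \<otimes>\<^bsub>H\<^esub> b I {}"
      proof (rule lam_inject)
        fix I' J assume I': "I' \<in> \<I>" "J \<in> \<J> I'"
        have "coord I J p = 0" if "J \<noteq> {}"
          by (rule coord_outside_R[OF p(1) _ that]) (use I' in \<open>auto simp: \<J>_iff\<close>)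
        then show "lam I' J (cls p \<otimes>\<^bsub>H\<^esub> b I {}) = lam I' J (sc (poly_eval ?ind p) \<otimes>\<^bsub>H\<^esub> b I {})"
          using mult_idempotent[OF I _ I', of "cls p"] mult_idempotent[OF I _ I', of "sc (poly_eval ?ind p)"] I' pP
          by (auto simp: lam_cls coord_const coord_empty poly_ring_closed)
      qed (use pP e in auto)
      then show ?thesis by (simp add: p(2) incl \<chi>)
    qed
    show "\<exists>x\<in>carrier ?B. hecke_incl G R x = b I {} \<and> \<chi> x = 1"
    proof -
      \<comment> \<open>A representative of the idempotent using only variables outside R, which
        lifts it to the algebra of G - R.\<close>
      let ?p = "(\<Prod>u\<in>I. pvar u) * (\<Prod>u\<in>verts G - R - I. 1 - pvar u) :: ('v, 'f) mpoly"
      have IV: "I \<subseteq> verts G - R" using I by (simp add: \<I>_iff)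
      have p: "?p \<in> carrier ?P"
        using IV by (intro poly_ring_closed prod_closed pvar_closed) auto
      have clsp: "cls ?p = b I {}"
        using cls_prod_pvar[of I] cls_prod_one_minus_pvar[of "verts G - R - I"] IV index_finite(2)[OF I]
        by (simp add: cls_mult subset_iff)
      have "\<chi> (?cls ?p) = lam I {} (cls ?p)"
        using I empty_index by (simp add: \<chi> lam_cls coord_empty)
      also have "\<dots> = 1" unfolding clsp using lam_b[OF I empty_index[OF I] I empty_index[OF I]] by simp
      finally show ?thesis using p clsp by (intro bexI[of _ "?cls ?p"]) (auto simp: B incl)
    qed
    show "\<exists>x\<in>carrier ?B. hecke_incl G R x = sc c \<and> \<chi> x = c" for c
      by (intro bexI[of _ "?cls (pconst c)"]) (auto simp: B incl \<chi> poly_eval_const poly_ring_closed)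
  qed (use e sc_add sc_mult sc_1 in \<open>auto simp: C_module_def\<close>)
  show ?thesis using module_iso_extension_of_scalars by simp
qed

end

theorem corollary6p6:
  fixes G :: "('v, 'e) pre_digraph" and R :: "'v set"
  assumes "graph G" and "R \<subseteq> verts G"
  shows
    "(semisimple_algebra (hecke_algebra G R :: ('v, 'f::field) mpoly set ring) \<longleftrightarrow> R = {})
   \<and> (\<forall>I \<in> independent_sets (G \<restriction> (verts G - R)).
        module_iso (hecke_algebra G R :: ('v, 'f) mpoly set ring)
          (P_module G R I)
          (extension_of_scalars
             (hecke_algebra (G \<restriction> (verts G - R)) {}) (hecke_incl G R)
             (hecke_algebra G R)
             (C_module I :: (('v, 'f) mpoly set, 'f) module)))
   \<and> (\<forall>I \<in> independent_sets (G \<restriction> (verts G - R)).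
        let H = (hecke_algebra G R :: ('v, 'f) mpoly set ring);
            P = P_module G R I;
            L = (\<lambda>J. scalar_line G R (X_plus G R (I \<union> J) \<otimes>\<^bsub>H\<^esub> X_minus G R (verts G - R - I)));
            \<J> = maximal_independent_sets (G \<restriction> (R - neighbours G I))
        in internal_direct_sum H P \<J> L (socle H P)
           \<and> (\<forall>J\<in>\<J>. module_iso H (P\<lparr>carrier := L J\<rparr>) (C_module I :: (('v, 'f) mpoly set, 'f) module)))
   \<and> (\<forall>I \<in> independent_sets (G \<restriction> (verts G - R)).
      \<forall>J \<in> independent_sets (G \<restriction> (verts G - R)).
        cartan_entry TYPE('f) G R I J =
          (if I = J then card (independent_sets (G \<restriction> (R - neighbours G I))) else 0))
   \<and> complete_primitive_orthogonal_idempotents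
       (hecke_algebra G R :: ('v, 'f) mpoly set ring)
       (independent_sets (G \<restriction> (verts G - R)))
       (\<lambda>I. X_plus G R I \<otimes>\<^bsub>hecke_algebra G R\<^esub> X_minus G R (verts G - R - I))"
proof -
  interpret hecke G R "TYPE('f)"
    using assms by (simp add: hecke_def hecke_axioms_def)
  show ?thesis
  proof (intro conjI ballI)
    show "semisimple_algebra H \<longleftrightarrow> R = {}"
      unfolding semisimple_iff by (rule trivial_index_iff)
  next
    fix I assume "I \<in> \<I>"
    then show "module_iso H (P_module G R I)
      (extension_of_scalars (hecke_algebra (G \<restriction> (verts G - R)) {}) (hecke_incl G R) H (C_module I))"
      unfolding P_module_eq_projective by (rule projective_iso_extension)
  next
    fix I assume I: "I \<in> \<I>"
    show "let H = H; P = P_module G R I; L = (\<lambda>J. scalar_line G R (X_plus G R (I \<union> J) \<otimes>\<^bsub>H\<^esub> X_minus G R (verts G - R - I)));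
        \<J> = maximal_independent_sets (G \<restriction> (R - neighbours G I))
      in internal_direct_sum H P \<J> L (socle H P) \<and>
        (\<forall>J\<in>\<J>. module_iso H (P\<lparr>carrier := L J\<rparr>) (C_module I :: (('v, 'f) mpoly set, 'f) module))"
      unfolding Let_def scalar_line_eq P_module_eq_projective maximal_independent_sets_eq C_module_eq_simple
      using socle_projective[OF I] by blast
  next
    fix I J assume "I \<in> \<I>" "J \<in> \<I>"
    then show "cartan_entry TYPE('f) G R I J = (if I = J then card (\<J> I) else 0)"
      unfolding cartan_entry_def P_module_eq_projective C_module_eq_simple
      by (rule composition_multiplicity_projective)
  next
    show "complete_primitive_orthogonal_idempotents H \<I>
       (\<lambda>I. X_plus G R I \<otimes>\<^bsub>H\<^esub> X_minus G R (verts G - R - I))"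
      \<comment> \<open>These are the basis elements with J empty, up to
        \<open>I \<union> {} = I\<close>.\<close>
      using complete_idempotents by simp
  qed
qed

end
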